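(* Let $\mathcal{U}\subset\mathbb{R}^{2\times2}_{sym}$ be a finite coplanar set of wells. If $\mathcal{U}$ is a basic configuration, then $L^e(\mathcal{U})=Q^e(\mathcal{U})$.
   Context: $\mathbb{R}^{2\times 2}_{sym}$ is the space of real symmetric $2\times2$ matrices (called wells when they belong to a given finite set) with the Frobenius inner product $\langle\cdot,\cdot\rangle$; $C(\cdot)$ denotes the convex hull. A finite set $\mathcal{U}\subset\mathbb{R}^{2\times2}_{sym}$ is coplanar if there exist a nonzero $Q\in\mathbb{R}^{2\times2}_{sym}$ and $\delta\in\mathbb{R}$ such that $\langle Q,U\rangle=\delta$ for every $U\in\mathcal{U}$. Compatibility. $M_1,M_2\in\mathbb{R}^{2\times2}_{sym}$ are compatible if there is a skew-symmetric $S$ with $\operatorname{rank}(M_1-M_2+S)\le 1$ (equivalently, $\det(M_1-M_2)\le 0$), incompatible otherwise ($\det(M_1-M_2)>0$), and rank-one compatible if $\det(M_1-M_2)=0$. A matrix counts as compatible with itself. Basic blocks. A three-well basic block is a set of three distinct coplanar wells whose three pairs consist of one compatible but not rank-one compatible pair ($\det<0$), one rank-one compatible pair ($\det=0$), and one incompatible pair ($\det>0$). A four-well basic block is a set of four distinct coplanar wells $\{V_1,V_2,W_1,W_2\}$, contained in a plane whose normal $Q$ satisfies $\det Q<0$, such that $\{V_1,V_2\}$ and $\{W_1,W_2\}$ are rank-one compatible pairs, and the two segments $C(\{V_1,V_2\})$ and $C(\{W_1,W_2\})$ lie on different lines and intersect at a single point $U_0$ (the center of the block) lying in the relative interior of both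 segments. Basic configuration. A finite coplanar set $\mathcal{U}$ is a basic configuration if no three distinct wells of $\mathcal{U}$ are collinear and $\mathcal{U}=\mathcal{U}_1\cup\dots\cup\mathcal{U}_n$ for some $n\ge1$, where each $\mathcal{U}_i$ is a (three-well or four-well) basic block and, for each $1\le i<n$, the adjacent blocks $\mathcal{U}_i,\mathcal{U}_{i+1}$ share exactly two wells, $\mathcal{U}_i\cap\mathcal{U}_{i+1}=\{V_i,W_i\}$, with $\det(V_i-W_i)<0$ (i.e. compatible but not rank-one compatible). Symmetric lamination convex hull. $L^{e,0}(\mathcal{U})=\mathcal{U}$, $L^{e,i+1}(\mathcal{U})=\{\lambda A+(1-\lambda)B\;|\;\lambda\in[0,1],\ A,B\in L^{e,i}(\mathcal{U})\text{ compatible}\}$, and $L^e(\mathcal{U})=\bigcup_{i\ge0}L^{e,i}(\mathcal{U})$. Symmetric quasiconvex hull. For a differentiable $\phi$ with values in $\mathbb{R}^2$, $e(D\phi)=(D\phi+(D\phi)^T)/2$. A Borel measurable, locally bounded function $f:\mathbb{R}^{2\times2}_{sym}\to\mathbb{R}$ is symmetric quasiconvex if for every $U\in\mathbb{R}^{2\times2}_{sym}$ $$f(U)\le\inf\left\{\frac1{|\Omega|}\int_\Omega f(U+e(D\phi))\,dx\;\middle|\;\phi\in C_0^\infty(\Omega,\mathbb{R}^2)\right\},$$ where $\Omega\subset\mathbb{R}^2$ is a bounded domain. For compact $\mathcal{U}\subset\mathbb{R}^{2\times2}_{sym}$, $$Q^e(\mathcal{U})=\{A\in\mathbb{R}^{2\times2}_{sym}\;|\;f(A)\le\sup_{B\in\mathcal{U}}f(B)\text{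 for every symmetric quasiconvex }f:\mathbb{R}^{2\times 2}_{sym}\to\mathbb{R}\}.$$ *)

theory Defs
  imports "HOL-Analysis.Analysis"
begin

(* The inner product of the library on real^2^2 is the Frobenius inner product. *)

type_synonym mat2 = "real^2^2"

definition sym_mats :: "mat2 set" where
  "sym_mats = {A. transpose A = A}"

definition coplanar_wells :: "mat2 set \<Rightarrow> bool" where
  "coplanar_wells U \<longleftrightarrow>
     U \<subseteq> sym_mats \<and> (\<exists>Q\<in>sym_mats. \<exists>\<delta>::real. Q \<noteq> 0 \<and> (\<forall>A\<in>U. Q \<bullet> A = \<delta>))"

definition compatible :: "mat2 \<Rightarrow> mat2 \<Rightarrow> bool" where
  "compatible A B \<longleftrightarrow> (\<exists>S::mat2. transpose S = - S \<and> rank (A - B + S) \<le> 1)"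

definition rank_one_compatible :: "mat2 \<Rightarrow> mat2 \<Rightarrow> bool" where
  "rank_one_compatible A B \<longleftrightarrow> det (A - B) = 0"

(* Every assignment of the three pair types to the three pairs arises from some
   labelling A, B, C of the wells. *)
definition three_well_block :: "mat2 set \<Rightarrow> bool" where
  "three_well_block U \<longleftrightarrow> coplanar_wells U \<and>
     (\<exists>A B C. U = {A, B, C} \<and> distinct [A, B, C] \<and>
        (compatible A B \<and> \<not> rank_one_compatible A B) \<and>
        rank_one_compatible B C \<and>
        \<not> compatible A C)"

definition four_well_block :: "mat2 set \<Rightarrow> bool" where
  "four_well_block U \<longleftrightarrow> U \<subseteq> sym_mats \<and>
     (\<exists>Q\<in>sym_mats. \<exists>\<delta>::real. det Q < 0 \<and> (\<forall>A\<in>U. Q \<bullet> A = \<delta>)) \<and>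
     (\<exists>V1 V2 W1 W2. U = {V1, V2, W1, W2} \<and> distinct [V1, V2, W1, W2] \<and>
        rank_one_compatible V1 V2 \<and> rank_one_compatible W1 W2 \<and>
        affine hull {V1, V2} \<noteq> affine hull {W1, W2} \<and>
        (\<exists>U0. convex hull {V1, V2} \<inter> convex hull {W1, W2} = {U0} \<and>
              U0 \<in> rel_interior (convex hull {V1, V2}) \<and>
              U0 \<in> rel_interior (convex hull {W1, W2})))"

definition basic_block :: "mat2 set \<Rightarrow> bool" where
  "basic_block U \<longleftrightarrow> three_well_block U \<or> four_well_block U"

definition basic_configuration :: "mat2 set \<Rightarrow> bool" where
  "basic_configuration U \<longleftrightarrow> finite U \<and> coplanar_wells U \<and>
     (\<forall>A\<in>U. \<forall>B\<in>U. \<forall>C\<in>U. distinct [A, B, C] \<longrightarrow> \<not> collinear {A, B, C}) \<and>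
     (\<exists>n\<ge>1. \<exists>Ub :: nat \<Rightarrow> mat2 set.
        U = (\<Union>i\<in>{1..n}. Ub i) \<and>
        (\<forall>i\<in>{1..n}. basic_block (Ub i)) \<and>
        (\<forall>i. 1 \<le> i \<and> i < n \<longrightarrow>
           (\<exists>V W. V \<noteq> W \<and> Ub i \<inter> Ub (i + 1) = {V, W} \<and> det (V - W) < 0)))"

primrec lamination :: "nat \<Rightarrow> mat2 set \<Rightarrow> mat2 set" where
  "lamination 0 U = U"
| "lamination (Suc i) U =
     {l *\<^sub>R A + (1 - l) *\<^sub>R B | l A B.
        l \<in> {0..1} \<and> A \<in> lamination i U \<and> B \<in> lamination i U \<and> compatible A B}"

definition sym_lamination_hull :: "mat2 set \<Rightarrow> mat2 set" where
  "sym_lamination_hull U = (\<Union>i. lamination i U)"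

(* In finite dimension a map is C^(k+1) iff it is differentiable and all its
   directional derivatives are C^k. *)
primrec Ck :: "nat \<Rightarrow> (real^2 \<Rightarrow> real^2) \<Rightarrow> bool" where
  "Ck 0 \<phi> \<longleftrightarrow> continuous_on UNIV \<phi>"
| "Ck (Suc k) \<phi> \<longleftrightarrow> (\<forall>x. \<phi> differentiable (at x)) \<and>
     (\<forall>v. Ck k (\<lambda>x. frechet_derivative \<phi> (at x) v))"

(* Test functions on \<Omega> are represented by their extension by zero to the whole plane. *)
definition test_functions :: "(real^2) set \<Rightarrow> (real^2 \<Rightarrow> real^2) set" where
  "test_functions \<Omega> = {\<phi>. (\<forall>k. Ck k \<phi>) \<and>
     compact (closure {x. \<phi> x \<noteq> 0}) \<and> closure {x. \<phi> x \<noteq> 0} \<subseteq> \<Omega>}"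

definition sym_gradient :: "(real^2 \<Rightarrow> real^2) \<Rightarrow> real^2 \<Rightarrow> mat2" where
  "sym_gradient \<phi> x =
     (1/2) *\<^sub>R (jacobian \<phi> (at x) + transpose (jacobian \<phi> (at x)))"

definition bounded_domain :: "(real^2) set \<Rightarrow> bool" where
  "bounded_domain \<Omega> \<longleftrightarrow> \<Omega> \<noteq> {} \<and> open \<Omega> \<and> connected \<Omega> \<and> bounded \<Omega>"

definition locally_bounded_on_sym :: "(mat2 \<Rightarrow> real) \<Rightarrow> bool" where
  "locally_bounded_on_sym f \<longleftrightarrow> (\<forall>A\<in>sym_mats. \<exists>r>0. bounded (f ` (ball A r \<inter> sym_mats)))"

(* A function on symmetric matrices is represented by a total function on mat2 whose
   values outside sym_mats are irrelevant.  Infimum and supremum are taken in ereal,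
   where an unbounded infimum and an empty supremum have their usual meaning.  By
   translation, scaling and extension by zero of the test functions, the condition does
   not depend on the choice of the bounded domain. *)
definition sym_quasiconvex :: "(mat2 \<Rightarrow> real) \<Rightarrow> bool" where
  "sym_quasiconvex f \<longleftrightarrow>
     f \<in> borel_measurable (restrict_space borel sym_mats) \<and>
     locally_bounded_on_sym f \<and>
     (\<forall>\<Omega>. bounded_domain \<Omega> \<longrightarrow> (\<forall>A\<in>sym_mats.
        ereal (f A) \<le> (INF \<phi>\<in>test_functions \<Omega>.
          ereal (1 / measure lborel \<Omega> * (LINT x:\<Omega>|lborel. f (A + sym_gradient \<phi> x))))))"

definition sym_quasiconvex_hull :: "mat2 set \<Rightarrow> mat2 set" where
  "sym_quasiconvex_hull U = {A \<in> sym_mats.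
     \<forall>f. sym_quasiconvex f \<longrightarrow> ereal (f A) \<le> (SUP B\<in>U. ereal (f B))}"

end

theory Submission
  imports Defs
begin

text \<open>
  The lamination hull lies in the quasiconvex hull because a symmetric quasiconvex \<open>f\<close> is convex on
  segments with compatible end points: for \<open>A - B\<close> the symmetric part of \<open>a \<otimes> b\<close>, test with a
  smoothed tent profile in \<open>b \<bullet> x\<close>, times \<open>a\<close>, cut off on long boxes orthogonal to \<open>b\<close>.

  Conversely, the incompatible pair in every block forces the normal \<open>Q\<close> of the plane of the wells to
  satisfy \<open>det Q < 0\<close>, so the plane has coordinates \<open>(x, y)\<close> in which \<open>det (A - B)\<close> is the product of
  the two coordinate differences. Going along the chain of blocks, and since no three wells are
  aligned, the wells are exactly points \<open>(x i, y (i + 1))\<close> and \<open>(x (i + 1), y i)\<close> of a staircase for two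
  increasing sequences \<open>x\<close>, \<open>y\<close>, where at each end at most one of the two points may be missing. The
  functions \<open>- det (M - P)\<close> with \<open>P = (x i, y i)\<close> are symmetric quasiconvex and not positive on the wells;
  together with affine functions they confine the quasiconvex hull to the boxes between consecutive
  corners, with triangles or segments at the ends, and all these are reached by laminations.
\<close>

section \<open>Smooth functions of one variable\<close>

text \<open>A symmetric quasiconvex \<open>f\<close> is only Borel and locally bounded, so gradients
  close to \<open>A\<close> or \<open>B\<close> give no information: the test field has to equal
  \<open>A\<close> or \<open>B\<close> exactly on almost all of the domain and to stay in one fixed
  compact set on the rest, where only a bound on \<open>f\<close> is available. This is why the
  profiles carry derivative bounds uniform in the width of the layers and in the length of the box.

  The determinant enters because det e(D phi) is det D phi, a null Lagrangian, minus a quarter of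
  the squared curl. In the coordinates, \<open>- det (M - P)\<close> is nonpositive exactly on two
  opposite closed quadrants with vertex \<open>P\<close>, so using it at every corner leaves a chain
  of boxes. A corner shared by two consecutive boxes lies on a rank-one segment between two wells,
  hence is reached, and in either box it spans with the compatible pair there a triangle filled by
  laminations. Only at an end where both points are present is the outer corner out of reach; there
  an affine function cuts the box along its antidiagonal.\<close>

primrec Ck_real :: "nat \<Rightarrow> (real \<Rightarrow> real) \<Rightarrow> bool" where
  "Ck_real 0 g \<longleftrightarrow> continuous_on UNIV g"
| "Ck_real (Suc n) g \<longleftrightarrow> (\<exists>g'. (\<forall>t. (g has_real_derivative g' t) (at t)) \<and> Ck_real n g')"

definition smooth_real :: "(real \<Rightarrow> real) \<Rightarrow> bool" where
  "smooth_real g \<longleftrightarrow> (\<forall>n. Ck_real n g)"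

lemma Ck_real_SucI:
  "(\<And>t. (g has_real_derivative g' t) (at t)) \<Longrightarrow> Ck_real n g' \<Longrightarrow> Ck_real (Suc n) g"
  unfolding Ck_real.simps(2) by blast

lemma Ck_real_SucE:
  assumes "Ck_real (Suc n) g"
  obtains g' where "\<And>t. (g has_real_derivative g' t) (at t)" "Ck_real n g'"
  using assms unfolding Ck_real.simps(2) by blast

declare Ck_real.simps(2) [simp del]

lemma Ck_real_Suc_imp: "Ck_real (Suc n) g \<Longrightarrow> Ck_real n g"
proof (induction n arbitrary: g)
  case 0
  then obtain g' where "\<And>t. (g has_real_derivative g' t) (at t)" by (rule Ck_real_SucE) blast
  then show ?case
    by (auto simp: continuous_on_eq_continuous_at intro: DERIV_isCont)
next
  case (Suc n)
  from Suc.prems obtain g' where g': "\<And>t. (g has_real_derivative g' t) (at t)" "Ck_real (Suc n) g'"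
    by (rule Ck_real_SucE) blast
  show ?case by (rule Ck_real_SucI[OF g'(1) Suc.IH[OF g'(2)]])
qed

lemma Ck_real_deriv:
  assumes "Ck_real (Suc n) g" "\<And>t. (g has_real_derivative g' t) (at t)"
  shows "Ck_real n g'"
proof -
  from assms(1) obtain h where h: "\<And>t. (g has_real_derivative h t) (at t)" "Ck_real n h"
    by (rule Ck_real_SucE) blast
  have "h t = g' t" for t using h(1)[of t] assms(2)[of t] by (rule DERIV_unique)
  then have "h = g'" by (rule ext)
  with h show ?thesis by simp
qed

lemma smooth_realE:
  assumes "smooth_real g"
  obtains g' where "\<And>t. (g has_real_derivative g' t) (at t)" "smooth_real g'"
proof -
  have g: "Ck_real n g" for n using assms by (simp add: smooth_real_def)
  from g[of "Suc 0"] obtain h where h: "\<And>t. (g has_real_derivative h t) (at t)"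
    by (rule Ck_real_SucE) blast
  moreover have "smooth_real h"
    unfolding smooth_real_def using Ck_real_deriv[OF g h] by simp
  ultimately show ?thesis by (rule that)
qed

lemma Ck_real_const: "Ck_real n (\<lambda>_. c)"
proof (induction n arbitrary: c)
  case (Suc n)
  show ?case by (rule Ck_real_SucI[OF _ Suc]) (rule DERIV_const)
qed simp

lemma Ck_real_id: "Ck_real n (\<lambda>t. t)"
proof (cases n)
  case (Suc m)
  show ?thesis unfolding Suc by (rule Ck_real_SucI[OF _ Ck_real_const]) (rule DERIV_ident)
qed simp

lemma Ck_real_add: "Ck_real n f \<Longrightarrow> Ck_real n g \<Longrightarrow> Ck_real n (\<lambda>t. f t + g t)"
proof (induction n arbitrary: f g)
  case (Suc n)
  from Suc.prems(1) obtain f' where f: "\<And>t. (f has_real_derivative f' t) (at t)" "Ck_real n f'"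
    by (rule Ck_real_SucE) blast
  from Suc.prems(2) obtain g' where g: "\<And>t. (g has_real_derivative g' t) (at t)" "Ck_real n g'"
    by (rule Ck_real_SucE) blast
  show ?case by (rule Ck_real_SucI[OF DERIV_add[OF f(1) g(1)] Suc.IH[OF f(2) g(2)]])
qed (simp add: continuous_on_add)

lemma Ck_real_mult: "Ck_real n f \<Longrightarrow> Ck_real n g \<Longrightarrow> Ck_real n (\<lambda>t. f t * g t)"
proof (induction n arbitrary: f g)
  case (Suc n)
  from Suc.prems(1) obtain f' where f: "\<And>t. (f has_real_derivative f' t) (at t)" "Ck_real n f'"
    by (rule Ck_real_SucE) blast
  from Suc.prems(2) obtain g' where g: "\<And>t. (g has_real_derivative g' t) (at t)" "Ck_real n g'"
    by (rule Ck_real_SucE) blast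
  have "Ck_real n (\<lambda>t. f' t * g t + g' t * f t)"
    by (rule Ck_real_add[OF Suc.IH[OF f(2) Ck_real_Suc_imp[OF Suc.prems(2)]]
          Suc.IH[OF g(2) Ck_real_Suc_imp[OF Suc.prems(1)]]])
  then show ?case by (rule Ck_real_SucI[OF DERIV_mult[OF f(1) g(1)]])
qed (simp add: continuous_on_mult)

lemma Ck_real_affine: "Ck_real n f \<Longrightarrow> Ck_real n (\<lambda>t. f (a * t + b))"
proof (induction n arbitrary: f)
  case 0
  then show ?case
    by simp (rule continuous_on_compose2[of UNIV f], auto intro!: continuous_on_add continuous_on_mult)
next
  case (Suc n)
  from Suc.prems obtain f' where d: "\<And>t. (f has_real_derivative f' t) (at t)" "Ck_real n f'"
    by (rule Ck_real_SucE) blast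
  have "((\<lambda>t. f (a * t + b)) has_real_derivative (a * f' (a * t + b))) (at t)" for t
    by (rule DERIV_cong[OF DERIV_chain2[OF d(1)]]) (auto intro!: derivative_eq_intros)
  moreover have "Ck_real n (\<lambda>t. a * f' (a * t + b))"
    using Ck_real_mult[OF Ck_real_const Suc.IH[OF d(2)]] .
  ultimately show ?case by (rule Ck_real_SucI)
qed

lemma Ck_real_inverse:
  assumes "\<And>t. f t \<noteq> 0"
  shows "Ck_real n f \<Longrightarrow> Ck_real n (\<lambda>t. inverse (f t))"
proof (induction n)
  case 0
  then show ?case using assms by (simp add: continuous_on_inverse)
next
  case (Suc n)
  from Suc.prems obtain f' where d: "\<And>t. (f has_real_derivative f' t) (at t)" "Ck_real n f'"
    by (rule Ck_real_SucE) blast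
  have i: "Ck_real n (\<lambda>t. inverse (f t))" using Suc.IH Ck_real_Suc_imp[OF Suc.prems] by blast
  have "((\<lambda>t. inverse (f t)) has_real_derivative (-1 * f' t * (inverse (f t) * inverse (f t)))) (at t)" for t
    by (rule DERIV_cong[OF DERIV_inverse_fun[OF d(1) assms]]) (simp add: mult_ac)
  moreover have "Ck_real n (\<lambda>t. -1 * f' t * (inverse (f t) * inverse (f t)))"
    by (intro Ck_real_mult Ck_real_const d(2) i)
  ultimately show ?case by (rule Ck_real_SucI)
qed

text \<open>The polynomial factor in \<open>1 / t\<close> makes this family closed under differentiation.\<close>

definition flat_exp :: "real poly \<Rightarrow> real \<Rightarrow> real" where
  "flat_exp p t = (if t \<le> 0 then 0 else poly p (inverse t) * exp (- inverse t))"

lemma poly_exp_decay: "((\<lambda>t. poly p (inverse t) * exp (- inverse t)) \<longlongrightarrow> 0) (at_right (0::real))"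
proof -
  have "((\<lambda>s. poly p s * exp (- s)) \<longlongrightarrow> 0) at_top" for p :: "real poly"
  proof (induction p)
    case (pCons a p)
    have m: "((\<lambda>s::real. s ^ n * exp (- s)) \<longlongrightarrow> 0) at_top" for n
      using tendsto_power_div_exp_0[of n] by (simp only: exp_minus divide_inverse)
    have "((\<lambda>s. (\<Sum>i\<le>degree (pCons a p). coeff (pCons a p) i * (s ^ i * exp (- s)))) \<longlongrightarrow>
        (\<Sum>i\<le>degree (pCons a p). coeff (pCons a p) i * 0)) at_top"
      by (intro tendsto_sum tendsto_mult tendsto_const m)
    then show ?case by (simp add: poly_altdef sum_distrib_right mult.assoc)
  qed simp
  from filterlim_compose[OF this filterlim_inverse_at_top_right] show ?thesis .
qed

text \<open>With s = 1/t the derivative of p(s) exp(-s) in t is s^2 (p - p')(s) exp(-s), which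
  explains the new polynomial. Only t = 0 needs a limit.\<close>

lemma flat_exp_deriv:
  "(flat_exp p has_real_derivative flat_exp ([:0, 0, 1:] * (p - pderiv p)) t) (at t)"
proof -
  let ?q = "[:0, 0, 1:] * (p - pderiv p)"
  consider "t < 0" | "t > 0" | "t = 0" by linarith
  then show ?thesis
  proof cases
    case 1
    have "(flat_exp p has_real_derivative 0) (at t)"
      by (rule has_field_derivative_transform_within_open[of "\<lambda>_. 0" _ _ "{..<0}"])
        (use 1 in \<open>auto simp: flat_exp_def\<close>)
    then show ?thesis using 1 by (simp add: flat_exp_def)
  next
    case 2
    have "((\<lambda>t. poly p (inverse t) * exp (- inverse t)) has_real_derivative
        (poly (pderiv p) (inverse t) * - (inverse t * inverse t) * exp (- inverse t)
         + exp (- inverse t) * (inverse t * inverse t) * poly p (inverse t))) (at t)"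
      using 2 by (auto intro!: derivative_eq_intros poly_DERIV[THEN DERIV_chain2] simp: power2_eq_square)
    then have "((\<lambda>t. poly p (inverse t) * exp (- inverse t)) has_real_derivative flat_exp ?q t) (at t)"
      by (rule DERIV_cong) (use 2 in \<open>simp add: flat_exp_def algebra_simps\<close>)
    then show ?thesis
      by (rule has_field_derivative_transform_within_open[of _ _ _ "{0<..}"])
        (use 2 in \<open>auto simp: flat_exp_def\<close>)
  next
    case 3
    have "((\<lambda>h. (flat_exp p (0 + h) - flat_exp p 0) / h) \<longlongrightarrow> 0) (at_right 0)"
    \<comment> \<open>Dividing by the increment multiplies the polynomial in 1/t by its variable, so
      the quotient decays like any other member of the family.\<close>
    proof (rule Lim_transform_eventually[OF poly_exp_decay[of "[:0, 1:] * p"]])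
      show "\<forall>\<^sub>F x in at_right 0. poly ([:0, 1:] * p) (inverse x) * exp (- inverse x) =
          (flat_exp p (0 + x) - flat_exp p 0) / x"
        unfolding eventually_at_right_field
        by (intro exI[of _ 1]) (simp add: flat_exp_def divide_inverse)
    qed
    moreover have "((\<lambda>h. (flat_exp p (0 + h) - flat_exp p 0) / h) \<longlongrightarrow> 0) (at_left 0)"
    proof (rule Lim_transform_eventually[OF tendsto_const])
      show "\<forall>\<^sub>F x in at_left 0. 0 = (flat_exp p (0 + x) - flat_exp p 0) / x"
        unfolding eventually_at_left_field
        by (intro exI[of _ "-1"]) (simp add: flat_exp_def)
    qed
    ultimately have "((\<lambda>h. (flat_exp p (0 + h) - flat_exp p 0) / h) \<longlongrightarrow> 0) (at 0)"
      by (simp add: filterlim_split_at)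
    then show ?thesis unfolding 3 DERIV_def by (simp add: flat_exp_def)
  qed
qed

lemma Ck_real_flat_exp: "Ck_real n (flat_exp p)"
proof (induction n arbitrary: p)
  case 0
  have "isCont (flat_exp p) t" for t using flat_exp_deriv DERIV_isCont by blast
  then show ?case by (simp add: continuous_on_eq_continuous_at)
next
  case (Suc n)
  show ?case by (rule Ck_real_SucI[OF flat_exp_deriv Suc])
qed

text \<open>The usual quotient; its denominator is positive because \<open>t\<close> and
  \<open>1 - t\<close> are never both nonpositive.\<close>

definition smooth_step :: "real \<Rightarrow> real" where
  "smooth_step t = flat_exp 1 t * inverse (flat_exp 1 t + flat_exp 1 (1 - t))"

lemma flat_exp_1: "flat_exp 1 t \<ge> 0" "flat_exp 1 t + flat_exp 1 (1 - t) > 0"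
  by (auto simp: flat_exp_def add_pos_pos)

lemma smooth_step_smooth: "smooth_real smooth_step"
  unfolding smooth_real_def smooth_step_def
proof (intro allI Ck_real_mult Ck_real_inverse Ck_real_add)
  fix n t
  show "Ck_real n (flat_exp 1)" by (rule Ck_real_flat_exp)
  show "flat_exp 1 t + flat_exp 1 (1 - t) \<noteq> 0" using flat_exp_1(2)[of t] by linarith
  show "Ck_real n (\<lambda>t. flat_exp 1 (1 - t))"
    using Ck_real_affine[OF Ck_real_flat_exp[of n 1], of "-1" 1] by (simp add: algebra_simps)
  then show "Ck_real n (flat_exp 1)" by (intro Ck_real_flat_exp)
qed

lemma smooth_step_0: "t \<le> 0 \<Longrightarrow> smooth_step t = 0"
  by (simp add: smooth_step_def flat_exp_def)

lemma smooth_step_1: "t \<ge> 1 \<Longrightarrow> smooth_step t = 1"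
  by (simp add: smooth_step_def flat_exp_def)

lemma smooth_step_range: "0 \<le> smooth_step t" "smooth_step t \<le> 1"
  using flat_exp_1[of t] flat_exp_1(1)[of "1 - t"]
  by (auto simp: smooth_step_def field_simps)

lemma smooth_step_deriv:
  obtains s' C where "\<And>t. (smooth_step has_real_derivative s' t) (at t)"
    "C > 0" "\<And>t. \<bar>s' t\<bar> \<le> C" "\<And>t. t \<notin> {0<..<1} \<Longrightarrow> s' t = 0"
proof -
  obtain s' where d: "\<And>t. (smooth_step has_real_derivative s' t) (at t)" and sm: "smooth_real s'"
    using smooth_step_smooth smooth_realE by metis
  have cont: "continuous_on UNIV s'" using sm unfolding smooth_real_def by (metis Ck_real.simps(1))
  have z0: "s' t = 0" if "t < 0 \<or> t > 1" for t
  proof -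
    have "(smooth_step has_real_derivative 0) (at t)"
    proof (cases "t < 0")
      case True
      show ?thesis
        by (rule has_field_derivative_transform_within_open[of "\<lambda>_. 0" _ _ "{..<0}"])
          (use True in \<open>auto simp: smooth_step_0\<close>)
    next
      case False
      show ?thesis
        by (rule has_field_derivative_transform_within_open[of "\<lambda>_. 1" _ _ "{1<..}"])
          (use False that in \<open>auto simp: smooth_step_1\<close>)
    qed
    with d DERIV_unique show ?thesis by blast
  qed
  have "{..<0} \<union> {1<..} \<subseteq> {t. s' t = 0}" using z0 by auto
  \<comment> \<open>Continuity of \<open>s'\<close> carries the zero over to the end points 0 and
    1.\<close>
  then have "closure ({..<0} \<union> {1<..}) \<subseteq> {t. s' t = 0}"
    by (intro closure_minimal closed_Collect_eq cont continuous_on_const)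
  then have z: "s' t = 0" if "t \<notin> {0<..<1}" for t using that by (auto simp: subset_iff)
  have "compact (s' ` {0..1})"
    using cont by (meson compact_Icc compact_continuous_image continuous_on_subset subset_UNIV)
  then obtain C where C: "C > 0" "\<And>t. t \<in> {0..1} \<Longrightarrow> \<bar>s' t\<bar> \<le> C"
    using compact_imp_bounded bounded_pos by (metis image_eqI real_norm_def)
  have "\<bar>s' t\<bar> \<le> C" for t
    using C z[of t] by (cases "t \<in> {0..1}") auto
  with d C z that show ?thesis by blast
qed

section \<open>Plane waves as test functions\<close>

lemma Ck_add: "Ck n \<phi> \<Longrightarrow> Ck n \<psi> \<Longrightarrow> Ck n (\<lambda>x. \<phi> x + \<psi> x)"
proof (induction n arbitrary: \<phi> \<psi>)
  case (Suc n)
  then have d: "\<phi> differentiable (at x)" "\<psi> differentiable (at x)" for x by simp_all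
  have "frechet_derivative (\<lambda>x. \<phi> x + \<psi> x) (at x) v =
      frechet_derivative \<phi> (at x) v + frechet_derivative \<psi> (at x) v" for x v
    by (rule frechet_derivative_at[THEN sym, THEN fun_cong, OF has_derivative_add])
      (use d frechet_derivative_works in blast)+
  moreover have "(\<lambda>x. \<phi> x + \<psi> x) differentiable (at x)" for x
    using Suc.prems by (simp add: differentiable_add)
  moreover have "Ck n (\<lambda>x. frechet_derivative \<phi> (at x) v + frechet_derivative \<psi> (at x) v)" for v
    using Suc.prems by (intro Suc.IH) auto
  ultimately show ?case by simp
qed (simp add: continuous_on_add)

lemma has_derivative_plane_wave:
  fixes b c :: "real^2" and a :: "real^2"
  assumes g: "\<And>t. (g has_real_derivative g' t) (at t)"
    and k: "\<And>t. (k has_real_derivative k' t) (at t)"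
  shows "((\<lambda>x. (g (b \<bullet> x) * k (c \<bullet> x)) *\<^sub>R a) has_derivative
    (\<lambda>v. ((b \<bullet> v) * g' (b \<bullet> x) * k (c \<bullet> x) + (c \<bullet> v) * g (b \<bullet> x) * k' (c \<bullet> x)) *\<^sub>R a)) (at x)"
proof -
  have comp: "((\<lambda>x. h (d \<bullet> x)) has_derivative (\<lambda>v. (d \<bullet> v) * h' (d \<bullet> x))) (at x)"
    if "\<And>t. (h has_real_derivative h' t) (at t)" for h h' and d :: "real^2"
  proof -
    have "(h has_derivative (\<lambda>s. s * h' (d \<bullet> x))) (at (d \<bullet> x))"
      using that[of "d \<bullet> x"] unfolding has_field_derivative_def
      by (rule has_derivative_eq_rhs) (simp add: fun_eq_iff)
    moreover have "((\<lambda>x. d \<bullet> x) has_derivative (\<lambda>v. d \<bullet> v)) (at x)"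
      by (intro bounded_linear_imp_has_derivative bounded_linear_inner_right)
    ultimately show ?thesis by (rule has_derivative_compose[rotated])
  qed
  show ?thesis
    by (rule has_derivative_eq_rhs[OF has_derivative_scaleR_left[OF has_derivative_mult[OF comp[OF g] comp[OF k]]]])
      (simp add: algebra_simps)
qed

lemma Ck_scaleR: "Ck n \<phi> \<Longrightarrow> Ck n (\<lambda>x. r *\<^sub>R \<phi> x)"
proof (induction n arbitrary: \<phi>)
  case (Suc n)
  have d: "\<phi> differentiable (at x)" for x using Suc.prems by simp
  then have "frechet_derivative (\<lambda>x. r *\<^sub>R \<phi> x) (at x) v = r *\<^sub>R frechet_derivative \<phi> (at x) v" for x v
    by (intro frechet_derivative_at[THEN sym, THEN fun_cong, OF has_derivative_scaleR_right])
      (simp add: frechet_derivative_works[symmetric])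
  moreover have "(\<lambda>x. r *\<^sub>R \<phi> x) differentiable (at x)" for x
    using d by simp
  ultimately show ?case using Suc by simp
qed (simp add: continuous_on_scaleR)

text \<open>A directional derivative is a combination of two waves of the same shape, with profiles
  \<open>g'\<close>, \<open>k\<close> and \<open>g\<close>, \<open>k'\<close>, so the induction has
  to vary both profiles.\<close>

lemma Ck_plane_wave:
  assumes "smooth_real g" "smooth_real k"
  shows "Ck n (\<lambda>x. (g (b \<bullet> x) * k (c \<bullet> x)) *\<^sub>R a)"
  using assms
proof (induction n arbitrary: g k)
  case 0
  then have "continuous_on UNIV g" "continuous_on UNIV k"
    unfolding smooth_real_def by (metis Ck_real.simps(1))+
  then show ?case
    by (auto intro!: continuous_on_scaleR continuous_on_mult continuous_on_inner continuous_on_const continuous_on_id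
        continuous_on_compose2[of UNIV g] continuous_on_compose2[of UNIV k])
next
  case (Suc n)
  obtain g' k' where g': "\<And>t. (g has_real_derivative g' t) (at t)" "smooth_real g'"
    and k': "\<And>t. (k has_real_derivative k' t) (at t)" "smooth_real k'"
    using Suc.prems smooth_realE by metis
  note D = has_derivative_plane_wave[OF g'(1) k'(1), of b c a]
  have "frechet_derivative (\<lambda>x. (g (b \<bullet> x) * k (c \<bullet> x)) *\<^sub>R a) (at x) v =
    (b \<bullet> v) *\<^sub>R ((g' (b \<bullet> x) * k (c \<bullet> x)) *\<^sub>R a) + (c \<bullet> v) *\<^sub>R ((g (b \<bullet> x) * k' (c \<bullet> x)) *\<^sub>R a)" for x v
    unfolding frechet_derivative_at[OF D, symmetric] by (simp add: scaleR_left_distrib mult.assoc)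
  moreover have "(\<lambda>x. (g (b \<bullet> x) * k (c \<bullet> x)) *\<^sub>R a) differentiable (at x)" for x
    using D differentiable_def by blast
  moreover have "Ck n (\<lambda>x. (b \<bullet> v) *\<^sub>R ((g' (b \<bullet> x) * k (c \<bullet> x)) *\<^sub>R a) +
      (c \<bullet> v) *\<^sub>R ((g (b \<bullet> x) * k' (c \<bullet> x)) *\<^sub>R a))" for v
    by (intro Ck_add Ck_scaleR Suc.IH g' k' Suc.prems)
  ultimately show ?case by simp
qed

definition sym_outer :: "real^2 \<Rightarrow> real^2 \<Rightarrow> mat2" where
  "sym_outer a b = (\<chi> i j. (a $ i * b $ j + a $ j * b $ i) / 2)"

text \<open>The first term is the wanted gradient along \<open>sym_outer a b\<close>; the second is
  the error made by the cut-off \<open>k\<close>, present only where \<open>k'\<close> does not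
  vanish.\<close>

lemma sym_gradient_plane_wave:
  assumes g: "\<And>t. (g has_real_derivative g' t) (at t)"
    and k: "\<And>t. (k has_real_derivative k' t) (at t)"
  shows "sym_gradient (\<lambda>x. (g (b \<bullet> x) * k (c \<bullet> x)) *\<^sub>R a) x =
    (g' (b \<bullet> x) * k (c \<bullet> x)) *\<^sub>R sym_outer a b + (g (b \<bullet> x) * k' (c \<bullet> x)) *\<^sub>R sym_outer a c"
  unfolding sym_gradient_def jacobian_def
    frechet_derivative_at[OF has_derivative_plane_wave[OF g k, of b c a], symmetric]
  by (simp add: vec_eq_iff matrix_def transpose_def sym_outer_def inner_axis field_simps)

lemma mem_sym_mats: "M \<in> sym_mats \<longleftrightarrow> M $ 1 $ 2 = M $ 2 $ 1"
  by (auto simp: sym_mats_def transpose_def vec_eq_iff forall_2)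

lemma subspace_sym_mats: "subspace sym_mats"
  unfolding subspace_def by (simp add: mem_sym_mats)

lemma sym_gradient_sym: "sym_gradient \<phi> x \<in> sym_mats"
  by (simp add: mem_sym_mats sym_gradient_def transpose_def)

lemma sym_outer_sym: "sym_outer a b \<in> sym_mats"
  by (simp add: mem_sym_mats sym_outer_def)

text \<open>The quadratic form of \<open>sym_outer a b\<close> is the product of the linear forms of
  \<open>a\<close> and \<open>b\<close>. A binary form p X^2 + 2 q X Y + r Y^2 with q^2 - p r >= 0
  splits over the reals: as Y (2 q X + r Y) if p = 0, otherwise as (X + (q + s)/p Y)(p X + (q - s)
  Y) with s the root of q^2 - p r.\<close>

lemma det_nonpos_sym_outer:
  assumes D: "D \<in> sym_mats" "det D \<le> 0" "D \<noteq> 0"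
  obtains a b where "D = sym_outer a b" "a \<noteq> 0" "b \<noteq> 0"
proof -
  define p q r where "p = D $ 1 $ 1" and "q = D $ 1 $ 2" and "r = D $ 2 $ 2"
  have q': "D $ 2 $ 1 = q" using D(1) by (simp add: mem_sym_mats q_def)
  have "p * r \<le> q * q" using D(2) q' by (simp add: det_2 p_def q_def r_def)
  have ex: "\<exists>a b. D = sym_outer a b"
  proof (cases "p = 0")
    case True
    have "D = sym_outer (vector [0, 1]) (vector [2 * q, r])"
      using True q' by (simp add: sym_outer_def vec_eq_iff forall_2 p_def q_def r_def)
    then show ?thesis by blast
  next
    case False
    define s where "s = sqrt (q * q - p * r)"
    have s: "s * s = q * q - p * r" using \<open>p * r \<le> q * q\<close> by (simp add: s_def)
    then have "r = (q + s) * (q - s) / p" using False by (simp add: field_simps)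
    then have "(q + s) / p * (q - s) = r" "(q + s) / p * p = q + s" using False by simp_all
    then have "D = sym_outer (vector [1, (q + s) / p]) (vector [p, q - s])"
      using q' unfolding vec_eq_iff forall_2
      by (simp add: sym_outer_def p_def[symmetric] q_def[symmetric] r_def[symmetric])
    then show ?thesis by blast
  qed
  then obtain a b where ab: "D = sym_outer a b" by blast
  moreover have "sym_outer 0 b = 0" "sym_outer a 0 = 0" by (simp_all add: sym_outer_def vec_eq_iff)
  ultimately show ?thesis using that D(3) by metis
qed

section \<open>Cut-off and tent profiles\<close>

lemma smooth_real_add: "smooth_real f \<Longrightarrow> smooth_real g \<Longrightarrow> smooth_real (\<lambda>t. f t + g t)"
  by (simp add: smooth_real_def Ck_real_add)

lemma smooth_real_mult: "smooth_real f \<Longrightarrow> smooth_real g \<Longrightarrow> smooth_real (\<lambda>t. f t * g t)"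
  by (simp add: smooth_real_def Ck_real_mult)

lemma smooth_real_affine: "smooth_real f \<Longrightarrow> smooth_real (\<lambda>t. f (a * t + b))"
  by (simp add: smooth_real_def Ck_real_affine)

lemma smooth_real_affine_id: "smooth_real (\<lambda>t. a * t + b)"
  using smooth_real_affine[of "\<lambda>t. t"] by (simp add: smooth_real_def Ck_real_id)

text \<open>\<open>C\<close> is fixed before \<open>R\<close>: both ramps have width 1 whatever the
  length of the plateau.\<close>

lemma smooth_cutoff:
  obtains C where "C > 0" "\<And>R::real. R \<ge> 2 \<Longrightarrow> \<exists>\<zeta> \<zeta>'. smooth_real \<zeta> \<and>
    (\<forall>t. (\<zeta> has_real_derivative \<zeta>' t) (at t)) \<and> (\<forall>t. 0 \<le> \<zeta> t \<and> \<zeta> t \<le> 1) \<and> (\<forall>t. \<bar>\<zeta>' t\<bar> \<le> C) \<and>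
    (\<forall>t. t \<notin> {0..R} \<longrightarrow> \<zeta> t = 0) \<and> (\<forall>t\<in>{1<..<R-1}. \<zeta> t = 1 \<and> \<zeta>' t = 0)"
proof -
  obtain s' C where s': "\<And>t. (smooth_step has_real_derivative s' t) (at t)"
    "C > 0" "\<And>t. \<bar>s' t\<bar> \<le> C" "\<And>t. t \<notin> {0<..<1} \<Longrightarrow> s' t = 0"
    by (rule smooth_step_deriv) blast
  show ?thesis
  proof (rule that[of "2 * C"])
    show "2 * C > 0" using s' by simp
    fix R :: real assume R: "R \<ge> 2"
    let ?z = "\<lambda>t. smooth_step t * smooth_step ((-1) * t + R)"
    let ?z' = "\<lambda>t. s' t * smooth_step (R - t) - s' (R - t) * smooth_step t"
    have d: "(?z has_real_derivative ?z' t) (at t)" for t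
      by (rule DERIV_cong[OF DERIV_mult[OF s'(1) DERIV_chain2[OF s'(1)]]])
        (auto intro!: derivative_eq_intros)
    have sm: "smooth_real ?z"
      by (rule smooth_real_mult[OF smooth_step_smooth smooth_real_affine[OF smooth_step_smooth]])
    have b: "\<bar>?z' t\<bar> \<le> 2 * C" for t
    proof -
      have "\<bar>s' t * smooth_step (R - t)\<bar> \<le> C * 1" "\<bar>s' (R - t) * smooth_step t\<bar> \<le> C * 1"
        unfolding abs_mult using s'(2,3) smooth_step_range by (intro mult_mono; simp add: less_imp_le)+
      then show ?thesis by linarith
    qed
    show "\<exists>\<zeta> \<zeta>'. smooth_real \<zeta> \<and>
      (\<forall>t. (\<zeta> has_real_derivative \<zeta>' t) (at t)) \<and> (\<forall>t. 0 \<le> \<zeta> t \<and> \<zeta> t \<le> 1) \<and> (\<forall>t. \<bar>\<zeta>' t\<bar> \<le> 2 * C) \<and>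
      (\<forall>t. t \<notin> {0..R} \<longrightarrow> \<zeta> t = 0) \<and> (\<forall>t\<in>{1<..<R-1}. \<zeta> t = 1 \<and> \<zeta>' t = 0)"
    proof (rule exI[of _ ?z], rule exI[of _ ?z'], intro conjI allI ballI impI)
      fix t
      show "0 \<le> ?z t" "?z t \<le> 1" using smooth_step_range by (simp_all add: mult_le_one)
      show "?z t = 0" if "t \<notin> {0..R}" using that by (auto simp: smooth_step_0)
      show "?z t = 1" if "t \<in> {1<..<R - 1}" using that by (auto simp: smooth_step_1)
      show "?z' t = 0" if "t \<in> {1<..<R - 1}" using that s'(4) by auto
    qed (use sm d b in auto)
  qed
qed

text \<open>A smoothing of the tent with slopes \<open>1 - l\<close> and \<open>- l\<close>: the transition layers have width
  \<open>\<delta>\<close>, but there the interpolated affine pieces differ by at most \<open>\<delta>\<close>, so the derivative stays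
  bounded independently of \<open>\<delta>\<close>.\<close>

lemma smooth_tent:
  fixes l :: real
  assumes l: "0 < l" "l < 1"
  obtains K where "K > 0" "\<And>\<delta>. 0 < \<delta> \<Longrightarrow> \<delta> < l \<Longrightarrow> 2 * \<delta> < 1 - l \<Longrightarrow> \<exists>H H'. smooth_real H \<and>
    (\<forall>t. (H has_real_derivative H' t) (at t)) \<and> (\<forall>t. \<bar>H t\<bar> \<le> 1) \<and> (\<forall>t. \<bar>H' t\<bar> \<le> K) \<and>
    (\<forall>t. t \<notin> {0..1} \<longrightarrow> H t = 0) \<and> (\<forall>t\<in>{\<delta><..<l}. H' t = 1 - l) \<and> (\<forall>t\<in>{l+\<delta><..<1-\<delta>}. H' t = - l)"
proof -
  obtain s' C where s': "\<And>t. (smooth_step has_real_derivative s' t) (at t)"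
    "C > 0" "\<And>t. \<bar>s' t\<bar> \<le> C" "\<And>t. t \<notin> {0<..<1} \<Longrightarrow> s' t = 0"
    by (rule smooth_step_deriv) blast
  show ?thesis
  \<comment> \<open>Each of the three ramps below contributes \<open>C\<close>, the slope of the
    interpolated profile at most 1.\<close>
  proof (rule that[of "3 * C + 1"])
    show "3 * C + 1 > 0" using s' by simp
    fix \<delta> :: real assume \<delta>: "0 < \<delta>" "\<delta> < l" "2 * \<delta> < 1 - l"
    \<comment> \<open>\<open>p\<close> switches the profile on at 0, \<open>q\<close> switches it
      off at 1, and \<open>r\<close> passes at \<open>l\<close> from the piece
      \<open>(1 - l) * t\<close> to the piece \<open>l * (1 - t)\<close>. The bounds on
      \<open>\<delta>\<close> keep the three layers disjoint.\<close>
    define p where "p t = smooth_step (1/\<delta> * t + 0)" for t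
    define q where "q t = smooth_step (-1/\<delta> * t + 1/\<delta>)" for t
    define r where "r t = smooth_step (1/\<delta> * t + -l/\<delta>)" for t
    define p' where "p' t = s' (1/\<delta> * t + 0) / \<delta>" for t
    define q' where "q' t = - s' (-1/\<delta> * t + 1/\<delta>) / \<delta>" for t
    define r' where "r' t = s' (1/\<delta> * t + -l/\<delta>) / \<delta>" for t
    define g where "g t = (1 - l) * t + r t * (l - t)" for t
    let ?H = "\<lambda>t. p t * q t * g t"
    let ?H' = "\<lambda>t. p' t * (q t * g t) + q' t * (p t * g t) + p t * q t * (1 - l - r t + r' t * (l - t))"
    have dp: "(p has_real_derivative p' t) (at t)" for t
      unfolding p_def p'_def by (rule DERIV_cong[OF DERIV_chain2[OF s'(1)]]) (use \<delta> in \<open>auto intro!: derivative_eq_intros\<close>)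
    have dq: "(q has_real_derivative q' t) (at t)" for t
      unfolding q_def q'_def by (rule DERIV_cong[OF DERIV_chain2[OF s'(1)]]) (use \<delta> in \<open>auto intro!: derivative_eq_intros\<close>)
    have dr: "(r has_real_derivative r' t) (at t)" for t
      unfolding r_def r'_def by (rule DERIV_cong[OF DERIV_chain2[OF s'(1)]]) (use \<delta> in \<open>auto intro!: derivative_eq_intros\<close>)
    have d: "(?H has_real_derivative ?H' t) (at t)" for t
      unfolding g_def
      by (rule derivative_eq_intros dp dq dr refl | simp add: algebra_simps)+
    have sm: "smooth_real ?H"
    proof -
      have "smooth_real r" "smooth_real p" "smooth_real q"
        unfolding p_def q_def r_def by (rule smooth_real_affine smooth_step_smooth)+
      note smooth_real_mult[OF smooth_real_mult[OF this(2,3)] smooth_real_add[OF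
            smooth_real_affine_id[of "1 - l" 0] smooth_real_mult[OF this(1) smooth_real_affine_id[of "-1" l]]]]
      then show ?thesis by (simp add: g_def)
    qed
    have rng: "0 \<le> p t" "p t \<le> 1" "0 \<le> q t" "q t \<le> 1" "0 \<le> r t" "r t \<le> 1" for t
      unfolding p_def q_def r_def using smooth_step_range by auto
    have p0: "p t = 0" if "t \<le> 0" for t
      using that \<delta> by (auto simp: p_def intro!: smooth_step_0 simp: field_simps)
    have q0: "q t = 0" if "t \<ge> 1" for t
      using that \<delta> by (auto simp: q_def intro!: smooth_step_0 simp: field_simps)
    have r0: "r t = 0" if "t \<le> l" for t
      using that \<delta> by (auto simp: r_def intro!: smooth_step_0 simp: field_simps)
    have p1: "p t = 1" if "t \<ge> \<delta>" for t
      using that \<delta> by (auto simp: p_def intro!: smooth_step_1 simp: field_simps)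
    have q1: "q t = 1" if "t \<le> 1 - \<delta>" for t
      using that \<delta> by (auto simp: q_def intro!: smooth_step_1 simp: field_simps)
    have r1: "r t = 1" if "t \<ge> l + \<delta>" for t
      using that \<delta> by (auto simp: r_def intro!: smooth_step_1 simp: field_simps)
    have p'0: "p' t = 0" if "t \<notin> {0<..<\<delta>}" for t
    proof -
      have "1/\<delta> * t + 0 \<notin> {0<..<1}" using that \<delta> by (auto simp: field_simps)
      then show ?thesis unfolding p'_def using s'(4) by simp
    qed
    have q'0: "q' t = 0" if "t \<notin> {1-\<delta><..<1}" for t
    proof -
      have "-1/\<delta> * t + 1/\<delta> \<notin> {0<..<1}" using that \<delta> by (auto simp: field_simps)
      then show ?thesis unfolding q'_def using s'(4) by simp
    qed
    have r'0: "r' t = 0" if "t \<notin> {l<..<l+\<delta>}" for t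
    proof -
      have "1/\<delta> * t + -l/\<delta> \<notin> {0<..<1}" using that \<delta> by (auto simp: field_simps)
      then show ?thesis unfolding r'_def using s'(4) by simp
    qed
    have b': "\<bar>p' t\<bar> \<le> C / \<delta>" "\<bar>q' t\<bar> \<le> C / \<delta>" "\<bar>r' t\<bar> \<le> C / \<delta>" for t
      unfolding p'_def q'_def r'_def using s'(3) \<delta> by (simp_all add: divide_right_mono)
    have bound: "\<bar>u * (v * w)\<bar> \<le> C" if "\<bar>u\<bar> \<le> C / \<delta>" "0 \<le> v" "v \<le> 1" "\<bar>w\<bar> \<le> \<delta>" for u v w
    proof -
      have "\<bar>u\<bar> * (\<bar>v\<bar> * \<bar>w\<bar>) \<le> C / \<delta> * (1 * \<delta>)"
        by (intro mult_mono) (use that \<delta> s'(2) in auto)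
      then show ?thesis using \<delta> by (simp add: abs_mult)
    qed
    have gb: "\<bar>g t\<bar> \<le> 1" if "t \<in> {0..1}" for t
    proof -
      have e: "g t = (1 - r t) * ((1 - l) * t) + r t * (l * (1 - t))" by (simp add: g_def algebra_simps)
      have "(1 - l) * t \<le> 1 * 1" "l * (1 - t) \<le> 1 * 1" using that l by (intro mult_mono; simp)+
      then have "(1 - r t) * ((1 - l) * t) \<le> (1 - r t) * 1" "r t * (l * (1 - t)) \<le> r t * 1"
        using rng by (intro mult_left_mono; simp)+
      moreover have "0 \<le> (1 - r t) * ((1 - l) * t)" "0 \<le> r t * (l * (1 - t))" using that l rng by simp_all
      ultimately have "0 \<le> g t" "g t \<le> (1 - r t) * 1 + r t * 1"
        unfolding e by - (intro add_nonneg_nonneg add_mono; assumption)+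
      then show ?thesis by simp
    qed
    have Hb: "\<bar>?H t\<bar> \<le> 1" for t
    proof (cases "t \<in> {0..1}")
      case True
      have "\<bar>p t\<bar> * \<bar>q t\<bar> * \<bar>g t\<bar> \<le> 1 * 1 * 1" by (intro mult_mono) (use rng gb[OF True] in auto)
      then show ?thesis by (simp add: abs_mult)
    next
      case False
      then have "p t = 0 \<or> q t = 0" using p0[of t] q0[of t] by auto
      then show ?thesis by auto
    qed
    have H'b: "\<bar>?H' t\<bar> \<le> 3 * C + 1" for t
    proof -
      have "\<bar>p' t * (q t * g t)\<bar> \<le> C"
      proof (cases "t \<in> {0<..<\<delta>}")
        case True
        then have "g t = (1 - l) * t" using r0[of t] \<delta> by (simp add: g_def)
        moreover have "(1 - l) * t \<le> 1 * \<delta>" "0 \<le> (1 - l) * t" using True l \<delta> by ((intro mult_mono; simp)[1], simp)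
        ultimately show ?thesis by (intro bound b' rng) simp
      qed (use p'0 s'(2) in simp)
      moreover have "\<bar>q' t * (p t * g t)\<bar> \<le> C"
      proof (cases "t \<in> {1-\<delta><..<1}")
        case True
        then have "g t = l * (1 - t)" using r1[of t] \<delta> by (simp add: g_def algebra_simps)
        moreover have "l * (1 - t) \<le> 1 * \<delta>" "0 \<le> l * (1 - t)" using True l \<delta> by ((intro mult_mono; simp)[1], simp)
        ultimately show ?thesis by (intro bound b' rng) simp
      qed (use q'0 s'(2) in simp)
      moreover have "\<bar>p t * q t * (1 - l - r t + r' t * (l - t))\<bar> \<le> C + 1"
      proof -
        have "\<bar>r' t * (l - t)\<bar> \<le> C"
        proof (cases "t \<in> {l<..<l+\<delta>}")
          case True
          then have "\<bar>r' t * (1 * (l - t))\<bar> \<le> C" by (intro bound b') auto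
          then show ?thesis by simp
        qed (use r'0 s'(2) in simp)
        then have "\<bar>1 - l - r t + r' t * (l - t)\<bar> \<le> C + 1" using rng[of t] l by linarith
        then have "\<bar>p t\<bar> * \<bar>q t\<bar> * \<bar>1 - l - r t + r' t * (l - t)\<bar> \<le> 1 * 1 * (C + 1)"
          by (intro mult_mono) (use rng in auto)
        then show ?thesis by (simp only: abs_mult mult_1)
      qed
      ultimately show ?thesis by linarith
    qed
    show "\<exists>H H'. smooth_real H \<and>
      (\<forall>t. (H has_real_derivative H' t) (at t)) \<and> (\<forall>t. \<bar>H t\<bar> \<le> 1) \<and> (\<forall>t. \<bar>H' t\<bar> \<le> 3 * C + 1) \<and>
      (\<forall>t. t \<notin> {0..1} \<longrightarrow> H t = 0) \<and> (\<forall>t\<in>{\<delta><..<l}. H' t = 1 - l) \<and> (\<forall>t\<in>{l+\<delta><..<1-\<delta>}. H' t = - l)"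
    proof (rule exI[of _ ?H], rule exI[of _ ?H'], intro conjI allI ballI impI)
      fix t
      show "?H t = 0" if "t \<notin> {0..1}" using that p0[of t] q0[of t] by auto
      show "?H' t = 1 - l" if "t \<in> {\<delta><..<l}"
        using that \<delta> p1[of t] q1[of t] r0[of t] p'0[of t] q'0[of t] r'0[of t] by auto
      show "?H' t = - l" if "t \<in> {l+\<delta><..<1-\<delta>}"
        using that \<delta> l p1[of t] q1[of t] r1[of t] p'0[of t] q'0[of t] r'0[of t] by auto
    qed (use sm d Hb H'b in auto)
  qed
qed

section \<open>Convexity along compatible segments\<close>

definition strip_box :: "real^2 \<Rightarrow> real^2 \<Rightarrow> real \<Rightarrow> real \<Rightarrow> real \<Rightarrow> real \<Rightarrow> (real^2) set" where
  "strip_box b c p q r s = {x. p < b \<bullet> x \<and> b \<bullet> x < q \<and> r < c \<bullet> x \<and> c \<bullet> x < s}"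

definition rot90 :: "real^2 \<Rightarrow> real^2" where
  "rot90 b = vector [- b $ 2, b $ 1]"

lemma inner_2: "(x::real^2) \<bullet> y = x $ 1 * y $ 1 + x $ 2 * y $ 2"
  by (simp add: inner_vec_def sum_2)

text \<open>\<open>b\<close> and \<open>rot90 b\<close> are orthogonal of equal length, so x -> (b .
  x, rot90 b . x) is a rotation times the length of \<open>b\<close>; \<open>S\<close> is its
  inverse. Boundedness, connectedness and area are thus inherited from axis-parallel boxes.\<close>

lemma strip_box_linear_image:
  assumes "b \<noteq> 0"
  obtains S :: "real^2 \<Rightarrow> real^2" where "linear S" "det (matrix S) \<noteq> 0"
    "\<And>p q r s. strip_box b (rot90 b) p q r s = S ` box (vector [p, r]) (vector [q, s])"
proof -
  define n where "n = b $ 1 * b $ 1 + b $ 2 * b $ 2"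
  have n: "n \<noteq> 0" using assms by (auto simp: n_def vec_eq_iff forall_2 add_nonneg_eq_0_iff)
  define A :: "real^2^2" where
    "A = vector [vector [b $ 1 / n, - b $ 2 / n], vector [b $ 2 / n, b $ 1 / n]]"
  have A: "A $ 1 $ 1 = b $ 1 / n" "A $ 1 $ 2 = - b $ 2 / n" "A $ 2 $ 1 = b $ 2 / n" "A $ 2 $ 2 = b $ 1 / n"
    by (simp_all add: A_def)
  have "det A = n / (n * n)" by (simp add: det_2 A n_def add_divide_distrib)
  then have det: "det A = 1 / n" by simp
  have inv: "b \<bullet> (A *v y) = y $ 1" "rot90 b \<bullet> (A *v y) = y $ 2" for y
  proof -
    have "b \<bullet> (A *v y) = (b $ 1 * b $ 1 + b $ 2 * b $ 2) / n * y $ 1"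
      by (simp add: inner_2 matrix_vector_mult_def sum_2 A algebra_simps add_divide_distrib)
    then show "b \<bullet> (A *v y) = y $ 1" using n by (simp add: n_def[symmetric])
    have "rot90 b \<bullet> (A *v y) = (b $ 1 * b $ 1 + b $ 2 * b $ 2) / n * y $ 2"
      by (simp add: inner_2 rot90_def matrix_vector_mult_def sum_2 A algebra_simps add_divide_distrib)
    then show "rot90 b \<bullet> (A *v y) = y $ 2" using n by (simp add: n_def[symmetric])
  qed
  have surj: "A *v vector [b \<bullet> x, rot90 b \<bullet> x] = x" for x
  proof -
    have "(A *v vector [b \<bullet> x, rot90 b \<bullet> x]) $ i = (b $ 1 * b $ 1 + b $ 2 * b $ 2) / n * x $ i" for i
      using exhaust_2[of i]
      by (auto simp: inner_2 rot90_def matrix_vector_mult_def sum_2 A algebra_simps add_divide_distrib)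
    then show ?thesis using n by (simp add: n_def[symmetric] vec_eq_iff)
  qed
  have "strip_box b (rot90 b) p q r s = (\<lambda>y. A *v y) ` box (vector [p, r]) (vector [q, s])" for p q r s
  proof (intro set_eqI iffI)
    fix x assume x: "x \<in> strip_box b (rot90 b) p q r s"
    have "vector [b \<bullet> x, rot90 b \<bullet> x] \<in> box (vector [p, r]) (vector [q, s] :: real^2)"
      using x by (auto simp: strip_box_def mem_box_cart forall_2)
    then show "x \<in> (\<lambda>y. A *v y) ` box (vector [p, r]) (vector [q, s])"
      using surj[of x] by (metis image_eqI)
  next
    fix x assume "x \<in> (\<lambda>y. A *v y) ` box (vector [p, r]) (vector [q, s])"
    then show "x \<in> strip_box b (rot90 b) p q r s"
      by (auto simp: strip_box_def mem_box_cart forall_2 inv)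
  qed
  moreover have "linear (\<lambda>y. A *v y)" "det (matrix (\<lambda>y. A *v y)) \<noteq> 0"
    using det n by (auto simp: matrix_vector_mul_linear)
  ultimately show ?thesis using that by blast
qed

lemma open_strip_box: "open (strip_box b c p q r s)"
  unfolding strip_box_def
  by (intro open_Collect_conj open_Collect_less continuous_intros)

lemma bounded_strip_box: "b \<noteq> 0 \<Longrightarrow> bounded (strip_box b (rot90 b) p q r s)"
  by (rule strip_box_linear_image)
    (auto intro!: bounded_linear_image bounded_box simp: linear_conv_bounded_linear[symmetric])

lemma bounded_domain_strip_box:
  assumes "b \<noteq> 0" "p < q" "r < s"
  shows "bounded_domain (strip_box b (rot90 b) p q r s)"
proof -
  obtain S :: "real^2 \<Rightarrow> real^2" where S: "linear S" "strip_box b (rot90 b) p q r s = S ` box (vector [p, r]) (vector [q, s])"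
    by (rule strip_box_linear_image[OF assms(1)]) auto
  have "vector [(p + q) / 2, (r + s) / 2] \<in> box (vector [p, r]) (vector [q, s] :: real^2)"
    using assms by (simp add: mem_box_cart forall_2)
  then have "strip_box b (rot90 b) p q r s \<noteq> {}" using S by auto
  moreover have "connected (strip_box b (rot90 b) p q r s)"
    unfolding S(2) using S(1) by (intro convex_connected convex_linear_image convex_box)
  ultimately show ?thesis
    using open_strip_box bounded_strip_box[OF assms(1)] by (simp add: bounded_domain_def)
qed

text \<open>One factor \<open>\<kappa>\<close> serves all boxes with the same \<open>b\<close>, so
  it cancels in area ratios.\<close>

lemma measure_strip_box:
  assumes "b \<noteq> 0"
  obtains \<kappa> where "\<kappa> > 0"
    "\<And>p q r s. p \<le> q \<Longrightarrow> r \<le> s \<Longrightarrow> measure lborel (strip_box b (rot90 b) p q r s) = \<kappa> * ((q - p) * (s - r))"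
proof -
  obtain S :: "real^2 \<Rightarrow> real^2" where S: "linear S" "det (matrix S) \<noteq> 0"
    "\<And>p q r s. strip_box b (rot90 b) p q r s = S ` box (vector [p, r]) (vector [q, s])"
    by (rule strip_box_linear_image[OF assms]) blast
  show ?thesis
  proof (rule that[of "\<bar>det (matrix S)\<bar>"])
    show "\<bar>det (matrix S)\<bar> > 0" using S(2) by simp
    fix p q r s :: real assume pq: "p \<le> q" "r \<le> s"
    have "measure lborel (strip_box b (rot90 b) p q r s) = measure lebesgue (S ` box (vector [p, r]) (vector [q, s]))"
      using open_strip_box by (simp add: S(3)[symmetric] borel_open)
    also have "\<dots> = \<bar>det (matrix S)\<bar> * measure lebesgue (box (vector [p, r]) (vector [q, s] :: real^2))"
      by (rule measure_linear_image[OF S(1)]) simp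
    also have "measure lebesgue (box (vector [p, r]) (vector [q, s] :: real^2)) = measure lborel (cbox (vector [p, r]) (vector [q, s] :: real^2))"
      by (simp add: measure_lborel_box_eq measure_lborel_cbox_eq)
    also have "\<dots> = (q - p) * (s - r)"
    proof -
      have "cbox (vector [p, r]) (vector [q, s] :: real^2) \<noteq> {}"
        using pq unfolding interval_ne_empty_cart by (simp add: forall_2)
      then show ?thesis by (simp add: content_cbox_cart UNIV_2)
    qed
    finally show "measure lborel (strip_box b (rot90 b) p q r s) = \<bar>det (matrix S)\<bar> * ((q - p) * (s - r))" .
  qed
qed

section \<open>Averages of a symmetric quasiconvex function over long boxes\<close>

lemma closed_sym_mats: "closed sym_mats"
  using closed_subspace[OF subspace_sym_mats] .

lemma locally_bounded_on_compact:
  assumes f: "locally_bounded_on_sym f" and K: "compact K" "K \<subseteq> sym_mats"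
  shows "bounded (f ` K)"
proof -
  obtain r where r: "\<And>A. A \<in> sym_mats \<Longrightarrow> r A > 0 \<and> bounded (f ` (ball A (r A) \<inter> sym_mats))"
    using f unfolding locally_bounded_on_sym_def by metis
  have "K \<subseteq> (\<Union>A\<in>K. ball A (r A))" using r K(2) by fastforce
  then obtain T where T: "T \<subseteq> K" "finite T" "K \<subseteq> (\<Union>A\<in>T. ball A (r A))"
    using compactE_image[OF K(1), of K "\<lambda>A. ball A (r A)"] by blast
  have "bounded (\<Union>A\<in>T. f ` (ball A (r A) \<inter> sym_mats))"
    using T K(2) r by (intro bounded_UN) auto
  moreover have "f ` K \<subseteq> (\<Union>A\<in>T. f ` (ball A (r A) \<inter> sym_mats))" using T K(2) by blast
  ultimately show ?thesis by (rule bounded_subset)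
qed

text \<open>The strict margins leave room for the closed support inside the open box.\<close>

lemma plane_wave_test_function:
  assumes g: "smooth_real g" "\<And>t. t \<notin> {p..q} \<Longrightarrow> g t = 0"
    and k: "smooth_real k" "\<And>t. t \<notin> {r..s} \<Longrightarrow> k t = 0"
    and b: "b \<noteq> 0" and le: "p0 < p" "q < q0" "r0 < r" "s < s0"
  shows "(\<lambda>x. (g (b \<bullet> x) * k (rot90 b \<bullet> x)) *\<^sub>R a) \<in> test_functions (strip_box b (rot90 b) p0 q0 r0 s0)"
    (is "?\<phi> \<in> test_functions ?\<Omega>")
proof -
  let ?K = "{x. p \<le> b \<bullet> x \<and> b \<bullet> x \<le> q \<and> r \<le> rot90 b \<bullet> x \<and> rot90 b \<bullet> x \<le> s}"
  have "closed ?K" by (intro closed_Collect_conj closed_Collect_le continuous_intros)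
  moreover have "{x. ?\<phi> x \<noteq> 0} \<subseteq> ?K"
    using g(2) k(2) by (auto simp: not_le[symmetric])
  ultimately have "closure {x. ?\<phi> x \<noteq> 0} \<subseteq> ?K" by (rule closure_minimal[rotated])
  moreover have "?K \<subseteq> ?\<Omega>" using le by (auto simp: strip_box_def)
  ultimately have sub: "closure {x. ?\<phi> x \<noteq> 0} \<subseteq> ?\<Omega>" by blast
  then have "compact (closure {x. ?\<phi> x \<noteq> 0})"
    using bounded_subset[OF bounded_strip_box[OF b]] by (simp add: compact_eq_bounded_closed)
  then show ?thesis using sub Ck_plane_wave[OF g(1) k(1)] by (simp add: test_functions_def)
qed

lemma sym_quasiconvex_test:
  assumes "sym_quasiconvex f" "bounded_domain \<Omega>" "E \<in> sym_mats" "\<phi> \<in> test_functions \<Omega>"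
  shows "f E \<le> 1 / measure lborel \<Omega> * (LINT x:\<Omega>|lborel. f (E + sym_gradient \<phi> x))"
proof -
  have "ereal (f E) \<le> (INF \<phi>\<in>test_functions \<Omega>.
          ereal (1 / measure lborel \<Omega> * (LINT x:\<Omega>|lborel. f (E + sym_gradient \<phi> x))))"
    using assms unfolding sym_quasiconvex_def by blast
  also have "\<dots> \<le> ereal (1 / measure lborel \<Omega> * (LINT x:\<Omega>|lborel. f (E + sym_gradient \<phi> x)))"
    using assms(4) by (rule INF_lower)
  finally show ?thesis by simp
qed

lemma Ck_1_sym_gradient_continuous:
  assumes "Ck 1 \<phi>"
  shows "continuous_on UNIV (sym_gradient \<phi>)"
proof -
  have "continuous_on UNIV (\<lambda>x. frechet_derivative \<phi> (at x) v)" for v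
    using assms by simp
  then have c: "continuous_on UNIV (\<lambda>x. frechet_derivative \<phi> (at x) v $ i)" for v i
    by (intro continuous_on_component)
  have "sym_gradient \<phi> = (\<lambda>x. \<chi> i j. (frechet_derivative \<phi> (at x) (axis j 1) $ i
      + frechet_derivative \<phi> (at x) (axis i 1) $ j) * (1/2))"
    by (simp add: fun_eq_iff vec_eq_iff sym_gradient_def jacobian_def matrix_def transpose_def)
  then show ?thesis
    by (simp only:) (intro continuous_on_vec_lambda continuous_on_add continuous_on_mult continuous_on_const c)
qed

text \<open>The fractions are the shares of area on which the test gradient produces
  \<open>A\<close> and \<open>B\<close>, for layer width 1/n and box length n. They tend to
  \<open>l\<close> and \<open>1 - l\<close>, so the contribution of the crude bound \<open>M\<close>
  disappears.\<close>

lemma Lim_lamination_bound: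
  fixes l fA fB M :: real
  assumes "\<And>n. n \<ge> N \<Longrightarrow> F \<le> M + (fA - M) * ((l - 1 / real n) * (real n - 2) / ((1 + 2 / real n) * (real n + 2)))
     + (fB - M) * ((1 - l - 2 / real n) * (real n - 2) / ((1 + 2 / real n) * (real n + 2)))"
  shows "F \<le> l * fA + (1 - l) * fB"
proof -
  have r: "(\<lambda>n. (real n - 2) / (real n + 2)) \<longlonglongrightarrow> 1"
  proof -
    have "LIM n sequentially. 2 + real n :> at_infinity"
      by (intro filterlim_at_top_imp_at_infinity filterlim_tendsto_add_at_top[OF tendsto_const filterlim_real_sequentially])
    then have "(\<lambda>n. 1 - 4 / (2 + real n)) \<longlonglongrightarrow> 1 - 0"
      by (intro tendsto_diff tendsto_const tendsto_divide_0[OF tendsto_const])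
    moreover have "1 - 4 / (2 + real n) = (real n - 2) / (real n + 2)" for n by (simp add: field_simps)
    ultimately show ?thesis by simp
  qed
  have i: "(\<lambda>n. a / real n) \<longlonglongrightarrow> 0" for a
    by (rule lim_const_over_n)
  have "(\<lambda>n. M + (fA - M) * ((l - 1 / real n) / (1 + 2 / real n) * ((real n - 2) / (real n + 2)))
     + (fB - M) * ((1 - l - 2 / real n) / (1 + 2 / real n) * ((real n - 2) / (real n + 2))))
     \<longlonglongrightarrow> M + (fA - M) * ((l - 0) / (1 + 0) * 1) + (fB - M) * ((1 - l - 0) / (1 + 0) * 1)"
    by (intro tendsto_intros i r) simp_all
  moreover have "\<forall>\<^sub>F n in sequentially. F \<le> M + (fA - M) * ((l - 1 / real n) / (1 + 2 / real n) * ((real n - 2) / (real n + 2)))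
     + (fB - M) * ((1 - l - 2 / real n) / (1 + 2 / real n) * ((real n - 2) / (real n + 2)))"
    using assms by (auto simp: eventually_sequentially intro!: exI[of _ N])
  ultimately have "F \<le> M + (fA - M) * ((l - 0) / (1 + 0) * 1) + (fB - M) * ((1 - l - 0) / (1 + 0) * 1)"
    using tendsto_lowerbound by fastforce
  then show ?thesis by (simp add: algebra_simps)
qed

text \<open>Exact values on \<open>G1\<close> and \<open>G2\<close>, the bound \<open>C\<close> on
  the rest of \<Omega>.\<close>

lemma set_lebesgue_integral_le_split:
  fixes F :: "'a \<Rightarrow> real"
  assumes F: "F \<in> borel_measurable M" and \<Omega>: "\<Omega> \<in> sets M" "emeasure M \<Omega> < \<infinity>"
    and G: "G1 \<in> sets M" "G2 \<in> sets M" "G1 \<subseteq> \<Omega>" "G2 \<subseteq> \<Omega>" "G1 \<inter> G2 = {}"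
    and bd: "\<And>x. \<bar>F x\<bar> \<le> C"
    and v: "\<And>x. x \<in> G1 \<Longrightarrow> F x = a1" "\<And>x. x \<in> G2 \<Longrightarrow> F x = a2"
  shows "(LINT x:\<Omega>|M. F x) \<le> C * measure M \<Omega> + (a1 - C) * measure M G1 + (a2 - C) * measure M G2"
proof -
  have fin: "emeasure M G1 < \<infinity>" "emeasure M G2 < \<infinity>"
    using emeasure_mono[OF G(3) \<Omega>(1)] emeasure_mono[OF G(4) \<Omega>(1)] \<Omega>(2) by (auto intro: le_less_trans)
  have int\<Omega>: "integrable M (\<lambda>x. indicator \<Omega> x * C)"
    using \<Omega> by (intro integrable_mult_left integrable_real_indicator) auto
  have "integrable M (\<lambda>x. indicator \<Omega> x * F x)"
    by (rule Bochner_Integration.integrable_bound[OF int\<Omega>])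
      (use F \<Omega> bd in \<open>auto intro!: AE_I2 simp: indicator_def abs_mult intro: order_trans[OF bd abs_ge_self]\<close>)
  moreover have int2: "integrable M (\<lambda>x. C * indicator \<Omega> x + (a1 - C) * indicator G1 x + (a2 - C) * indicator G2 x)"
    using \<Omega> G fin by (intro Bochner_Integration.integrable_add integrable_mult_right integrable_real_indicator) auto
  moreover have "indicator \<Omega> x * F x \<le> C * indicator \<Omega> x + (a1 - C) * indicator G1 x + (a2 - C) * indicator G2 x" for x
    using G v bd[of x] by (auto simp: indicator_def)
  ultimately have "(LINT x:\<Omega>|M. F x) \<le> (LINT x|M. C * indicator \<Omega> x + (a1 - C) * indicator G1 x + (a2 - C) * indicator G2 x)"
    unfolding set_lebesgue_integral_def real_scaleR_def by (intro integral_mono)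
  also have "\<dots> = C * measure M \<Omega> + (a1 - C) * measure M G1 + (a2 - C) * measure M G2"
  proof -
    have i: "integrable M (\<lambda>x. C * indicator \<Omega> x)" "integrable M (\<lambda>x. (a1 - C) * indicator G1 x)"
      "integrable M (\<lambda>x. (a2 - C) * indicator G2 x)"
      using \<Omega> G fin by (auto intro!: integrable_mult_right integrable_real_indicator)
    have "space M \<inter> \<Omega> = \<Omega>" "space M \<inter> G1 = G1" "space M \<inter> G2 = G2" using \<Omega> G sets.sets_into_space by blast+
    then show ?thesis
      using i by (simp add: Int_commute)
  qed
  finally show ?thesis .
qed

text \<open>Quasiconvexity at the point of the segment is tested with the tent wave. The integrand
  is \<open>f A\<close> or \<open>f B\<close> on two plateaus and at most \<open>M\<close>
  elsewhere; layer width and box length are coupled through \<open>n\<close>, and n tends to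
  infinity.\<close>

lemma sym_quasiconvex_on_compatible_segment:
  assumes f: "sym_quasiconvex f" and AB: "A \<in> sym_mats" "B \<in> sym_mats" "det (A - B) \<le> 0"
    and l: "0 \<le> l" "l \<le> 1"
  shows "f (l *\<^sub>R A + (1 - l) *\<^sub>R B) \<le> l * f A + (1 - l) * f B"
proof (cases "l = 0 \<or> l = 1 \<or> A = B")
  case True
  then show ?thesis by (auto simp: algebra_simps simp flip: scaleR_add_left)
next
  case False
  with l have l: "0 < l" "l < 1" by auto
  have "A - B \<in> sym_mats" "A - B \<noteq> 0" using AB False subspace_diff[OF subspace_sym_mats] by auto
  with AB(3) obtain a b where ab: "A - B = sym_outer a b" "b \<noteq> 0"
    by (metis det_nonpos_sym_outer)
  define c where "c = rot90 b"
  define E where "E = l *\<^sub>R A + (1 - l) *\<^sub>R B"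
  have E: "E \<in> sym_mats" unfolding E_def
    using AB by (intro subspace_add subspace_scale subspace_sym_mats)
  \<comment> \<open>The slopes \<open>1 - l\<close> and \<open>- l\<close> of the tent are those
    that carry \<open>E\<close> exactly to \<open>A\<close> and \<open>B\<close>.\<close>
  have EA: "E + (1 - l) *\<^sub>R (A - B) = A" and EB: "E + (- l) *\<^sub>R (A - B) = B"
    by (simp_all add: E_def algebra_simps)
  obtain C where C: "C > 0" "\<And>R::real. R \<ge> 2 \<Longrightarrow> \<exists>\<zeta> \<zeta>'. smooth_real \<zeta> \<and>
    (\<forall>t. (\<zeta> has_real_derivative \<zeta>' t) (at t)) \<and> (\<forall>t. 0 \<le> \<zeta> t \<and> \<zeta> t \<le> 1) \<and> (\<forall>t. \<bar>\<zeta>' t\<bar> \<le> C) \<and>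
    (\<forall>t. t \<notin> {0..R} \<longrightarrow> \<zeta> t = 0) \<and> (\<forall>t\<in>{1<..<R-1}. \<zeta> t = 1 \<and> \<zeta>' t = 0)"
    by (rule smooth_cutoff) blast
  obtain K where K: "K > 0" "\<And>\<delta>. 0 < \<delta> \<Longrightarrow> \<delta> < l \<Longrightarrow> 2 * \<delta> < 1 - l \<Longrightarrow> \<exists>H H'. smooth_real H \<and>
    (\<forall>t. (H has_real_derivative H' t) (at t)) \<and> (\<forall>t. \<bar>H t\<bar> \<le> 1) \<and> (\<forall>t. \<bar>H' t\<bar> \<le> K) \<and>
    (\<forall>t. t \<notin> {0..1} \<longrightarrow> H t = 0) \<and> (\<forall>t\<in>{\<delta><..<l}. H' t = 1 - l) \<and> (\<forall>t\<in>{l+\<delta><..<1-\<delta>}. H' t = - l)"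
    by (rule smooth_tent[OF l]) blast
  \<comment> \<open>This radius bounds the test gradient for every \<open>n\<close>, since
    \<open>K\<close> and \<open>C\<close> bound the derivatives and 1 bounds the profiles; hence one
    \<open>M\<close> serves all \<open>n\<close>.\<close>
  define \<rho> where "\<rho> = K * norm (A - B) + C * norm (sym_outer a c)"
  have "bounded (f ` (cball E \<rho> \<inter> sym_mats))"
    using f closed_sym_mats
    by (intro locally_bounded_on_compact compact_Int_closed) (auto simp: sym_quasiconvex_def)
  then obtain M where M: "\<And>X. X \<in> cball E \<rho> \<Longrightarrow> X \<in> sym_mats \<Longrightarrow> \<bar>f X\<bar> \<le> M"
    unfolding bounded_iff by force
  obtain \<kappa> where \<kappa>: "\<kappa> > 0" "\<And>p q r s. p \<le> q \<Longrightarrow> r \<le> s \<Longrightarrow> measure lborel (strip_box b c p q r s) = \<kappa> * ((q - p) * (s - r))"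
    unfolding c_def by (rule measure_strip_box[OF ab(2)]) blast
  obtain N where N: "real N > 2" "1 / real N < l" "2 / real N < 1 - l"
  proof -
    obtain N where "real N > max 2 (max (1 / l) (2 / (1 - l)))" using reals_Archimedean2 by blast
    with l that show ?thesis by (force simp: field_simps)
  qed
  have "f E \<le> M + (f A - M) * ((l - 1 / real n) * (real n - 2) / ((1 + 2 / real n) * (real n + 2)))
     + (f B - M) * ((1 - l - 2 / real n) * (real n - 2) / ((1 + 2 / real n) * (real n + 2)))" if "n \<ge> N" for n
  proof -
    \<comment> \<open>Thin layers and a long box at once: the layers, the margins and the two unit
      ramps of the cut-off all lose their share of the area.\<close>
    define \<delta> R where "\<delta> = 1 / real n" and "R = real n"
    have "R > 2" using N that by (simp add: R_def)
    have \<delta>: "0 < \<delta>" "\<delta> < l" "2 * \<delta> < 1 - l"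
    proof -
      have "1 / real n \<le> 1 / real N" using N that by (intro divide_left_mono) auto
      then show "0 < \<delta>" "\<delta> < l" "2 * \<delta> < 1 - l" using N \<open>R > 2\<close> by (auto simp: \<delta>_def R_def)
    qed
    obtain H H' where H: "smooth_real H" "\<And>t. (H has_real_derivative H' t) (at t)" "\<And>t. \<bar>H t\<bar> \<le> 1"
      "\<And>t. \<bar>H' t\<bar> \<le> K" "\<And>t. t \<notin> {0..1} \<Longrightarrow> H t = 0" "\<And>t. t \<in> {\<delta><..<l} \<Longrightarrow> H' t = 1 - l"
      "\<And>t. t \<in> {l+\<delta><..<1-\<delta>} \<Longrightarrow> H' t = - l"
      using K(2)[OF \<delta>] by blast
    obtain \<zeta> \<zeta>' where \<zeta>: "smooth_real \<zeta>" "\<And>t. (\<zeta> has_real_derivative \<zeta>' t) (at t)"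
      "\<And>t. 0 \<le> \<zeta> t" "\<And>t. \<zeta> t \<le> 1" "\<And>t. \<bar>\<zeta>' t\<bar> \<le> C" "\<And>t. t \<notin> {0..R} \<Longrightarrow> \<zeta> t = 0"
      "\<And>t. t \<in> {1<..<R-1} \<Longrightarrow> \<zeta> t = 1" "\<And>t. t \<in> {1<..<R-1} \<Longrightarrow> \<zeta>' t = 0"
      using C(2)[OF less_imp_le[OF \<open>R > 2\<close>]] by blast
    define \<phi> where "\<phi> = (\<lambda>x. (H (b \<bullet> x) * \<zeta> (c \<bullet> x)) *\<^sub>R a)"
    \<comment> \<open>The tent lives on [0, 1] and the cut-off on [0, R]; \<open>?\<Omega>\<close>
      adds margins around both. On \<open>?A\<close> and \<open>?B\<close> the cut-off is 1 and the
      slope of the tent is constant.\<close>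
    let ?\<Omega> = "strip_box b c (-\<delta>) (1 + \<delta>) (-1) (R + 1)"
    let ?A = "strip_box b c \<delta> l 1 (R - 1)"
    let ?B = "strip_box b c (l + \<delta>) (1 - \<delta>) 1 (R - 1)"
    have \<phi>: "\<phi> \<in> test_functions ?\<Omega>"
      unfolding \<phi>_def c_def
      by (rule plane_wave_test_function[OF H(1,5) \<zeta>(1,6) ab(2)]) (use \<delta> in auto)
    have sg: "sym_gradient \<phi> x = (H' (b \<bullet> x) * \<zeta> (c \<bullet> x)) *\<^sub>R (A - B) + (H (b \<bullet> x) * \<zeta>' (c \<bullet> x)) *\<^sub>R sym_outer a c" for x
      unfolding \<phi>_def ab(1) by (rule sym_gradient_plane_wave[OF H(2) \<zeta>(2)])
    have sym: "E + sym_gradient \<phi> x \<in> sym_mats" for x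
      using E sym_gradient_sym by (intro subspace_add subspace_sym_mats)
    have near: "E + sym_gradient \<phi> x \<in> cball E \<rho>" for x
    proof -
      have "\<bar>H' (b \<bullet> x)\<bar> * \<bar>\<zeta> (c \<bullet> x)\<bar> \<le> K * 1" "\<bar>H (b \<bullet> x)\<bar> * \<bar>\<zeta>' (c \<bullet> x)\<bar> \<le> 1 * C"
        using H(3,4) \<zeta>(3,4,5) K(1) by (intro mult_mono; simp add: less_imp_le)+
      then have "norm (sym_gradient \<phi> x) \<le> \<rho>"
        unfolding sg \<rho>_def
        by (intro norm_triangle_mono) (auto simp: abs_mult intro!: mult_right_mono)
      then show ?thesis by (simp add: dist_norm)
    qed
    have fb: "\<bar>f (E + sym_gradient \<phi> x)\<bar> \<le> M" for x using M near sym by blast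
    have fA: "f (E + sym_gradient \<phi> x) = f A" if "x \<in> ?A" for x
      using that H(6)[of "b \<bullet> x"] \<zeta>(7,8)[of "c \<bullet> x"] EA by (simp add: sg strip_box_def)
    have fB: "f (E + sym_gradient \<phi> x) = f B" if "x \<in> ?B" for x
      using that H(7)[of "b \<bullet> x"] \<zeta>(7,8)[of "c \<bullet> x"] EB by (simp add: sg strip_box_def)
    have meas: "(\<lambda>x. f (E + sym_gradient \<phi> x)) \<in> borel_measurable lborel"
    proof -
      have "continuous_on UNIV (\<lambda>x. E + sym_gradient \<phi> x)"
        using \<phi> by (intro continuous_on_add continuous_on_const Ck_1_sym_gradient_continuous)
          (simp add: test_functions_def del: Ck.simps)
      then have "(\<lambda>x. E + sym_gradient \<phi> x) \<in> borel \<rightarrow>\<^sub>M restrict_space borel sym_mats"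
        using sym by (intro measurable_restrict_space2 borel_measurable_continuous_onI) auto
      from measurable_compose[OF this, of f borel] f show ?thesis
        by (simp add: sym_quasiconvex_def)
    qed
    have bd: "bounded ?\<Omega>" unfolding c_def by (rule bounded_strip_box[OF ab(2)])
    have "(LINT x:?\<Omega>|lborel. f (E + sym_gradient \<phi> x)) \<le>
        M * measure lborel ?\<Omega> + (f A - M) * measure lborel ?A + (f B - M) * measure lborel ?B"
    proof (rule set_lebesgue_integral_le_split[OF meas])
      show "emeasure lborel ?\<Omega> < \<infinity>" using bd emeasure_bounded_finite by blast
    qed (use \<delta> fb fA fB in \<open>auto simp: open_strip_box strip_box_def[of _ _ "_ + _"] strip_box_def\<close>)
    moreover have "f E \<le> 1 / measure lborel ?\<Omega> * (LINT x:?\<Omega>|lborel. f (E + sym_gradient \<phi> x))"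
      using f E \<phi> \<delta> \<open>R > 2\<close> bounded_domain_strip_box[OF ab(2)] by (intro sym_quasiconvex_test) (auto simp: c_def)
    moreover have m: "measure lborel ?\<Omega> = \<kappa> * ((1 + 2 * \<delta>) * (R + 2))"
      "measure lborel ?A = \<kappa> * ((l - \<delta>) * (R - 2))" "measure lborel ?B = \<kappa> * ((1 - l - 2 * \<delta>) * (R - 2))"
      using \<delta> \<open>R > 2\<close> by (simp_all add: \<kappa>(2) algebra_simps)
    moreover have pos: "measure lborel ?\<Omega> > 0" unfolding m using \<kappa>(1) \<delta> \<open>R > 2\<close> by simp
    ultimately have "f E \<le> 1 / measure lborel ?\<Omega> * (M * measure lborel ?\<Omega> + (f A - M) * measure lborel ?A + (f B - M) * measure lborel ?B)"
      by (meson order_trans mult_left_mono divide_nonneg_pos zero_le_one)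
    also have "\<dots> = M + (f A - M) * (measure lborel ?A / measure lborel ?\<Omega>) + (f B - M) * (measure lborel ?B / measure lborel ?\<Omega>)"
      using pos by (simp add: field_simps)
    also have "measure lborel ?A / measure lborel ?\<Omega> = (l - \<delta>) * (R - 2) / ((1 + 2 * \<delta>) * (R + 2))"
      unfolding m using \<kappa>(1) by simp
    also have "measure lborel ?B / measure lborel ?\<Omega> = (1 - l - 2 * \<delta>) * (R - 2) / ((1 + 2 * \<delta>) * (R + 2))"
      unfolding m using \<kappa>(1) by simp
    finally show ?thesis by (simp add: \<delta>_def R_def)
  qed
  then show ?thesis using Lim_lamination_bound unfolding E_def by blast
qed

section \<open>Symmetric quasiconvexity of affine functions minus the determinant\<close>

definition C1_compact :: "(real^2 \<Rightarrow> real) \<Rightarrow> (real^2 \<Rightarrow> real^2 \<Rightarrow> real) \<Rightarrow> bool" where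
  "C1_compact u D \<longleftrightarrow> (\<forall>x. (u has_derivative D x) (at x)) \<and>
     (\<forall>v. continuous_on UNIV (\<lambda>x. D x v)) \<and> bounded {x. u x \<noteq> 0}"

lemma C1_compact_continuous: "C1_compact u D \<Longrightarrow> continuous_on UNIV u"
  unfolding C1_compact_def continuous_on_eq_continuous_at[OF open_UNIV]
  using has_derivative_continuous by blast

lemma C1_compact_support:
  assumes "C1_compact u D"
  obtains \<rho> where "\<rho> > 0" "\<And>x. \<rho> \<le> norm x \<Longrightarrow> u x = 0" "\<And>x v. \<rho> \<le> norm x \<Longrightarrow> D x v = 0"
proof -
  obtain r where r: "r > 0" "\<And>x. u x \<noteq> 0 \<Longrightarrow> norm x \<le> r"
    using assms unfolding C1_compact_def bounded_pos by auto
  have u0: "u x = 0" if "r < norm x" for x using r that by force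
  have "D x v = 0" if x: "r + 1 \<le> norm x" for x v
  proof -
    have "((\<lambda>_. 0) has_derivative D x) (at x)"
    proof (rule has_derivative_transform_within_open)
      show "(u has_derivative D x) (at x)" using assms by (simp add: C1_compact_def)
      show "open {y. r < norm y}" by (intro open_Collect_less continuous_intros)
    qed (use x u0 in auto)
    from has_derivative_unique[OF this has_derivative_const] show ?thesis by simp
  qed
  then show ?thesis using that[of "r + 1"] r(1) u0 by simp
qed

lemma continuous_compact_support_integrable:
  fixes g :: "real^2 \<Rightarrow> real"
  assumes c: "continuous_on UNIV g" and s: "\<And>x. \<rho> \<le> norm x \<Longrightarrow> g x = 0"
  shows "integrable lborel g"
proof -
  have "integrable lborel (\<lambda>x. indicator (cball 0 \<rho>) x *\<^sub>R g x)"
    by (rule borel_integrable_compact) (auto intro: continuous_on_subset[OF c])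
  moreover have "(\<lambda>x. indicator (cball 0 \<rho>) x *\<^sub>R g x) = g"
    using s by (auto simp: fun_eq_iff indicator_def)
  ultimately show ?thesis by simp
qed

lemma continuous_compact_support_bounded:
  fixes g :: "real^2 \<Rightarrow> real"
  assumes c: "continuous_on UNIV g" and s: "\<And>x. \<rho> \<le> norm x \<Longrightarrow> g x = 0"
  obtains C where "C \<ge> 0" "\<And>x. \<bar>g x\<bar> \<le> C"
proof -
  have "compact (g ` cball 0 \<rho>)"
    by (intro compact_continuous_image continuous_on_subset[OF c]) auto
  then obtain C where C: "C > 0" "\<And>x. x \<in> cball 0 \<rho> \<Longrightarrow> \<bar>g x\<bar> \<le> C"
    using compact_imp_bounded bounded_pos by (metis image_eqI real_norm_def)
  have "\<bar>g x\<bar> \<le> C" for x using C s[of x] by (cases "x \<in> cball 0 \<rho>") auto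
  then show ?thesis by (rule that[OF less_imp_le[OF C(1)]])
qed

lemma integral_translate:
  fixes g :: "real^2 \<Rightarrow> real"
  assumes "g \<in> borel_measurable borel"
  shows "(LINT x|lborel. g (x + z)) = (LINT x|lborel. g x)"
proof -
  have "(LINT x|lborel. g x) = (LINT x|distr lborel borel ((+) z). g x)"
    by (subst lborel_distr_plus) simp
  also have "\<dots> = (LINT x|lborel. g (z + x))"
    using assms by (subst integral_distr) auto
  finally show ?thesis by (simp add: add.commute)
qed

text \<open>Dominated convergence: by the mean value theorem each quotient is a value of the
  directional derivative of \<open>w\<close>, hence bounded, and since the steps are at most 1 all
  quotients vanish outside the ball of radius \<open>\<rho> + norm v\<close>.\<close>

lemma integral_difference_quotient:
  assumes w: "C1_compact w D" and p: "continuous_on UNIV p" "\<And>x. \<bar>p x\<bar> \<le> P"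
  shows "(\<lambda>n. LINT x|lborel. p x * ((w (x + inverse (real (Suc n)) *\<^sub>R v) - w x) * real (Suc n)))
    \<longlonglongrightarrow> (LINT x|lborel. p x * D x v)"
proof -
  obtain \<rho> where \<rho>: "\<rho> > 0" "\<And>x. \<rho> \<le> norm x \<Longrightarrow> w x = 0" "\<And>x v. \<rho> \<le> norm x \<Longrightarrow> D x v = 0"
    using C1_compact_support[OF w] by metis
  have wd: "(w has_derivative D x) (at x)" and Dc: "continuous_on UNIV (\<lambda>x. D x v)" for x v
    using w by (auto simp: C1_compact_def)
  obtain C where C: "C \<ge> 0" "\<And>x. \<bar>D x v\<bar> \<le> C"
    using continuous_compact_support_bounded[OF Dc \<rho>(3)] by metis
  have P: "P \<ge> 0" using p(2)[of 0] by linarith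
  have wc: "continuous_on UNIV w" by (rule C1_compact_continuous[OF w])
  define h where "h n = inverse (real (Suc n))" for n
  have h: "h n > 0" "h n \<le> 1" for n by (auto simp: h_def inverse_le_1_iff)
  define q where "q n x = p x * ((w (x + h n *\<^sub>R v) - w x) * real (Suc n))" for n x
  have line: "((\<lambda>t. w (x + t *\<^sub>R v)) has_real_derivative D (x + t *\<^sub>R v) v) (at t)" for x t
  proof -
    have "((\<lambda>t. x + t *\<^sub>R v) has_derivative (\<lambda>s. s *\<^sub>R v)) (at t)"
      by (auto intro!: derivative_eq_intros)
    from has_derivative_compose[OF this wd]
    show ?thesis
      using linear_scale[OF has_derivative_linear[OF wd]]
      by (simp add: has_field_derivative_def mult_commute_abs)
  qed
  have dq: "\<exists>z. (w (x + h n *\<^sub>R v) - w x) * real (Suc n) = D (x + z *\<^sub>R v) v" for n x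
  proof -
    obtain z where "w (x + h n *\<^sub>R v) - w (x + 0 *\<^sub>R v) = (h n - 0) * D (x + z *\<^sub>R v) v"
      using MVT2[OF h(1)[of n], of "\<lambda>t. w (x + t *\<^sub>R v)" "\<lambda>t. D (x + t *\<^sub>R v) v"] line by blast
    then show ?thesis by (intro exI[of _ z]) (simp add: h_def)
  qed
  have "(\<lambda>n. LINT x|lborel. q n x) \<longlonglongrightarrow> (LINT x|lborel. p x * D x v)"
  proof (rule integral_dominated_convergence[where w = "\<lambda>x. P * C * indicator (cball 0 (\<rho> + norm v)) x"])
    show "(\<lambda>x. p x * D x v) \<in> borel_measurable lborel"
      using p(1) Dc by (simp add: borel_measurable_continuous_onI continuous_on_mult)
    have "continuous_on UNIV (\<lambda>x. w (x + h n *\<^sub>R v))" for n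
      by (rule continuous_on_compose2[OF wc]) (auto intro!: continuous_on_add continuous_on_const continuous_on_id)
    then show "q n \<in> borel_measurable lborel" for n
      using p(1) wc unfolding q_def
      by (simp add: borel_measurable_continuous_onI continuous_on_mult continuous_on_diff)
    show "integrable lborel (\<lambda>x. P * C * indicator (cball 0 (\<rho> + norm v)) x :: real)"
      by (intro integrable_mult_right integrable_real_indicator emeasure_bounded_finite) auto
    show "AE x in lborel. norm (q n x) \<le> P * C * indicator (cball 0 (\<rho> + norm v)) x" for n
    proof (rule AE_I2)
      fix x
      show "norm (q n x) \<le> P * C * indicator (cball 0 (\<rho> + norm v)) x"
      proof (cases "x \<in> cball 0 (\<rho> + norm v)")
        case True
        obtain z where "(w (x + h n *\<^sub>R v) - w x) * real (Suc n) = D (x + z *\<^sub>R v) v" using dq by blast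
        then show ?thesis using True C(2)[of "x + z *\<^sub>R v"] p(2)[of x] P
          unfolding q_def by (simp add: abs_mult mult_mono)
      next
        case False
        have "norm (h n *\<^sub>R v) \<le> norm v" using h[of n] by (simp add: mult_left_le_one_le)
        moreover have "\<rho> + norm v < norm x" using False by simp
        ultimately have "norm x \<ge> \<rho>" "norm (x + h n *\<^sub>R v) \<ge> \<rho>"
          using norm_diff_ineq[of x "h n *\<^sub>R v"] norm_ge_zero[of v] by linarith+
        then show ?thesis using \<rho>(2) False by (simp add: q_def)
      qed
    qed
    show "AE x in lborel. (\<lambda>n. q n x) \<longlonglongrightarrow> p x * D x v"
    proof (rule AE_I2)
      fix x
      have "((\<lambda>t. (w (x + t *\<^sub>R v) - w x) / t) \<longlongrightarrow> D x v) (at 0)"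
        using line[of x 0] by (simp add: DERIV_def)
      moreover have "filterlim h (at 0) sequentially"
        using h(1) LIMSEQ_inverse_real_of_nat unfolding filterlim_at h_def
        by (auto intro!: always_eventually)
      ultimately have "(\<lambda>n. (w (x + h n *\<^sub>R v) - w x) / h n) \<longlonglongrightarrow> D x v"
        by (rule filterlim_compose)
      then show "(\<lambda>n. q n x) \<longlonglongrightarrow> p x * D x v"
        unfolding q_def by (intro tendsto_mult tendsto_const) (simp add: h_def divide_inverse)
    qed
  qed
  then show ?thesis by (simp add: q_def h_def)
qed

text \<open>With weight 1 the integral of every difference quotient vanishes by translation
  invariance, and so does the limit.\<close>

lemma integral_derivative_zero:
  assumes w: "C1_compact w D"
  shows "(LINT x|lborel. D x v) = 0"
proof -
  obtain \<rho> where \<rho>: "\<And>x. \<rho> \<le> norm x \<Longrightarrow> w x = 0" using C1_compact_support[OF w] by metis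
  have wc: "continuous_on UNIV w" by (rule C1_compact_continuous[OF w])
  note int = continuous_compact_support_integrable[OF wc \<rho>]
  have m: "w \<in> borel_measurable borel" by (rule borel_measurable_continuous_onI[OF wc])
  have int': "integrable lborel (\<lambda>x. w (x + z))" for z
  proof (rule continuous_compact_support_integrable[where \<rho> = "\<rho> + norm z"])
    show "continuous_on UNIV (\<lambda>x. w (x + z))"
      by (rule continuous_on_compose2[OF wc]) (auto intro!: continuous_on_add continuous_on_const continuous_on_id)
    show "w (x + z) = 0" if "\<rho> + norm z \<le> norm x" for x
      using that norm_diff_ineq[of x z] by (intro \<rho>) linarith
  qed
  have "(LINT x|lborel. 1 * ((w (x + z) - w x) * r)) = 0" for z r
    using int int' integral_translate[OF m] by simp
  with integral_difference_quotient[OF w, of "\<lambda>_. 1" 1 v]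
  have "(\<lambda>n::nat. 0) \<longlonglongrightarrow> (LINT x|lborel. 1 * D x v)"
    by (simp only: continuous_on_const abs_one order_refl)
  then show ?thesis by (simp add: LIMSEQ_const_iff)
qed

lemma C1_compact_translate:
  assumes "C1_compact w D"
  shows "C1_compact (\<lambda>x. w (x + z)) (\<lambda>x. D (x + z))"
  unfolding C1_compact_def
proof (intro conjI allI)
  fix x
  have "((\<lambda>x. x + z) has_derivative (\<lambda>v. v)) (at x)" by (auto intro!: derivative_eq_intros)
  moreover have "(w has_derivative D (x + z)) (at (x + z))" using assms by (simp add: C1_compact_def)
  ultimately show "((\<lambda>x. w (x + z)) has_derivative D (x + z)) (at x)"
    by (rule has_derivative_compose)
next
  fix v
  have "continuous_on UNIV (\<lambda>x. D x v)" using assms by (simp add: C1_compact_def)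
  then show "continuous_on UNIV (\<lambda>x. D (x + z) v)"
    by (rule continuous_on_compose2) (auto intro!: continuous_on_add continuous_on_const continuous_on_id)
next
  have "{x. w (x + z) \<noteq> 0} = (\<lambda>x. x - z) ` {x. w x \<noteq> 0}"
    by (auto simp: image_iff intro!: exI[of _ "_ + z"])
  then show "bounded {x. w (x + z) \<noteq> 0}"
    using assms bounded_translation_minus[of "{x. w x \<noteq> 0}" z] by (simp add: C1_compact_def)
qed

lemma C1_compact_mult:
  assumes "C1_compact u D" "C1_compact w F"
  shows "C1_compact (\<lambda>x. u x * w x) (\<lambda>x v. u x * F x v + D x v * w x)"
  using assms C1_compact_continuous[OF assms(1)] C1_compact_continuous[OF assms(2)]
  unfolding C1_compact_def
  by (auto intro!: has_derivative_mult continuous_on_add continuous_on_mult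
      elim!: bounded_subset)

text \<open>Integration by parts against a difference quotient of \<open>w\<close> avoids second derivatives.\<close>

lemma integral_null_lagrangian:
  assumes u: "C1_compact u D" and w: "C1_compact w F"
  shows "(LINT x|lborel. D x a * F x b) = (LINT x|lborel. D x b * F x a)"
proof -
  obtain \<rho> where \<rho>: "\<And>x. \<rho> \<le> norm x \<Longrightarrow> u x = 0" "\<And>x v. \<rho> \<le> norm x \<Longrightarrow> D x v = 0"
    using C1_compact_support[OF u] by metis
  obtain \<sigma> where \<sigma>: "\<And>x. \<sigma> \<le> norm x \<Longrightarrow> w x = 0" "\<And>x v. \<sigma> \<le> norm x \<Longrightarrow> F x v = 0"
    using C1_compact_support[OF w] by metis
  have c: "continuous_on UNIV u" "continuous_on UNIV w" "continuous_on UNIV (\<lambda>x. D x a)" "continuous_on UNIV (\<lambda>x. F x a)"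
    using C1_compact_continuous u w by (auto simp: C1_compact_def)
  have tr: "continuous_on UNIV (\<lambda>x. g (x + z))" if "continuous_on UNIV g" for g :: "real^2 \<Rightarrow> real" and z
    by (rule continuous_on_compose2[OF that]) (auto intro!: continuous_on_add continuous_on_const continuous_on_id)
  obtain P where P: "\<And>x. \<bar>D x a\<bar> \<le> P" using continuous_compact_support_bounded[OF c(3) \<rho>(2)] by metis
  obtain P' where P': "\<And>x. \<bar>F x a\<bar> \<le> P'" using continuous_compact_support_bounded[OF c(4) \<sigma>(2)] by metis
  \<comment> \<open>Discrete integration by parts: the derivative is moved by integrating the
    derivative of \<open>u x * w (x + z)\<close>, the shift by translating the variable, which turns
    \<open>z\<close> into \<open>- z\<close>.\<close>
  have key: "(LINT x|lborel. D x a * (w (x + z) - w x)) = - (LINT x|lborel. F x a * (u (x - z) - u x))" for z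
  proof -
    have i: "integrable lborel (\<lambda>x. D x a * w (x + z))" "integrable lborel (\<lambda>x. D x a * w x)"
      "integrable lborel (\<lambda>x. u x * F (x + z) a)" "integrable lborel (\<lambda>x. u x * F x a)"
      by (rule continuous_compact_support_integrable[where \<rho> = \<rho>],
          rule continuous_on_mult[OF c(3) tr[OF c(2)]] continuous_on_mult[OF c(3) c(2)]
            continuous_on_mult[OF c(1) tr[OF c(4)]] continuous_on_mult[OF c(1) c(4)], simp add: \<rho>)+
    have j: "integrable lborel (\<lambda>x. F x a * u (x - z))"
      by (rule continuous_compact_support_integrable[where \<rho> = \<sigma>])
        (use continuous_on_mult[OF c(4) tr[OF c(1), of "- z"]] in \<open>simp_all add: \<sigma>\<close>)
    have 1: "(LINT x|lborel. u x * F (x + z) a + D x a * w (x + z)) = 0" for z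
      by (rule integral_derivative_zero[OF C1_compact_mult[OF u C1_compact_translate[OF w]]])
    have "(LINT x|lborel. u x * F (x + z) a) + (LINT x|lborel. D x a * w (x + z)) = 0"
      "(LINT x|lborel. u x * F x a) + (LINT x|lborel. D x a * w x) = 0"
      using 1[of z] 1[of 0] i by simp_all
    moreover have "(LINT x|lborel. u x * F (x + z) a) = (LINT x|lborel. F x a * u (x - z))"
    proof -
      have "(\<lambda>x. F x a * u (x - z)) \<in> borel_measurable borel"
        using continuous_on_mult[OF c(4) tr[OF c(1), of "- z"]] by (intro borel_measurable_continuous_onI) simp
      from integral_translate[OF this, of z] show ?thesis by (simp only: mult.commute[of "u _"] add_diff_cancel)
    qed
    moreover have "(LINT x|lborel. D x a * (w (x + z) - w x)) =
        (LINT x|lborel. D x a * w (x + z)) - (LINT x|lborel. D x a * w x)"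
      unfolding right_diff_distrib by (rule Bochner_Integration.integral_diff[OF i(1,2)])
    moreover have "(LINT x|lborel. F x a * (u (x - z) - u x)) =
        (LINT x|lborel. F x a * u (x - z)) - (LINT x|lborel. u x * F x a)"
      unfolding right_diff_distrib mult.commute[of "u _"]
      using i(4) by (intro Bochner_Integration.integral_diff j) (simp only: mult.commute[of "u _"])
    ultimately show ?thesis by linarith
  qed
  \<comment> \<open>Both sides of \<open>key\<close> are divided by the step length. The shift by a
    multiple of \<open>- b\<close> yields \<open>D x (- b)\<close>, whose sign cancels the one in
    \<open>key\<close>.\<close>
  have "(\<lambda>n. LINT x|lborel. D x a * ((w (x + inverse (real (Suc n)) *\<^sub>R b) - w x) * real (Suc n)))
      \<longlonglongrightarrow> (LINT x|lborel. D x a * F x b)"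
    by (rule integral_difference_quotient[OF w c(3) P])
  moreover have "(LINT x|lborel. D x a * ((w (x + inverse (real (Suc n)) *\<^sub>R b) - w x) * real (Suc n)))
      = - (LINT x|lborel. F x a * ((u (x + inverse (real (Suc n)) *\<^sub>R (- b)) - u x) * real (Suc n)))" for n
    using key[of "inverse (real (Suc n)) *\<^sub>R b"] unfolding mult.assoc[symmetric]
    by (simp del: of_nat_Suc)
  moreover have "(\<lambda>n. - (LINT x|lborel. F x a * ((u (x + inverse (real (Suc n)) *\<^sub>R (- b)) - u x) * real (Suc n))))
      \<longlonglongrightarrow> - (LINT x|lborel. F x a * D x (- b))"
    by (intro tendsto_minus integral_difference_quotient[OF u c(4) P'])
  ultimately have "(LINT x|lborel. D x a * F x b) = - (LINT x|lborel. F x a * D x (- b))"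
    using LIMSEQ_unique by simp
  moreover have "D x (- b) = - D x b" for x
    using u linear_neg[OF has_derivative_linear, of u "D x" "at x" b] by (simp add: C1_compact_def)
  ultimately show ?thesis by (simp add: mult.commute)
qed

lemma test_function_component:
  assumes "\<phi> \<in> test_functions \<Omega>"
  shows "C1_compact (\<lambda>x. \<phi> x $ i) (\<lambda>x v. frechet_derivative \<phi> (at x) v $ i)"
proof -
  have "Ck 1 \<phi>" using assms by (simp add: test_functions_def del: Ck.simps)
  then have d: "\<phi> differentiable (at x)" and c: "continuous_on UNIV (\<lambda>x. frechet_derivative \<phi> (at x) v)" for x v
    by auto
  have "bounded {x. \<phi> x \<noteq> 0}"
    using assms by (intro bounded_subset[OF compact_imp_bounded closure_subset]) (simp add: test_functions_def)
  then have "bounded {x. \<phi> x $ i \<noteq> 0}" by (rule bounded_subset) auto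
  moreover have "((\<lambda>x. \<phi> x $ i) has_derivative (\<lambda>v. frechet_derivative \<phi> (at x) v $ i)) (at x)" for x
    by (intro bounded_linear.has_derivative[OF bounded_linear_vec_nth] frechet_derivative_works[THEN iffD1] d)
  ultimately show ?thesis unfolding C1_compact_def by (simp add: continuous_on_component[OF c])
qed

text \<open>Lets integrals over \<Omega> be replaced by integrals over the plane, where translation
  is available.\<close>

lemma test_function_derivative_outside:
  assumes "\<phi> \<in> test_functions \<Omega>" "x \<notin> \<Omega>"
  shows "frechet_derivative \<phi> (at x) v = 0"
proof -
  have x: "x \<in> - closure {x. \<phi> x \<noteq> 0}" using assms by (auto simp: test_functions_def)
  have "(\<phi> has_derivative (\<lambda>_. 0)) (at x)"
  proof (rule has_derivative_transform_within_open[OF has_derivative_const _ x])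
    show "0 = \<phi> y" if "y \<in> - closure {x. \<phi> x \<noteq> 0}" for y
      using that closure_subset[of "{x. \<phi> x \<noteq> 0}"] by auto
  qed auto
  from frechet_derivative_at[OF this, symmetric] show ?thesis by simp
qed

text \<open>The terms linear in the gradient integrate to zero, and so does its full determinant.
  What remains of the increment is \<open>k / 4\<close> times the integral of a square, hence the
  sign condition on \<open>k\<close>.\<close>

lemma sym_quasiconvex_linear_minus_det:
  fixes L :: mat2
  assumes k: "k \<ge> 0"
  shows "sym_quasiconvex (\<lambda>M. L \<bullet> M - k * det M)"
proof -
  let ?f = "\<lambda>M::mat2. L \<bullet> M - k * det M"
  have cont: "continuous_on UNIV ?f"
    unfolding det_2 by (intro continuous_intros continuous_on_component)
  have bd: "locally_bounded_on_sym ?f"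
    unfolding locally_bounded_on_sym_def
  proof (intro ballI exI conjI)
    fix A :: mat2
    have "compact (?f ` cball A 1)" by (intro compact_continuous_image continuous_on_subset[OF cont]) auto
    then show "bounded (?f ` (ball A 1 \<inter> sym_mats))"
      by (rule bounded_subset[OF compact_imp_bounded]) auto
  qed simp
  have avg: "?f A \<le> 1 / measure lborel \<Omega> * (LINT x:\<Omega>|lborel. ?f (A + sym_gradient \<phi> x))"
    if \<Omega>: "bounded_domain \<Omega>" and A: "A \<in> sym_mats" and \<phi>: "\<phi> \<in> test_functions \<Omega>" for \<Omega> A \<phi>
  proof -
    define d where "d i j x = frechet_derivative \<phi> (at x) (axis j 1) $ i" for i j x
    note C1 = test_function_component[OF \<phi>]
    have d0: "d i j x = 0" if "x \<notin> \<Omega>" for i j x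
      using test_function_derivative_outside[OF \<phi> that] by (simp add: d_def)
    have dc: "continuous_on UNIV (d i j)" for i j
      using C1[of i] unfolding d_def C1_compact_def by blast
    obtain \<rho> where \<rho>: "\<And>i j x. \<rho> \<le> norm x \<Longrightarrow> d i j x = 0"
    proof -
      obtain r where "\<And>x. x \<in> \<Omega> \<Longrightarrow> norm x \<le> r" using \<Omega> by (auto simp: bounded_domain_def bounded_iff)
      with d0 that[of "r + 1"] show ?thesis by force
    qed
    have int1: "integrable lborel (d i j)" for i j
      by (rule continuous_compact_support_integrable[OF dc \<rho>])
    have int2: "integrable lborel (\<lambda>x. d i j x * d i' j' x)" for i j i' j'
      by (rule continuous_compact_support_integrable[where \<rho> = \<rho>]) (auto intro!: continuous_on_mult dc simp: \<rho>)
    have zero: "(LINT x|lborel. d i j x) = 0" for i j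
      unfolding d_def by (rule integral_derivative_zero[OF C1])
    have null: "(LINT x|lborel. d 1 1 x * d 2 2 x) = (LINT x|lborel. d 1 2 x * d 2 1 x)"
      unfolding d_def by (rule integral_null_lagrangian[OF C1 C1])
    \<comment> \<open>The increment of \<open>?f\<close> at \<open>A\<close>, sorted into linear
      terms, the determinant of the full gradient and the square of the curl.\<close>
    define g where "g x = (L$1$1 - k * A$2$2) * d 1 1 x + (L$2$2 - k * A$1$1) * d 2 2 x
      + ((L$1$2 + L$2$1) / 2 + k * A$1$2) * d 1 2 x + ((L$1$2 + L$2$1) / 2 + k * A$1$2) * d 2 1 x
      - k * (d 1 1 x * d 2 2 x) + k * (d 1 2 x * d 2 1 x) + k / 4 * (d 1 2 x - d 2 1 x)\<^sup>2" for x
    have fg: "?f (A + sym_gradient \<phi> x) = ?f A + g x" for x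
      using A by (simp add: g_def d_def mem_sym_mats sym_gradient_def jacobian_def matrix_def transpose_def
          det_2 inner_vec_def sum_2 power2_eq_square field_simps)
    have int3: "integrable lborel (\<lambda>x. (d 1 2 x - d 2 1 x)\<^sup>2)"
      unfolding power2_eq_square by (simp add: algebra_simps int2)
    have intg: "integrable lborel g"
      unfolding g_def using int1 int2 int3 by (intro Bochner_Integration.integrable_add Bochner_Integration.integrable_diff integrable_mult_right)
    have "(LINT x|lborel. g x) = k / 4 * (LINT x|lborel. (d 1 2 x - d 2 1 x)\<^sup>2)"
      unfolding g_def using int1 int2 int3 by (simp add: zero null)
    also have "\<dots> \<ge> 0" using k by simp
    finally have g_nonneg: "(LINT x|lborel. g x) \<ge> 0" .
    have fin: "emeasure lborel \<Omega> < \<infinity>" "\<Omega> \<in> sets lborel"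
      using \<Omega> emeasure_bounded_finite by (auto simp: bounded_domain_def)
    have "(LINT x:\<Omega>|lborel. ?f (A + sym_gradient \<phi> x)) = (LINT x|lborel. ?f A * indicator \<Omega> x + g x)"
      unfolding set_lebesgue_integral_def fg
      by (intro Bochner_Integration.integral_cong) (auto simp: indicator_def g_def d0)
    also have "\<dots> = ?f A * measure lborel \<Omega> + (LINT x|lborel. g x)"
      using fin intg by (subst Bochner_Integration.integral_add) auto
    finally have *: "(LINT x:\<Omega>|lborel. ?f (A + sym_gradient \<phi> x)) \<ge> ?f A * measure lborel \<Omega>"
      using g_nonneg by linarith
    have "emeasure lborel \<Omega> \<noteq> 0"
      using \<Omega> open_not_negligible[of \<Omega>] by (auto simp: bounded_domain_def negligible_iff_null_sets null_sets_def)
    then have "measure lborel \<Omega> > 0"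
      using fin by (simp add: measure_def enn2real_positive_iff zero_less_iff_neq_zero)
    with * show ?thesis by (simp add: field_simps)
  qed
  show ?thesis unfolding sym_quasiconvex_def
  proof (intro conjI allI impI ballI bd INF_greatest)
    show "?f \<in> borel_measurable (restrict_space borel sym_mats)"
      by (intro measurable_restrict_space1 borel_measurable_continuous_onI cont)
  qed (use avg in auto)
qed

section \<open>Staircases in the plane\<close>

text \<open>In null coordinates this is the determinant of the difference of two wells: negative for
  compatible pairs that are not rank-one compatible, zero for rank-one compatible and positive for
  incompatible pairs.\<close>

definition gap :: "real \<times> real \<Rightarrow> real \<times> real \<Rightarrow> real" where
  "gap a b = (fst a - fst b) * (snd a - snd b)"

text \<open>The two points with index \<open>i\<close> are the upper left and the lower right vertex
  of the box between \<open>(x i, y i)\<close> and \<open>(x (i + 1), y (i + 1))\<close>. Integer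
  indices let the staircase grow at both ends without renumbering.\<close>

definition stairs :: "(int \<Rightarrow> real) \<Rightarrow> (int \<Rightarrow> real) \<Rightarrow> int \<Rightarrow> int \<Rightarrow> int \<Rightarrow> int \<Rightarrow> (real \<times> real) set" where
  "stairs x y a1 a2 b1 b2 = (\<lambda>i. (x i, y (i + 1))) ` {a1..a2} \<union> (\<lambda>i. (x (i + 1), y i)) ` {b1..b2}"

text \<open>At either end the two index ranges may differ by one, which is a three-well block ending
  the chain; the values of \<open>x\<close> and \<open>y\<close> at unused indices are arbitrary.\<close>

definition is_stairs :: "(int \<Rightarrow> real) \<Rightarrow> (int \<Rightarrow> real) \<Rightarrow> int \<Rightarrow> int \<Rightarrow> int \<Rightarrow> int \<Rightarrow> (real \<times> real) set \<Rightarrow> bool" where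
  "is_stairs x y a1 a2 b1 b2 S \<longleftrightarrow> strict_mono x \<and> strict_mono y \<and> \<bar>a1 - b1\<bar> \<le> 1 \<and> \<bar>a2 - b2\<bar> \<le> 1 \<and>
     a1 \<le> a2 \<and> a1 \<le> b2 \<and> b1 \<le> a2 \<and> b1 \<le> b2 \<and> S = stairs x y a1 a2 b1 b2"

definition staircase :: "(real \<times> real) set \<Rightarrow> bool" where
  "staircase S \<longleftrightarrow> (\<exists>x y a1 a2 b1 b2. is_stairs x y a1 a2 b1 b2 S)"

text \<open>What the remaining wells of a block of either kind have in common with respect to a
  strictly compatible pair \<open>p\<close>, \<open>q\<close> of the block: rank-one compatible with
  one of the two, incompatible with the other.\<close>

definition extends_pair :: "real \<times> real \<Rightarrow> real \<times> real \<Rightarrow> real \<times> real \<Rightarrow> bool" where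
  "extends_pair p q c \<longleftrightarrow> (gap p c = 0 \<and> gap q c > 0) \<or> (gap q c = 0 \<and> gap p c > 0)"

definition no_three_aligned :: "(real \<times> real) set \<Rightarrow> bool" where
  "no_three_aligned S \<longleftrightarrow> (\<forall>u\<in>S. \<forall>v\<in>S. \<forall>w\<in>S. distinct [u, v, w] \<longrightarrow>
     \<not> (fst u = fst v \<and> fst v = fst w) \<and> \<not> (snd u = snd v \<and> snd v = snd w))"

lemma no_three_alignedD:
  assumes "no_three_aligned S" "u \<in> S" "v \<in> S" "w \<in> S" "distinct [u, v, w]"
  shows "\<not> (fst u = fst v \<and> fst v = fst w)" "\<not> (snd u = snd v \<and> snd v = snd w)"
  using assms unfolding no_three_aligned_def by blast+

text \<open>Index \<open>k - 1\<close> receives \<open>c\<close>; unit steps fill the lower indices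
  so that the sequence stays strictly monotone on all integers.\<close>

lemma strict_mono_extend_below:
  fixes x :: "int \<Rightarrow> real"
  assumes "strict_mono x" "c < x k"
  shows "strict_mono (\<lambda>j. if j < k then c + real_of_int (j - (k - 1)) else x j)"
proof (rule strict_monoI)
  fix i j :: int assume "i < j"
  have "x k \<le> x j" if "k \<le> j" using assms(1) that by (simp add: strict_mono_less_eq)
  moreover have "x i < x j" using assms(1) \<open>i < j\<close> by (simp add: strict_mono_less)
  ultimately show "(if i < k then c + real_of_int (i - (k - 1)) else x i) <
      (if j < k then c + real_of_int (j - (k - 1)) else x j)"
    using \<open>i < j\<close> assms(2) by (auto simp: of_int_diff)
qed

lemma strict_mono_extend_above:
  fixes x :: "int \<Rightarrow> real"
  assumes "strict_mono x" "x k < c"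
  shows "strict_mono (\<lambda>j. if j > k then c + real_of_int (j - (k + 1)) else x j)"
proof (rule strict_monoI)
  fix i j :: int assume "i < j"
  have "x i \<le> x k" if "i \<le> k" using assms(1) that by (simp add: strict_mono_less_eq)
  moreover have "x i < x j" using assms(1) \<open>i < j\<close> by (simp add: strict_mono_less)
  ultimately show "(if i > k then c + real_of_int (i - (k + 1)) else x i) <
      (if j > k then c + real_of_int (j - (k + 1)) else x j)"
    using \<open>i < j\<close> assms(2) by (auto simp: of_int_diff)
qed

text \<open>Reflection in the diagonal exchanges the two families of points and halves the cases
  below.\<close>

lemma is_stairs_swap:
  "is_stairs x y a1 a2 b1 b2 S \<Longrightarrow> is_stairs y x b1 b2 a1 a2 (prod.swap ` S)"
  by (auto simp: is_stairs_def stairs_def image_Un image_image)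

lemma staircase_swap: "staircase (prod.swap ` S) \<Longrightarrow> staircase S"
proof -
  assume "staircase (prod.swap ` S)"
  then have "staircase (prod.swap ` prod.swap ` S)" unfolding staircase_def using is_stairs_swap by blast
  then show ?thesis by (simp add: image_image)
qed

text \<open>The new point is the upper left point with index \<open>a1 - 1\<close>. The condition
  \<open>b1 \<le> a1\<close> keeps the two starting indices within distance one; since
  \<open>b1\<close> is at least \<open>a1 - 1\<close>, no present point uses a value of
  \<open>x\<close> below index \<open>a1\<close>, and these values may be changed.\<close>

lemma extend_low:
  assumes S: "is_stairs x y a1 a2 b1 b2 S" and "b1 \<le> a1" and c: "c < x a1"
  shows "staircase (insert (c, y a1) S)"
proof -
  define x' where "x' j = (if j < a1 then c + real_of_int (j - (a1 - 1)) else x j)" for j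
  have mono: "strict_mono x'" unfolding x'_def using S c by (intro strict_mono_extend_below) (auto simp: is_stairs_def)
  have "{a1 - 1..a2} = insert (a1 - 1) {a1..a2}" using S by (auto simp: is_stairs_def)
  then have "(\<lambda>i. (x' i, y (i + 1))) ` {a1 - 1..a2} = insert (c, y a1) ((\<lambda>i. (x i, y (i + 1))) ` {a1..a2})"
    by (simp add: x'_def cong: image_cong_simp)
  moreover have "(\<lambda>i. (x' (i + 1), y i)) ` {b1..b2} = (\<lambda>i. (x (i + 1), y i)) ` {b1..b2}"
    using S by (intro image_cong) (auto simp: x'_def is_stairs_def)
  ultimately have "insert (c, y a1) S = stairs x' y (a1 - 1) a2 b1 b2"
    using S by (simp add: stairs_def is_stairs_def)
  then have "is_stairs x' y (a1 - 1) a2 b1 b2 (insert (c, y a1) S)"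
    using S mono assms(2) by (auto simp: is_stairs_def)
  then show ?thesis unfolding staircase_def by blast
qed

text \<open>As at the lower end: the new point is the upper left point with index
  \<open>a2 + 1\<close>, and the values of \<open>y\<close> beyond \<open>a2 + 1\<close> are free
  because \<open>b2\<close> is at most \<open>a2 + 1\<close>.\<close>

lemma extend_high:
  assumes S: "is_stairs x y a1 a2 b1 b2 S" and "a2 \<le> b2" and c: "y (a2 + 1) < c"
  shows "staircase (insert (x (a2 + 1), c) S)"
proof -
  define y' where "y' j = (if j > a2 + 1 then c + real_of_int (j - (a2 + 1 + 1)) else y j)" for j
  have mono: "strict_mono y'" unfolding y'_def using S c by (intro strict_mono_extend_above) (auto simp: is_stairs_def)
  have "{a1..a2 + 1} = insert (a2 + 1) {a1..a2}" using S by (auto simp: is_stairs_def)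
  then have "(\<lambda>i. (x i, y' (i + 1))) ` {a1..a2 + 1} = insert (x (a2 + 1), c) ((\<lambda>i. (x i, y (i + 1))) ` {a1..a2})"
    by (simp add: y'_def cong: image_cong_simp)
  moreover have "(\<lambda>i. (x (i + 1), y' i)) ` {b1..b2} = (\<lambda>i. (x (i + 1), y i)) ` {b1..b2}"
    using S by (intro image_cong) (auto simp: y'_def is_stairs_def)
  ultimately have "insert (x (a2 + 1), c) S = stairs x y' a1 (a2 + 1) b1 b2"
    using S by (simp add: stairs_def is_stairs_def)
  then have "is_stairs x y' a1 (a2 + 1) b1 b2 (insert (x (a2 + 1), c) S)"
    using S mono assms(2) by (auto simp: is_stairs_def)
  then show ?thesis unfolding staircase_def by blast
qed

lemma stairs_mem:
  assumes "is_stairs x y a1 a2 b1 b2 S"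
  shows "a1 \<le> i \<Longrightarrow> i \<le> a2 \<Longrightarrow> (x i, y (i + 1)) \<in> S"
    and "b1 \<le> i \<Longrightarrow> i \<le> b2 \<Longrightarrow> (x (i + 1), y i) \<in> S"
  using assms by (auto simp: is_stairs_def stairs_def)

text \<open>Points of one family increase in both coordinates, and points of different families with
  different indices are at least weakly ordered in both. A negative gap is left only for the two
  points with a common index.\<close>

lemma stairs_strict_pair:
  assumes S: "is_stairs x y a1 a2 b1 b2 S" and pq: "p \<in> S" "q \<in> S" "gap p q < 0"
  obtains i where "i \<in> {a1..a2}" "i \<in> {b1..b2}" "{p, q} = {(x i, y (i + 1)), (x (i + 1), y i)}"
proof -
  have mono: "strict_mono x" "strict_mono y" using S by (auto simp: is_stairs_def)
  have AA: "\<not> gap (x i, y (i + 1)) (x j, y (j + 1)) < 0" "\<not> gap (x (i + 1), y i) (x (j + 1), y j) < 0" for i j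
    using mono by (cases i j rule: linorder_cases;
      auto simp: gap_def mult_less_0_iff strict_mono_less)+
  have AB: "i = j" if "gap (x i, y (i + 1)) (x (j + 1), y j) < 0" for i j
    using that mono by (cases i j rule: linorder_cases)
      (auto simp: gap_def mult_less_0_iff strict_mono_less)
  have sym: "gap a b = gap b a" for a b by (simp add: gap_def algebra_simps)
  have "(\<exists>i\<in>{a1..a2}. r = (x i, y (i + 1))) \<or> (\<exists>i\<in>{b1..b2}. r = (x (i + 1), y i))" if "r \<in> S" for r
    using that S by (auto simp: is_stairs_def stairs_def)
  from this[OF pq(1)] this[OF pq(2)]
  consider i j where "p = (x i, y (i + 1))" "q = (x (j + 1), y j)" "i \<in> {a1..a2}" "j \<in> {b1..b2}"
    | i j where "q = (x i, y (i + 1))" "p = (x (j + 1), y j)" "i \<in> {a1..a2}" "j \<in> {b1..b2}"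
    using pq(3) AA by (elim disjE bexE) auto
  then show ?thesis
  proof cases
    case 1
    with AB[of i j] pq(3) that[of i] show ?thesis by auto
  next
    case 2
    have "gap q p < 0" using pq(3) by (simp add: sym[of q p])
    with 2 AB[of i j] that[of i] show ?thesis by auto
  qed
qed

text \<open>Away from the end, the row \<open>y i\<close> already holds
  \<open>(x (i - 1), y i)\<close> and \<open>(x (i + 1), y i)\<close>, so a point to the left of
  \<open>x i\<close> must be the first of these. New points can appear only at the end.\<close>

lemma stairs_extend_row:
  assumes S: "is_stairs x y a1 a2 b1 b2 S" and W: "no_three_aligned W" "insert (c, y i) S \<subseteq> W"
    and i: "i \<in> {a1..a2}" "i \<in> {b1..b2}" and c: "c < x i"
  shows "staircase (insert (c, y i) S)"
proof (cases "i = a1")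
  case True
  then show ?thesis using extend_low[OF S] i c by auto
next
  case False
  have mono: "strict_mono x" using S by (auto simp: is_stairs_def)
  have "(x (i - 1), y (i - 1 + 1)) \<in> S"
    using False i by (intro stairs_mem[OF S]) auto
  moreover have "(x (i + 1), y i) \<in> S"
    using i by (intro stairs_mem[OF S]) auto
  moreover have "x (i - 1) < x i" "x i < x (i + 1)" using mono by (simp_all add: strict_mono_less)
  ultimately have "c = x (i - 1)"
    using W c no_three_alignedD(2)[of W "(c, y i)" "(x (i - 1), y i)" "(x (i + 1), y i)"] by force
  then have "insert (c, y i) S = S" using \<open>(x (i - 1), y (i - 1 + 1)) \<in> S\<close> by auto
  moreover have "staircase S" using S unfolding staircase_def by blast
  ultimately show ?thesis by simp
qed

text \<open>The counterpart at the upper end. The pair has index \<open>i - 1\<close>, so the added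
  point lies straight above its lower right point and beyond the box.\<close>

lemma stairs_extend_column:
  assumes S: "is_stairs x y a1 a2 b1 b2 S" and W: "no_three_aligned W" "insert (x i, c) S \<subseteq> W"
    and i: "i - 1 \<in> {a1..a2}" "i - 1 \<in> {b1..b2}" and c: "y i < c"
  shows "staircase (insert (x i, c) S)"
proof (cases "i - 1 = a2")
  case True
  then show ?thesis using extend_high[OF S] i c by auto
next
  case False
  have mono: "strict_mono y" using S by (auto simp: is_stairs_def)
  have "(x i, y (i + 1)) \<in> S"
    using False i by (intro stairs_mem[OF S]) auto
  moreover have "(x i, y (i - 1)) \<in> S"
    using i stairs_mem(2)[OF S, of "i - 1"] by auto
  moreover have "y (i - 1) < y i" "y i < y (i + 1)" using mono by (simp_all add: strict_mono_less)
  ultimately have "c = y (i + 1)"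
    using W c no_three_alignedD(1)[of W "(x i, c)" "(x i, y (i - 1))" "(x i, y (i + 1))"] by force
  then have "insert (x i, c) S = S" using \<open>(x i, y (i + 1)) \<in> S\<close> by auto
  moreover have "staircase S" using S unfolding staircase_def by blast
  ultimately show ?thesis by simp
qed

lemma no_three_aligned_swap: "no_three_aligned W \<Longrightarrow> no_three_aligned (prod.swap ` W)"
  unfolding no_three_aligned_def by fastforce

lemma staircase_insert:
  assumes S: "staircase S" and W: "no_three_aligned W" "insert c S \<subseteq> W"
    and pq: "p \<in> S" "q \<in> S" "gap p q < 0" and c: "extends_pair p q c"
  shows "staircase (insert c S)"
proof -
  obtain x y a1 a2 b1 b2 where st: "is_stairs x y a1 a2 b1 b2 S" using S unfolding staircase_def by blast
  note st' = is_stairs_swap[OF st] and W' = no_three_aligned_swap[OF W(1)]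
  obtain i where i: "i \<in> {a1..a2}" "i \<in> {b1..b2}" and e: "{p, q} = {(x i, y (i + 1)), (x (i + 1), y i)}"
    using stairs_strict_pair[OF st pq] .
  have "extends_pair (x i, y (i + 1)) (x (i + 1), y i) c"
    using c e unfolding doubleton_eq_iff extends_pair_def by auto
  moreover have xy: "x i < x (i + 1)" "y i < y (i + 1)" using st by (auto simp: is_stairs_def strict_mono_less)
  \<comment> \<open>Zero gap puts \<open>c\<close> on the row or column of one point of the pair;
    positive gap with the other pushes it outside the box. Two of the four positions follow by
    reflection.\<close>
  ultimately consider
    "snd c = y i" "fst c < x i" | "fst c = x i" "snd c < y i" |
    "snd c = y (i + 1)" "fst c > x (i + 1)" | "fst c = x (i + 1)" "snd c > y (i + 1)"
    by (cases c) (auto simp: extends_pair_def gap_def zero_less_mult_iff)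
  then show ?thesis
  proof cases
    case 1
    then show ?thesis using stairs_extend_row[OF st W(1) _ i, of "fst c"] W(2) by (cases c) auto
  next
    case 2
    have "staircase (insert (snd c, fst c) (prod.swap ` S))"
      using stairs_extend_row[OF st' W' _ i(2,1), of "snd c"] W(2) 2 by (cases c) auto
    then show ?thesis using staircase_swap[of "insert c S"] by (cases c) auto
  next
    case 3
    have "staircase (insert (snd c, fst c) (prod.swap ` S))"
      using stairs_extend_column[OF st' W', of "i + 1" "fst c"] i W(2) 3 by (cases c) auto
    then show ?thesis using staircase_swap[of "insert c S"] by (cases c) auto
  next
    case 4
    then show ?thesis using stairs_extend_column[OF st W(1), of "i + 1" "snd c"] i W(2) by (cases c) auto
  qed
qed

text \<open>\<open>W\<close> stands for the whole configuration, so the alignment hypothesis is the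
  same at every insertion.\<close>

lemma staircase_union:
  assumes S: "staircase S" and W: "no_three_aligned W" "S \<union> T \<subseteq> W"
    and pq: "p \<in> S" "q \<in> S" "gap p q < 0" and T: "finite T" "\<And>c. c \<in> T - {p, q} \<Longrightarrow> extends_pair p q c"
  shows "staircase (S \<union> T)"
  using T(1) T(2) W(2)
proof (induction T rule: finite_induct)
  case empty
  then show ?case using S by simp
next
  case (insert c T)
  then have "staircase (S \<union> T)" by auto
  moreover have "insert c (S \<union> T) \<subseteq> W" using insert.prems(2) by auto
  ultimately have "staircase (insert c (S \<union> T))"
    using staircase_insert[OF _ W(1), of "S \<union> T" c p q] pq insert.prems(1)[of c]
    by (cases "c \<in> {p, q}") (auto simp: insert_absorb)
  then show ?case by simp
qed

lemma staircase_pair: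
  assumes "gap p q < 0"
  shows "staircase {p, q}"
proof -
  have *: "staircase {p, q}" if pq: "fst p < fst q" "snd q < snd p" for p q
  proof -
    \<comment> \<open>Affine sequences through the two given coordinates at the indices 0 and
      1.\<close>
    define x where "x i = fst p + real_of_int i * (fst q - fst p)" for i :: int
    define y where "y i = snd q + real_of_int i * (snd p - snd q)" for i :: int
    have "is_stairs x y 0 0 0 0 {p, q}"
      using pq by (cases p; cases q) (auto simp: is_stairs_def stairs_def x_def y_def strict_mono_def)
    then show ?thesis unfolding staircase_def by blast
  qed
  have "fst p < fst q \<and> snd q < snd p \<or> fst q < fst p \<and> snd p < snd q"
    using assms by (auto simp: gap_def mult_less_0_iff)
  then show ?thesis using *[of p q] *[of q p] by (auto simp: insert_commute)
qed

section \<open>Plane sets closed under convex combinations of compatible points\<close>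

definition gap_convex :: "(real \<times> real) set \<Rightarrow> bool" where
  "gap_convex L \<longleftrightarrow> (\<forall>a\<in>L. \<forall>b\<in>L. \<forall>l. gap a b \<le> 0 \<longrightarrow> 0 \<le> l \<longrightarrow> l \<le> 1 \<longrightarrow>
     (l * fst a + (1 - l) * fst b, l * snd a + (1 - l) * snd b) \<in> L)"

lemma gap_convexD:
  assumes "gap_convex L" "(p, q) \<in> L" "(p', q') \<in> L" "(p - p') * (q - q') \<le> 0" "0 \<le> l" "l \<le> 1"
    "s = l * p + (1 - l) * p'" "t = l * q + (1 - l) * q'"
  shows "(s, t) \<in> L"
proof -
  have "gap (p, q) (p', q') \<le> 0" using assms(4) by (simp add: gap_def)
  then have "(l * fst (p, q) + (1 - l) * fst (p', q'), l * snd (p, q) + (1 - l) * snd (p', q')) \<in> L"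
    using assms(1-3,5,6) unfolding gap_convex_def by blast
  then show ?thesis by (simp add: assms(7,8))
qed

text \<open>The condition on \<open>s\<close> is the equation of the line through
  \<open>(p, t')\<close> and \<open>(q, t)\<close> with denominators cleared.\<close>

lemma gap_convex_antidiagonal:
  assumes L: "gap_convex L" and A: "(p, t') \<in> L" and B: "(q, t) \<in> L" and le: "p < q" "t < t'"
    and r: "t \<le> r" "r \<le> t'" and s: "(s - p) * (t' - t) + (r - t) * (q - p) = (q - p) * (t' - t)"
  shows "(s, r) \<in> L"
proof (rule gap_convexD[OF L A B, of "(r - t) / (t' - t)"])
  show "(p - q) * (t' - t) \<le> 0" using le by (simp add: mult_le_0_iff)
  show "0 \<le> (r - t) / (t' - t)" "(r - t) / (t' - t) \<le> 1" using le r by (auto simp: field_simps)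
  define m where "m = (r - t) / (t' - t)"
  have m: "m * (t' - t) = r - t" using le by (simp add: m_def)
  then show "r = m * t' + (1 - m) * t" by (simp add: algebra_simps)
  have "(s - (m * p + (1 - m) * q)) * (t' - t) = (s - p) * (t' - t) + m * (t' - t) * (q - p) - (q - p) * (t' - t)"
    by (simp add: algebra_simps)
  also have "\<dots> = 0" unfolding m using s by simp
  finally show "s = m * p + (1 - m) * q" using le by simp
qed

lemma gap_convex_row:
  assumes L: "gap_convex L" and "(p, t) \<in> L" "(q, t) \<in> L" "p \<le> s" "s \<le> q"
  shows "(s, t) \<in> L"
proof (cases "p = q")
  case False
  then have "p < q" using assms by simp
  define m where "m = (q - s) / (q - p)"
  have "m * (q - p) = q - s" using \<open>p < q\<close> by (simp add: m_def)
  then have "s = m * p + (1 - m) * q" "t = m * t + (1 - m) * t" by (simp_all add: algebra_simps)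
  moreover have "0 \<le> m" "m \<le> 1" using \<open>p < q\<close> assms by (auto simp: m_def field_simps)
  ultimately show ?thesis by (intro gap_convexD[OF L assms(2,3), of m]) auto
qed (use assms in auto)

lemma gap_convex_column:
  assumes L: "gap_convex L" and "(s, p) \<in> L" "(s, q) \<in> L" "p \<le> t" "t \<le> q"
  shows "(s, t) \<in> L"
proof (cases "p = q")
  case False
  then have "p < q" using assms by simp
  define m where "m = (q - t) / (q - p)"
  have "m * (q - p) = q - t" using \<open>p < q\<close> by (simp add: m_def)
  then have "t = m * p + (1 - m) * q" "s = m * s + (1 - m) * s" by (simp_all add: algebra_simps)
  moreover have "0 \<le> m" "m \<le> 1" using \<open>p < q\<close> assms by (auto simp: m_def field_simps)
  ultimately show ?thesis by (intro gap_convexD[OF L assms(2,3), of m]) auto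
qed (use assms in auto)

text \<open>On the row at height \<open>r\<close>, the point lies between \<open>(p, r)\<close> on
  the left edge and \<open>(e, r)\<close> on the antidiagonal. Both of these are reached, and
  horizontal segments have gap zero.\<close>

lemma gap_convex_lower_triangle:
  assumes L: "gap_convex L" and A: "(p, t') \<in> L" and B: "(q, t) \<in> L" and P: "(p, t) \<in> L"
    and le: "p < q" "t < t'" and sr: "p \<le> s" "t \<le> r" "r \<le> t'"
    and s: "(s - p) * (t' - t) + (r - t) * (q - p) \<le> (q - p) * (t' - t)"
  shows "(s, r) \<in> L"
proof -
  define m e where "m = (r - t) / (t' - t)" and "e = q - m * (q - p)"
  have m: "m * (t' - t) = r - t" using le by (simp add: m_def)
  have e: "(e - p) * (t' - t) = (q - p) * (t' - t) - (r - t) * (q - p)"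
    unfolding m[symmetric] e_def by (simp only: algebra_simps)
  have "(e, r) \<in> L" by (rule gap_convex_antidiagonal[OF L A B le sr(2,3)]) (use e in linarith)
  moreover have "(p, r) \<in> L" by (rule gap_convex_column[OF L P A sr(2,3)])
  moreover have "s - p \<le> e - p"
    by (rule mult_right_le_imp_le[of _ "t' - t"]) (use s e le in linarith)+
  ultimately show ?thesis using sr(1) by - (rule gap_convex_row[OF L, of p r e], simp_all)
qed

lemma gap_convex_upper_triangle:
  assumes L: "gap_convex L" and A: "(p, t') \<in> L" and B: "(q, t) \<in> L" and P: "(q, t') \<in> L"
    and le: "p < q" "t < t'" and sr: "s \<le> q" "t \<le> r" "r \<le> t'"
    and s: "(s - p) * (t' - t) + (r - t) * (q - p) \<ge> (q - p) * (t' - t)"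
  shows "(s, r) \<in> L"
proof -
  define m e where "m = (r - t) / (t' - t)" and "e = q - m * (q - p)"
  have m: "m * (t' - t) = r - t" using le by (simp add: m_def)
  have e: "(e - p) * (t' - t) = (q - p) * (t' - t) - (r - t) * (q - p)"
    unfolding m[symmetric] e_def by (simp only: algebra_simps)
  have "(e, r) \<in> L" by (rule gap_convex_antidiagonal[OF L A B le sr(2,3)]) (use e in linarith)
  moreover have "(q, r) \<in> L" by (rule gap_convex_column[OF L B P sr(2,3)])
  moreover have "e - p \<le> s - p"
    by (rule mult_right_le_imp_le[of _ "t' - t"]) (use s e le in linarith)+
  ultimately show ?thesis using sr(1) by - (rule gap_convex_row[OF L, of e r q], simp_all)
qed

text \<open>\<open>quad\<close> and \<open>lin\<close> say that \<open>(s, t)\<close> is not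
  separated from \<open>S\<close> by the two kinds of quasiconvex functions in use; \<open>L\<close>
  will be the image of the lamination hull.\<close>

lemma staircase_separation:
  assumes S: "staircase S" "S \<subseteq> L" and L: "gap_convex L"
    and quad: "\<And>P. (\<And>u. u \<in> S \<Longrightarrow> gap u P \<ge> 0) \<Longrightarrow> gap (s, t) P \<ge> 0"
    and lin: "\<And>\<alpha> \<beta> \<gamma>. (\<And>u. u \<in> S \<Longrightarrow> \<alpha> * fst u + \<beta> * snd u \<ge> \<gamma>) \<Longrightarrow> \<alpha> * s + \<beta> * t \<ge> \<gamma>"
  shows "(s, t) \<in> L"
proof -
  obtain x y a1 a2 b1 b2 where st: "is_stairs x y a1 a2 b1 b2 S" using S(1) unfolding staircase_def by blast
  have mono: "strict_mono x" "strict_mono y" and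
    ab: "\<bar>a1 - b1\<bar> \<le> 1" "\<bar>a2 - b2\<bar> \<le> 1" "a1 \<le> a2" "a1 \<le> b2" "b1 \<le> a2" "b1 \<le> b2"
    using st by (auto simp: is_stairs_def)
  have S_cases: "P u" if "u \<in> S" "\<And>i. a1 \<le> i \<Longrightarrow> i \<le> a2 \<Longrightarrow> P (x i, y (i + 1))"
      "\<And>i. b1 \<le> i \<Longrightarrow> i \<le> b2 \<Longrightarrow> P (x (i + 1), y i)" for u P
    using that st by (auto simp: is_stairs_def stairs_def)
  have xle: "x i \<le> x j" "y i \<le> y j" if "i \<le> j" for i j
    using mono that by (simp_all add: strict_mono_less_eq)
  have xless: "x i < x (i + 1)" "y i < y (i + 1)" "x (i - 1) < x i" "y (i - 1) < y i" for i
    using mono by (simp_all add: strict_mono_less)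
  have A: "(x i, y (i + 1)) \<in> L" if "a1 \<le> i" "i \<le> a2" for i using stairs_mem(1)[OF st that] S(2) by blast
  have B: "(x (i + 1), y i) \<in> L" if "b1 \<le> i" "i \<le> b2" for i using stairs_mem(2)[OF st that] S(2) by blast
  have A': "(x (i - 1), y i) \<in> L" if "a1 \<le> i - 1" "i - 1 \<le> a2" for i using A[OF that] by simp
  have B': "(x i, y (i - 1)) \<in> L" if "b1 \<le> i - 1" "i - 1 \<le> b2" for i using B[OF that] by simp
  \<comment> \<open>All points of the staircase lie in the closed lower left or upper right quadrant
    at \<open>(x i, y i)\<close>, so \<open>quad\<close> places \<open>(s, t)\<close> there as
    well.\<close>
  have corner: "(x i \<le> s \<and> y i \<le> t) \<or> (s \<le> x i \<and> t \<le> y i)" for i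
  proof -
    have "gap u (x i, y i) \<ge> 0" if "u \<in> S" for u
      using that
    proof (rule S_cases)
      fix j show "gap (x j, y (j + 1)) (x i, y i) \<ge> 0"
        using xle[of j i] xle[of "j + 1" i] xle[of i j] xle[of i "j + 1"]
        by (cases "i \<le> j") (auto simp: gap_def zero_le_mult_iff)
      show "gap (x (j + 1), y j) (x i, y i) \<ge> 0"
        using xle[of j i] xle[of "j + 1" i] xle[of i j] xle[of i "j + 1"]
        by (cases "i \<le> j") (auto simp: gap_def zero_le_mult_iff)
    qed
    from quad[OF this] show ?thesis by (auto simp: gap_def zero_le_mult_iff)
  qed
  \<comment> \<open>The corner sits on the horizontal segment from \<open>(x (i - 1), y i)\<close>
    to \<open>(x (i + 1), y i)\<close>, or in the next fact on the analogous vertical one.\<close>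
  have corner_mem1: "(x i, y i) \<in> L" if "a1 \<le> i - 1" "i - 1 \<le> a2" "b1 \<le> i" "i \<le> b2" for i
    by (rule gap_convex_row[OF L A' B]) (use that xless[of i] in auto)
  have corner_mem2: "(x i, y i) \<in> L" if "b1 \<le> i - 1" "i - 1 \<le> b2" "a1 \<le> i" "i \<le> a2" for i
    by (rule gap_convex_column[OF L B' A]) (use that xless[of i] in auto)
  \<comment> \<open>The indices from \<open>c\<close> to \<open>d\<close> are those with both points
    present, that is, the full boxes.\<close>
  define c d where "c = max a1 b1" and "d = min a2 b2"
  have cd: "c \<le> d" "a1 \<le> c" "b1 \<le> c" "d \<le> a2" "d \<le> b2" using ab by (auto simp: c_def d_def)
  have lower_corner: "(x i, y i) \<in> L" if "c \<le> i" "i \<le> d" "\<not> (i = c \<and> a1 = b1)" for i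
  proof -
    have "(a1 \<le> i - 1 \<and> i - 1 \<le> a2 \<and> b1 \<le> i \<and> i \<le> b2) \<or> (b1 \<le> i - 1 \<and> i - 1 \<le> b2 \<and> a1 \<le> i \<and> i \<le> a2)"
      using that ab cd unfolding c_def by linarith
    then show ?thesis using corner_mem1 corner_mem2 by blast
  qed
  have upper_corner: "(x (i + 1), y (i + 1)) \<in> L" if "c \<le> i" "i \<le> d" "\<not> (i = d \<and> a2 = b2)" for i
  proof -
    have "(a1 \<le> i \<and> i \<le> a2 \<and> b1 \<le> i + 1 \<and> i + 1 \<le> b2) \<or> (b1 \<le> i \<and> i \<le> b2 \<and> a1 \<le> i + 1 \<and> i + 1 \<le> a2)"
      using that ab cd unfolding d_def by linarith
    then show ?thesis using corner_mem1[of "i + 1"] corner_mem2[of "i + 1"] by auto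
  qed
  \<comment> \<open>If both families start together, the line through the first two points supports
    the whole staircase from below: it carries the antidiagonal of the first box.\<close>
  have lin_lower: "(s - x c) * (y (c + 1) - y c) + (t - y c) * (x (c + 1) - x c) \<ge> (x (c + 1) - x c) * (y (c + 1) - y c)"
    if "a1 = b1"
  proof -
    let ?\<alpha> = "y (c + 1) - y c" and ?\<beta> = "x (c + 1) - x c"
    let ?\<gamma> = "?\<alpha> * x c + ?\<beta> * y (c + 1)"
    have "?\<alpha> * fst u + ?\<beta> * snd u \<ge> ?\<gamma>" if "u \<in> S" for u
      using that
    proof (rule S_cases)
      fix i assume "a1 \<le> i"
      then have "c \<le> i" using \<open>a1 = b1\<close> by (simp add: c_def)
      then show "?\<gamma> \<le> ?\<alpha> * fst (x i, y (i + 1)) + ?\<beta> * snd (x i, y (i + 1))"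
        using xless[of c] xle[of c i] xle[of "c + 1" "i + 1"] by (simp add: add_mono mult_left_mono)
    next
      fix i assume "b1 \<le> i"
      then have "c \<le> i" using \<open>a1 = b1\<close> by (simp add: c_def)
      then have "?\<alpha> * x (c + 1) + ?\<beta> * y c \<le> ?\<alpha> * x (i + 1) + ?\<beta> * y i"
        using xless[of c] xle[of c i] xle[of "c + 1" "i + 1"] by (simp add: add_mono mult_left_mono)
      moreover have "?\<alpha> * x (c + 1) + ?\<beta> * y c = ?\<gamma>" by (simp add: algebra_simps)
      ultimately show "?\<gamma> \<le> ?\<alpha> * fst (x (i + 1), y i) + ?\<beta> * snd (x (i + 1), y i)" by simp
    qed
    from lin[OF this] show ?thesis by (simp add: algebra_simps)
  qed
  have lin_upper: "(s - x d) * (y (d + 1) - y d) + (t - y d) * (x (d + 1) - x d) \<le> (x (d + 1) - x d) * (y (d + 1) - y d)"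
    if "a2 = b2"
  proof -
    let ?\<alpha> = "y (d + 1) - y d" and ?\<beta> = "x (d + 1) - x d"
    let ?\<gamma> = "?\<alpha> * x d + ?\<beta> * y (d + 1)"
    have "(- ?\<alpha>) * fst u + (- ?\<beta>) * snd u \<ge> - ?\<gamma>" if "u \<in> S" for u
      using that
    proof (rule S_cases)
      fix i assume "i \<le> a2"
      then have "i \<le> d" using \<open>a2 = b2\<close> by (simp add: d_def)
      then have "?\<alpha> * x i + ?\<beta> * y (i + 1) \<le> ?\<gamma>"
        using xless[of d] xle[of i d] xle[of "i + 1" "d + 1"] by (simp add: add_mono mult_left_mono)
      then show "- ?\<gamma> \<le> (- ?\<alpha>) * fst (x i, y (i + 1)) + (- ?\<beta>) * snd (x i, y (i + 1))"
        by (simp only: fst_conv snd_conv mult_minus_left; linarith)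
    next
      fix i assume "i \<le> b2"
      then have "i \<le> d" using \<open>a2 = b2\<close> by (simp add: d_def)
      then have "?\<alpha> * x (i + 1) + ?\<beta> * y i \<le> ?\<alpha> * x (d + 1) + ?\<beta> * y d"
        using xless[of d] xle[of i d] xle[of "i + 1" "d + 1"] by (simp add: add_mono mult_left_mono)
      moreover have "?\<alpha> * x (d + 1) + ?\<beta> * y d = ?\<gamma>" by (simp add: algebra_simps)
      ultimately show "- ?\<gamma> \<le> (- ?\<alpha>) * fst (x (i + 1), y i) + (- ?\<beta>) * snd (x (i + 1), y i)"
        by (simp only: fst_conv snd_conv mult_minus_left; linarith)
    qed
    from lin[OF this] show ?thesis by (simp add: algebra_simps)
  qed
  \<comment> \<open>Below the first corner: with a common start this contradicts
    \<open>lin_lower\<close>. Otherwise the single extra point bounds both coordinates, and the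
    region shrinks to the segment joining it to that corner.\<close>
  have low: ?thesis if le: "s \<le> x c" "t \<le> y c"
  proof -
    have "a1 = b1 \<or> (a1 = c - 1 \<and> b1 = c) \<or> (b1 = c - 1 \<and> a1 = c)"
      using ab(1) unfolding c_def by linarith
    then consider "a1 = b1" | "a1 = c - 1" "b1 = c" | "b1 = c - 1" "a1 = c" by blast
    then show ?thesis
    proof cases
      case 1
      have "(s - x c) * (y (c + 1) - y c) \<le> 0" "(t - y c) * (x (c + 1) - x c) \<le> 0"
        "0 < (x (c + 1) - x c) * (y (c + 1) - y c)"
        using le xless[of c] by (simp_all add: mult_le_0_iff)
      with lin_lower[OF 1] show ?thesis by linarith
    next
      case 2
      have "0 * s + 1 * t \<ge> y c" by (rule lin, rule S_cases, assumption) (use 2 in \<open>auto intro!: xle\<close>)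
      moreover have "1 * s + 0 * t \<ge> x (c - 1)" by (rule lin, rule S_cases, assumption) (use 2 in \<open>auto intro!: xle\<close>)
      moreover have "(s, y c) \<in> L" if "x (c - 1) \<le> s"
        by (rule gap_convex_row[OF L A' B]) (use that 2 cd le xless[of c] in linarith)+
      ultimately show ?thesis using le by simp
    next
      case 3
      have "1 * s + 0 * t \<ge> x c" by (rule lin, rule S_cases, assumption) (use 3 in \<open>auto intro!: xle\<close>)
      moreover have "0 * s + 1 * t \<ge> y (c - 1)" by (rule lin, rule S_cases, assumption) (use 3 in \<open>auto intro!: xle\<close>)
      moreover have "(x c, t) \<in> L" if "y (c - 1) \<le> t"
        by (rule gap_convex_column[OF L B' A]) (use that 3 cd le xless[of c] in linarith)+
      ultimately show ?thesis using le by simp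
    qed
  qed
  have high: ?thesis if le: "x (d + 1) \<le> s" "y (d + 1) \<le> t"
  proof -
    have "a2 = b2 \<or> (a2 = d + 1 \<and> b2 = d) \<or> (b2 = d + 1 \<and> a2 = d)"
      using ab(2) unfolding d_def by linarith
    then consider "a2 = b2" | "a2 = d + 1" "b2 = d" | "b2 = d + 1" "a2 = d" by blast
    then show ?thesis
    proof cases
      case 1
      have "(x (d + 1) - x d) * (y (d + 1) - y d) \<le> (s - x d) * (y (d + 1) - y d)"
        "0 < (t - y d) * (x (d + 1) - x d)"
        using le xless[of d] by (simp_all add: mult_right_mono)
      with lin_upper[OF 1] show ?thesis by linarith
    next
      case 2
      have "(-1) * s + 0 * t \<ge> - x (d + 1)" by (rule lin, rule S_cases, assumption) (use 2 in \<open>auto intro!: xle\<close>)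
      moreover have "0 * s + (-1) * t \<ge> - y (d + 1 + 1)" by (rule lin, rule S_cases, assumption) (use 2 in \<open>auto intro!: xle\<close>)
      moreover have "(x (d + 1), t) \<in> L" if "t \<le> y (d + 1 + 1)"
        by (rule gap_convex_column[OF L B[of d] A[of "d + 1"]])
          (use that 2 cd le xless[of d] in linarith)+
      ultimately show ?thesis using le by simp
    next
      case 3
      have "0 * s + (-1) * t \<ge> - y (d + 1)" by (rule lin, rule S_cases, assumption) (use 3 in \<open>auto intro!: xle\<close>)
      moreover have "(-1) * s + 0 * t \<ge> - x (d + 1 + 1)" by (rule lin, rule S_cases, assumption) (use 3 in \<open>auto intro!: xle\<close>)
      moreover have "(s, y (d + 1)) \<in> L" if "s \<le> x (d + 1 + 1)"
        by (rule gap_convex_row[OF L A[of d] B[of "d + 1"]])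
          (use that 3 cd le xless[of d] in linarith)+
      ultimately show ?thesis using le by simp
    qed
  qed
  show ?thesis
  proof (cases "x c \<le> s \<and> y c \<le> t")
    case False
    then show ?thesis using corner[of c] low by auto
  next
    case True
    \<comment> \<open>The last corner below \<open>(s, t)\<close> selects the box: by
      \<open>corner\<close>, the next corner is above the point unless the last full box has been
      passed.\<close>
    define I where "I = {i \<in> {c..d}. x i \<le> s \<and> y i \<le> t}"
    define i where "i = Max I"
    have I: "finite I" "c \<in> I"
    proof -
      show "finite I" by (rule finite_subset[of _ "{c..d}"]) (auto simp: I_def)
      show "c \<in> I" using True cd by (simp add: I_def)
    qed
    have "i \<in> I" unfolding i_def using I by (intro Max_in) auto
    then have i: "c \<le> i" "i \<le> d" "x i \<le> s" "y i \<le> t" by (auto simp: I_def)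
    have nxt: "i + 1 \<notin> I" using Max_ge[OF I(1), of "i + 1"] by (auto simp: i_def)
    show ?thesis
    proof (cases "s \<le> x (i + 1) \<and> t \<le> y (i + 1)")
      case False
      then have "x (i + 1) \<le> s" "y (i + 1) \<le> t" using corner[of "i + 1"] by auto
      with nxt i have "i = d" by (auto simp: I_def)
      then show ?thesis using high \<open>x (i + 1) \<le> s\<close> \<open>y (i + 1) \<le> t\<close> by auto
    next
      case box: True
      have Ai: "(x i, y (i + 1)) \<in> L" and Bi: "(x (i + 1), y i) \<in> L"
        using i cd by (intro A B; linarith)+
      note diag = gap_convex_antidiagonal[OF L Ai Bi xless(1,2)]
        and lower = gap_convex_lower_triangle[OF L Ai Bi _ xless(1,2)]
        and upper = gap_convex_upper_triangle[OF L Ai Bi _ xless(1,2)]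
      show ?thesis
      proof (cases "(s - x i) * (y (i + 1) - y i) + (t - y i) * (x (i + 1) - x i) \<le> (x (i + 1) - x i) * (y (i + 1) - y i)")
        case True
        show ?thesis
        proof (cases "i = c \<and> a1 = b1")
          case ends: True
          then have "(s - x i) * (y (i + 1) - y i) + (t - y i) * (x (i + 1) - x i) \<ge> (x (i + 1) - x i) * (y (i + 1) - y i)"
            using lin_lower by simp
          then show ?thesis using True i(4) box by - (rule diag, simp_all)
        next
          case False
          then have "(x i, y i) \<in> L" using lower_corner i by blast
          then show ?thesis using True i(3,4) box by - (rule lower, simp_all)
        qed
      next
        case False
        show ?thesis
        proof (cases "i = d \<and> a2 = b2")
          case True
          then show ?thesis using lin_upper False by simp
        next
          case notend: False
          then have "(x (i + 1), y (i + 1)) \<in> L" using upper_corner i by blast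
          then show ?thesis using False i(4) box by - (rule upper, simp_all)
        qed
      qed
    qed
  qed
qed

section \<open>Hulls in null coordinates\<close>

text \<open>The last clause quantifies over all strictly compatible pairs because the chain may
  enter a block through any of them; the pair with positive gap serves to find the sign of the
  determinant of the normal.\<close>

definition block_points :: "(real \<times> real) set \<Rightarrow> bool" where
  "block_points P \<longleftrightarrow> finite P \<and> (\<exists>p\<in>P. \<exists>q\<in>P. gap p q < 0) \<and> (\<exists>p\<in>P. \<exists>q\<in>P. gap p q > 0) \<and>
     (\<forall>p\<in>P. \<forall>q\<in>P. gap p q < 0 \<longrightarrow> (\<forall>c\<in>P - {p, q}. extends_pair p q c))"

lemma gap_commute: "gap a b = gap b a"
  by (simp add: gap_def algebra_simps)

lemma gap_self [simp]: "gap a a = 0"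
  by (simp add: gap_def)

lemma block_points_three:
  assumes "gap a b < 0" "gap b c = 0" "gap a c > 0"
  shows "block_points {a, b, c}"
proof -
  note g = assms gap_commute[of b a] gap_commute[of c b] gap_commute[of c a]
  have "extends_pair p q d" if "p \<in> {a, b, c}" "q \<in> {a, b, c}" "gap p q < 0" "d \<in> {a, b, c} - {p, q}" for p q d
    using that g by (elim insertE emptyE DiffE; simp add: extends_pair_def)
  then show ?thesis using assms unfolding block_points_def by blast
qed

lemma block_points_crossing:
  assumes "gap a b = 0" "gap c d = 0" "gap a c < 0" "gap b d < 0" "gap a d > 0" "gap b c > 0"
  shows "block_points {a, b, c, d}"
proof -
  note g = assms gap_commute[of b a] gap_commute[of d c] gap_commute[of c a] gap_commute[of d b]
    gap_commute[of d a] gap_commute[of c b]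
  have "extends_pair p q e"
    if "p \<in> {a, b, c, d}" "q \<in> {a, b, c, d}" "gap p q < 0" "e \<in> {a, b, c, d} - {p, q}" for p q e
    using that g by (elim insertE emptyE DiffE; simp add: extends_pair_def)
  then show ?thesis using assms unfolding block_points_def by blast
qed

text \<open>A horizontal and a vertical segment cross at \<open>(x0, y0)\<close>. Each end of one
  sees the two ends of the other with opposite signs of the gap, so up to exchanging the vertical
  ends this is the previous pattern.\<close>

lemma block_points_cross:
  assumes x: "(p - x0) * (q - x0) < 0" and y: "(r - y0) * (s - y0) < 0"
  shows "block_points {(p, y0), (q, y0), (x0, r), (x0, s)}"
proof -
  have z: "gap (p, y0) (q, y0) = 0" "gap (x0, r) (x0, s) = 0" "gap (x0, s) (x0, r) = 0"
    by (simp_all add: gap_def)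
  have x': "p < x0 \<and> x0 < q \<or> q < x0 \<and> x0 < p" using x by (auto simp: mult_less_0_iff)
  have y': "r < y0 \<and> y0 < s \<or> s < y0 \<and> y0 < r" using y by (auto simp: mult_less_0_iff)
  from x' y' consider "(p - x0) * (y0 - r) < 0" "(q - x0) * (y0 - s) < 0" "(p - x0) * (y0 - s) > 0" "(q - x0) * (y0 - r) > 0"
    | "(p - x0) * (y0 - s) < 0" "(q - x0) * (y0 - r) < 0" "(p - x0) * (y0 - r) > 0" "(q - x0) * (y0 - s) > 0"
    by (elim disjE) (simp_all add: mult_less_0_iff zero_less_mult_iff)
  then show ?thesis
  proof cases
    case 1
    then show ?thesis using z by (intro block_points_crossing) (simp_all add: gap_def)
  next
    case 2
    then have "block_points {(p, y0), (q, y0), (x0, s), (x0, r)}"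
      using z by (intro block_points_crossing) (simp_all add: gap_def)
    then show ?thesis by (simp add: insert_commute)
  qed
qed

text \<open>Rank-one pairs are horizontal or vertical. Two of the same direction that meet would put
  all four points on one line, so one is horizontal and one vertical, and they cross in their
  interiors.\<close>

lemma block_points_four:
  assumes V: "gap v1 v2 = 0" and W: "gap w1 w2 = 0"
    and al: "no_three_aligned {v1, v2, w1, w2}" and d: "distinct [v1, v2, w1, w2]"
    and a: "0 < a" "a < 1" and b: "0 < b" "b < 1"
    and fst: "(1 - a) * fst v1 + a * fst v2 = (1 - b) * fst w1 + b * fst w2"
    and snd: "(1 - a) * snd v1 + a * snd v2 = (1 - b) * snd w1 + b * snd w2"
  shows "block_points {v1, v2, w1, w2}"
proof -
  have al': "\<not> (fst v1 = fst v2 \<and> fst v2 = fst w1)" "\<not> (snd v1 = snd v2 \<and> snd v2 = snd w1)"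
    using no_three_alignedD[OF al, of v1 v2 w1] d by auto
  have between: "(p - ((1 - c) * p + c * q)) * (q - ((1 - c) * p + c * q)) < 0"
    if "0 < c" "c < 1" "p \<noteq> q" for c p q :: real
  proof -
    have "(p - ((1 - c) * p + c * q)) * (q - ((1 - c) * p + c * q)) = - (c * (1 - c) * (p - q)\<^sup>2)"
      by (simp add: power2_eq_square algebra_simps)
    moreover have "c * (1 - c) * (p - q)\<^sup>2 > 0" using that by simp
    ultimately show ?thesis by linarith
  qed
  have const: "(1 - c) * p + c * p = p" for c p :: real by (simp add: algebra_simps)
  consider "snd v1 = snd v2" "snd w1 = snd w2" | "fst v1 = fst v2" "fst w1 = fst w2"
    | "snd v1 = snd v2" "fst w1 = fst w2" | "fst v1 = fst v2" "snd w1 = snd w2"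
    using V W by (auto simp: gap_def)
  then show ?thesis
  proof cases
    case 1
    then show ?thesis using snd al' by (simp add: const)
  next
    case 2
    then show ?thesis using fst al' by (simp add: const)
  next
    case 3
    then have y0: "snd v2 = (1 - b) * snd w1 + b * snd w2" and x0: "fst w2 = (1 - a) * fst v1 + a * fst v2"
      using fst snd by (simp_all add: const)
    have "fst v1 \<noteq> fst v2" "snd w1 \<noteq> snd w2" using 3 d by (auto simp: prod_eq_iff)
    then have "(fst v1 - fst w2) * (fst v2 - fst w2) < 0" "(snd w1 - snd v2) * (snd w2 - snd v2) < 0"
      unfolding x0 y0 using between a b by auto
    moreover have "(fst v1, snd v2) = v1" "(fst v2, snd v2) = v2" "(fst w2, snd w1) = w1" "(fst w2, snd w2) = w2"
      using 3 by (auto simp: prod_eq_iff)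
    ultimately show ?thesis using block_points_cross[of "fst v1" "fst w2" "fst v2" "snd w1" "snd v2" "snd w2"]
      by simp
  next
    case 4
    then have y0: "snd w2 = (1 - a) * snd v1 + a * snd v2" and x0: "fst v2 = (1 - b) * fst w1 + b * fst w2"
      using fst snd by (simp_all add: const)
    have "snd v1 \<noteq> snd v2" "fst w1 \<noteq> fst w2" using 4 d by (auto simp: prod_eq_iff)
    then have "(fst w1 - fst v2) * (fst w2 - fst v2) < 0" "(snd v1 - snd w2) * (snd v2 - snd w2) < 0"
      unfolding x0 y0 using between a b by auto
    moreover have "(fst w1, snd w2) = w1" "(fst w2, snd w2) = w2" "(fst v2, snd v1) = v1" "(fst v2, snd v2) = v2"
      using 4 by (auto simp: prod_eq_iff)
    ultimately show ?thesis using block_points_cross[of "fst w1" "fst v2" "fst w2" "snd v1" "snd w2" "snd v2"]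
      by (simp add: insert_commute)
  qed
qed

text \<open>Adding a skew matrix with upper right entry sigma to a symmetric one adds sigma^2 to the
  determinant, and rank at most 1 means determinant zero. So sigma must be a square root of
  \<open>- det (A - B)\<close>.\<close>

lemma compatible_iff:
  assumes "A \<in> sym_mats" "B \<in> sym_mats"
  shows "compatible A B \<longleftrightarrow> det (A - B) \<le> 0"
proof -
  define D where "D = A - B"
  have D: "D $ 2 $ 1 = D $ 1 $ 2" using assms by (simp add: D_def mem_sym_mats)
  have rank: "rank M \<le> 1 \<longleftrightarrow> det M = 0" for M :: mat2
    by (simp add: det_eq_0_rank) linarith
  have skew: "det (D + S) = det D + (S $ 1 $ 2)\<^sup>2" if "transpose S = - S" for S :: mat2
  proof -
    have "S $ j $ i = - S $ i $ j" for i j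
      using arg_cong[OF that, of "\<lambda>M. M $ i $ j"] by (simp add: transpose_def)
    from this[of 1 1] this[of 2 2] this[of 1 2]
    have "S $ 1 $ 1 = 0" "S $ 2 $ 2 = 0" "S $ 2 $ 1 = - S $ 1 $ 2" by linarith+
    then show ?thesis using D by (simp add: det_2 power2_eq_square algebra_simps)
  qed
  show ?thesis
  proof
    assume "compatible A B"
    then obtain S :: mat2 where S: "transpose S = - S" "det (D + S) = 0"
      unfolding compatible_def rank D_def by blast
    then have "det D = - (S $ 1 $ 2)\<^sup>2" using skew by simp
    then show "det (A - B) \<le> 0" by (simp add: D_def)
  next
    assume le: "det (A - B) \<le> 0"
    define S :: mat2 where "S = vector [vector [0, sqrt (- det D)], vector [- sqrt (- det D), 0]]"
    have S: "transpose S = - S" by (simp add: S_def vec_eq_iff transpose_def forall_2)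
    have "det (D + S) = 0" using le unfolding skew[OF S] by (simp add: S_def D_def)
    with S show "compatible A B" unfolding compatible_def rank D_def by blast
  qed
qed

section \<open>Lamination hulls and their inclusion in the quasiconvex hull\<close>

lemma lamination_sym: "U \<subseteq> sym_mats \<Longrightarrow> lamination i U \<subseteq> sym_mats"
  by (induction i) (auto intro!: subspace_add subspace_scale subspace_sym_mats)

lemma lamination_mono:
  assumes "U \<subseteq> sym_mats" "i \<le> j"
  shows "lamination i U \<subseteq> lamination j U"
  using assms(2)
proof (induction rule: dec_induct)
  case (step n)
  have "A \<in> lamination (Suc n) U" if "A \<in> lamination n U" for A
  proof -
    have "compatible A A" using that lamination_sym[OF assms(1)] by (subst compatible_iff) (auto simp: det_2)
    then have "\<exists>l B C. A = l *\<^sub>R B + (1 - l) *\<^sub>R C \<and> l \<in> {0..1} \<and> B \<in> lamination n U \<and>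
        C \<in> lamination n U \<and> compatible B C"
      using that by (intro exI[of _ "1::real"] exI[of _ A]) simp
    then show ?thesis by simp
  qed
  with step show ?case by blast
qed simp

lemma sym_lamination_hull_combination:
  assumes U: "U \<subseteq> sym_mats" and AB: "A \<in> sym_lamination_hull U" "B \<in> sym_lamination_hull U"
    and det: "det (A - B) \<le> 0" and l: "0 \<le> l" "l \<le> 1"
  shows "l *\<^sub>R A + (1 - l) *\<^sub>R B \<in> sym_lamination_hull U"
proof -
  obtain i j where "A \<in> lamination i U" "B \<in> lamination j U" using AB by (auto simp: sym_lamination_hull_def)
  then have AB': "A \<in> lamination (max i j) U" "B \<in> lamination (max i j) U"
    using lamination_mono[OF U, of i "max i j"] lamination_mono[OF U, of j "max i j"] by auto
  then have "compatible A B" using det lamination_sym[OF U] by (subst compatible_iff) auto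
  then have "l *\<^sub>R A + (1 - l) *\<^sub>R B \<in> lamination (Suc (max i j)) U"
    unfolding lamination.simps using AB' l by (intro CollectI exI conjI refl) auto
  then show ?thesis unfolding sym_lamination_hull_def by blast
qed

lemma sym_lamination_hull_subset_quasiconvex_hull:
  assumes U: "U \<subseteq> sym_mats"
  shows "sym_lamination_hull U \<subseteq> sym_quasiconvex_hull U"
proof -
  have "ereal (f A) \<le> (SUP B\<in>U. ereal (f B))" if f: "sym_quasiconvex f" and A: "A \<in> lamination i U" for f i A
    using A
  proof (induction i arbitrary: A)
    case 0
    then show ?case by (auto intro: SUP_upper)
  next
    case (Suc i)
    then obtain l B C where A: "A = l *\<^sub>R B + (1 - l) *\<^sub>R C" and l: "0 \<le> l" "l \<le> 1"
      and BC: "B \<in> lamination i U" "C \<in> lamination i U" "compatible B C" by auto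
    have s: "B \<in> sym_mats" "C \<in> sym_mats" using BC lamination_sym[OF U] by auto
    have "f A \<le> l * f B + (1 - l) * f C"
      unfolding A using sym_quasiconvex_on_compatible_segment[OF f s _ l] BC(3) compatible_iff[OF s] by blast
    also have "\<dots> \<le> l * max (f B) (f C) + (1 - l) * max (f B) (f C)"
      using l by (intro add_mono mult_left_mono) auto
    finally have "f A \<le> max (f B) (f C)" by (simp add: algebra_simps)
    then have "ereal (f A) \<le> max (ereal (f B)) (ereal (f C))" by (simp add: max_def split: if_splits)
    also have "\<dots> \<le> (SUP B\<in>U. ereal (f B))" using Suc.IH BC by simp
    finally show ?case .
  qed
  then show ?thesis
    using lamination_sym[OF U] by (force simp: sym_lamination_hull_def sym_quasiconvex_hull_def)
qed

text \<open>\<open>N1\<close> and \<open>N2\<close> span the two directions parallel to the plane on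
  which \<open>det\<close> vanishes; \<open>X\<close> and \<open>Y\<close> represent the dual
  functionals, scaled so that \<open>det\<close> is exactly their product.\<close>

definition null_coordinates :: "mat2 \<Rightarrow> mat2 \<Rightarrow> mat2 \<Rightarrow> mat2 \<Rightarrow> mat2 \<Rightarrow> bool" where
  "null_coordinates Q X Y N1 N2 \<longleftrightarrow>
     N1 \<in> sym_mats \<and> N2 \<in> sym_mats \<and> Q \<bullet> N1 = 0 \<and> Q \<bullet> N2 = 0 \<and>
     X \<bullet> N1 = 1 \<and> X \<bullet> N2 = 0 \<and> Y \<bullet> N1 = 0 \<and> Y \<bullet> N2 = 1 \<and>
     (\<forall>M\<in>sym_mats. Q \<bullet> M = 0 \<longrightarrow>
        M = (X \<bullet> M) *\<^sub>R N1 + (Y \<bullet> M) *\<^sub>R N2 \<and> det M = (X \<bullet> M) * (Y \<bullet> M))"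

definition plane :: "mat2 \<Rightarrow> real \<Rightarrow> mat2 set" where
  "plane Q \<delta> = {M \<in> sym_mats. Q \<bullet> M = \<delta>}"

definition coords :: "mat2 \<Rightarrow> mat2 \<Rightarrow> mat2 \<Rightarrow> real \<times> real" where
  "coords X Y M = (X \<bullet> M, Y \<bullet> M)"

lemma plane_diff:
  assumes "A \<in> plane Q \<delta>" "B \<in> plane Q \<delta>"
  shows "A - B \<in> sym_mats" "Q \<bullet> (A - B) = 0"
  using assms subspace_diff[OF subspace_sym_mats] by (auto simp: plane_def inner_diff_right)

lemma gap_coords:
  assumes nc: "null_coordinates Q X Y N1 N2" and "A \<in> plane Q \<delta>" "B \<in> plane Q \<delta>"
  shows "gap (coords X Y A) (coords X Y B) = det (A - B)"
  using nc plane_diff[OF assms(2,3)] by (simp add: null_coordinates_def gap_def coords_def inner_diff_right)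

lemma coords_diff:
  assumes nc: "null_coordinates Q X Y N1 N2" and "A \<in> plane Q \<delta>" "B \<in> plane Q \<delta>"
  shows "A - B = (fst (coords X Y A) - fst (coords X Y B)) *\<^sub>R N1 + (snd (coords X Y A) - snd (coords X Y B)) *\<^sub>R N2"
proof -
  have "A - B = (X \<bullet> (A - B)) *\<^sub>R N1 + (Y \<bullet> (A - B)) *\<^sub>R N2"
    using nc plane_diff[OF assms(2,3)] unfolding null_coordinates_def by blast
  then show ?thesis by (simp only: coords_def fst_conv snd_conv inner_diff_right)
qed

lemma coords_inj:
  assumes "null_coordinates Q X Y N1 N2"
  shows "inj_on (coords X Y) (plane Q \<delta>)"
  by (rule inj_onI) (use coords_diff[OF assms] in force)

lemma plane_combination:
  assumes "A \<in> plane Q \<delta>" "B \<in> plane Q \<delta>"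
  shows "l *\<^sub>R A + (1 - l) *\<^sub>R B \<in> plane Q \<delta>"
proof -
  have "l * \<delta> + (1 - l) * \<delta> = \<delta>" by (simp add: algebra_simps)
  then show ?thesis using assms
    by (auto simp: plane_def inner_add_right intro!: subspace_add subspace_scale subspace_sym_mats)
qed

lemma lamination_plane: "U \<subseteq> plane Q \<delta> \<Longrightarrow> lamination i U \<subseteq> plane Q \<delta>"
  by (induction i) (auto intro!: plane_combination)

lemma no_three_aligned_coords:
  assumes co: "null_coordinates Q X Y N1 N2" and T: "T \<subseteq> plane Q \<delta>" and nc: "\<forall>A\<in>T. \<forall>B\<in>T. \<forall>C\<in>T. distinct [A, B, C] \<longrightarrow> \<not> collinear {A, B, C}"
  shows "no_three_aligned (coords X Y ` T)"
proof -
  have coll: "collinear {A, B, C}" if "A \<in> plane Q \<delta>" "B \<in> plane Q \<delta>" "C \<in> plane Q \<delta>"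
    "fst (coords X Y A) = fst (coords X Y B) \<and> fst (coords X Y B) = fst (coords X Y C) \<or>
     snd (coords X Y A) = snd (coords X Y B) \<and> snd (coords X Y B) = snd (coords X Y C)" for A B C
    using that(4)
  proof
    assume *: "fst (coords X Y A) = fst (coords X Y B) \<and> fst (coords X Y B) = fst (coords X Y C)"
    have "\<exists>c. M - M' = c *\<^sub>R N2" if "M \<in> {A, B, C}" "M' \<in> {A, B, C}" for M M'
      using coords_diff[OF co, of M \<delta> M'] that * \<open>A \<in> plane Q \<delta>\<close> \<open>B \<in> plane Q \<delta>\<close> \<open>C \<in> plane Q \<delta>\<close> by auto
    then show ?thesis unfolding collinear_def by blast
  next
    assume *: "snd (coords X Y A) = snd (coords X Y B) \<and> snd (coords X Y B) = snd (coords X Y C)"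
    have "\<exists>c. M - M' = c *\<^sub>R N1" if "M \<in> {A, B, C}" "M' \<in> {A, B, C}" for M M'
      using coords_diff[OF co, of M \<delta> M'] that * \<open>A \<in> plane Q \<delta>\<close> \<open>B \<in> plane Q \<delta>\<close> \<open>C \<in> plane Q \<delta>\<close> by auto
    then show ?thesis unfolding collinear_def by blast
  qed
  have "\<not> (fst u = fst v \<and> fst v = fst w) \<and> \<not> (snd u = snd v \<and> snd v = snd w)"
    if uvw: "u \<in> coords X Y ` T" "v \<in> coords X Y ` T" "w \<in> coords X Y ` T" "distinct [u, v, w]" for u v w
  proof -
    obtain A B C where "u = coords X Y A" "v = coords X Y B" "w = coords X Y C" "A \<in> T" "B \<in> T" "C \<in> T"
      using uvw by blast
    moreover from this have "distinct [A, B, C]" using uvw(4) by auto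
    ultimately have "\<not> collinear {A, B, C}" using nc by blast
    moreover note \<open>u = coords X Y A\<close> \<open>v = coords X Y B\<close> \<open>w = coords X Y C\<close> \<open>A \<in> T\<close> \<open>B \<in> T\<close> \<open>C \<in> T\<close>
    ultimately show ?thesis using coll[of A B C] T by auto
  qed
  then show ?thesis unfolding no_three_aligned_def by blast
qed

text \<open>Stated for any plane that contains the block: it is applied to the common plane of the
  wells and, before the normal of that one is understood, to the plane given with the block.\<close>

lemma block_points_four_well:
  assumes co: "null_coordinates Q X Y N1 N2" and T: "T \<subseteq> plane Q \<delta>" and block: "four_well_block T"
    and nc: "\<forall>A\<in>T. \<forall>B\<in>T. \<forall>C\<in>T. distinct [A, B, C] \<longrightarrow> \<not> collinear {A, B, C}"
  shows "block_points (coords X Y ` T)"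
proof -
  from block obtain V1 V2 W1 W2 U0 where VW: "T = {V1, V2, W1, W2}" "distinct [V1, V2, W1, W2]"
    "rank_one_compatible V1 V2" "rank_one_compatible W1 W2"
    "U0 \<in> rel_interior (convex hull {V1, V2})" "U0 \<in> rel_interior (convex hull {W1, W2})"
    unfolding four_well_block_def by blast
  have P: "V1 \<in> plane Q \<delta>" "V2 \<in> plane Q \<delta>" "W1 \<in> plane Q \<delta>" "W2 \<in> plane Q \<delta>" using T VW(1) by auto
  have "U0 \<in> open_segment V1 V2" "U0 \<in> open_segment W1 W2"
    using VW(2,5,6) rel_interior_closed_segment[of V1 V2] rel_interior_closed_segment[of W1 W2]
    by (auto simp: segment_convex_hull split: if_splits)
  then obtain a b where a: "0 < a" "a < 1" "U0 = (1 - a) *\<^sub>R V1 + a *\<^sub>R V2"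
    and b: "0 < b" "b < 1" "U0 = (1 - b) *\<^sub>R W1 + b *\<^sub>R W2"
    by (auto simp: in_segment)
  have "block_points {coords X Y V1, coords X Y V2, coords X Y W1, coords X Y W2}"
  proof (rule block_points_four[OF _ _ _ _ a(1,2) b(1,2)])
    show "gap (coords X Y V1) (coords X Y V2) = 0" "gap (coords X Y W1) (coords X Y W2) = 0"
      using VW(3,4) P by (simp_all add: gap_coords[OF co] rank_one_compatible_def)
    show "no_three_aligned {coords X Y V1, coords X Y V2, coords X Y W1, coords X Y W2}"
      using no_three_aligned_coords[OF co T nc] VW(1) by simp
    show "distinct [coords X Y V1, coords X Y V2, coords X Y W1, coords X Y W2]"
      using VW(2) P coords_inj[OF co, of \<delta>] by (auto simp: inj_on_def)
    have e: "(1 - a) *\<^sub>R V1 + a *\<^sub>R V2 = (1 - b) *\<^sub>R W1 + b *\<^sub>R W2" using a b by simp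
    show "(1 - a) * fst (coords X Y V1) + a * fst (coords X Y V2) = (1 - b) * fst (coords X Y W1) + b * fst (coords X Y W2)"
      using arg_cong[OF e, of "\<lambda>M. X \<bullet> M"] by (simp add: coords_def inner_add_right)
    show "(1 - a) * snd (coords X Y V1) + a * snd (coords X Y V2) = (1 - b) * snd (coords X Y W1) + b * snd (coords X Y W2)"
      using arg_cong[OF e, of "\<lambda>M. Y \<bullet> M"] by (simp add: coords_def inner_add_right)
  qed
  then show ?thesis using VW(1) by simp
qed

lemma block_points_three_well:
  assumes co: "null_coordinates Q X Y N1 N2" and T: "T \<subseteq> plane Q \<delta>" and block: "three_well_block T"
  shows "block_points (coords X Y ` T)"
proof -
  from block obtain A B C where ABC: "T = {A, B, C}" "compatible A B" "\<not> rank_one_compatible A B"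
    "rank_one_compatible B C" "\<not> compatible A C"
    unfolding three_well_block_def by blast
  have P: "A \<in> plane Q \<delta>" "B \<in> plane Q \<delta>" "C \<in> plane Q \<delta>" using T ABC(1) by auto
  then have s: "A \<in> sym_mats" "B \<in> sym_mats" "C \<in> sym_mats" by (auto simp: plane_def)
  have "block_points {coords X Y A, coords X Y B, coords X Y C}"
    using ABC P by (intro block_points_three)
      (auto simp: gap_coords[OF co] rank_one_compatible_def compatible_iff s)
  then show ?thesis using ABC(1) by simp
qed

lemma quasiconvex_hull_subset_lamination_hull:
  assumes co: "null_coordinates Q X Y N1 N2" and U: "U \<subseteq> plane Q \<delta>" and st: "staircase (coords X Y ` U)"
  shows "sym_quasiconvex_hull U \<subseteq> sym_lamination_hull U"
proof
  fix M assume M: "M \<in> sym_quasiconvex_hull U"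
  then have Ms: "M \<in> sym_mats" by (simp add: sym_quasiconvex_hull_def)
  have Us: "U \<subseteq> sym_mats" using U by (auto simp: plane_def)
  have le: "L \<bullet> M - k * det M \<le> c" if "k \<ge> 0" "\<And>B. B \<in> U \<Longrightarrow> L \<bullet> B - k * det B \<le> c" for L k c
  proof -
    have "ereal (L \<bullet> M - k * det M) \<le> (SUP B\<in>U. ereal (L \<bullet> B - k * det B))"
      using M sym_quasiconvex_linear_minus_det[OF that(1), of L] unfolding sym_quasiconvex_hull_def by blast
    also have "\<dots> \<le> ereal c" using that(2) by (intro SUP_least) simp
    finally show ?thesis by simp
  qed
  have QU: "Q \<bullet> B = \<delta>" if "B \<in> U" for B using U that by (auto simp: plane_def)
  \<comment> \<open>The affine functions given by \<open>Q\<close> and \<open>- Q\<close> keep the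
    quasiconvex hull in the plane of the wells.\<close>
  have "Q \<bullet> M = \<delta>"
    using le[of 0 Q \<delta>] le[of 0 "- Q" "- \<delta>"] QU by (simp add: inner_minus_left)
  with Ms have MP: "M \<in> plane Q \<delta>" by (simp add: plane_def)
  have LP: "sym_lamination_hull U \<subseteq> plane Q \<delta>"
    unfolding sym_lamination_hull_def using lamination_plane[OF U] by blast
  have "(fst (coords X Y M), snd (coords X Y M)) \<in> coords X Y ` sym_lamination_hull U"
  proof (rule staircase_separation[OF st])
    have "U \<subseteq> sym_lamination_hull U" unfolding sym_lamination_hull_def
      using lamination.simps(1) by (metis UN_upper UNIV_I)
    then show "coords X Y ` U \<subseteq> coords X Y ` sym_lamination_hull U" by blast
    show "gap_convex (coords X Y ` sym_lamination_hull U)"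
      unfolding gap_convex_def
    proof (intro ballI allI impI)
      fix a b and l :: real
      assume "a \<in> coords X Y ` sym_lamination_hull U" "b \<in> coords X Y ` sym_lamination_hull U"
        and g: "gap a b \<le> 0" and l: "0 \<le> l" "l \<le> 1"
      then obtain A B where AB: "a = coords X Y A" "b = coords X Y B" "A \<in> sym_lamination_hull U" "B \<in> sym_lamination_hull U"
        by blast
      then have "A \<in> plane Q \<delta>" "B \<in> plane Q \<delta>" using LP by blast+
      then have "det (A - B) \<le> 0" using g gap_coords[OF co, of A \<delta> B] AB(1,2) by simp
      then have "l *\<^sub>R A + (1 - l) *\<^sub>R B \<in> sym_lamination_hull U"
        using sym_lamination_hull_combination[OF Us AB(3,4)] l by blast
      moreover have "(l * fst a + (1 - l) * fst b, l * snd a + (1 - l) * snd b) = coords X Y (l *\<^sub>R A + (1 - l) *\<^sub>R B)"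
        by (simp add: AB coords_def inner_add_right)
      ultimately show "(l * fst a + (1 - l) * fst b, l * snd a + (1 - l) * snd b) \<in> coords X Y ` sym_lamination_hull U"
        by simp
    qed
  next
    fix P assume P: "\<And>u. u \<in> coords X Y ` U \<Longrightarrow> 0 \<le> gap u P"
    \<comment> \<open>The matrix of the plane with coordinates \<open>P\<close>, obtained by
      correcting \<open>M\<close> along the null directions.\<close>
    define Z where "Z = M + (fst P - X \<bullet> M) *\<^sub>R N1 + (snd P - Y \<bullet> M) *\<^sub>R N2"
    have Z: "Z \<in> plane Q \<delta>" "coords X Y Z = P"
      using MP co unfolding Z_def
      by (auto simp: null_coordinates_def plane_def coords_def inner_add_right prod_eq_iff intro!: subspace_add subspace_scale subspace_sym_mats)
    \<comment> \<open>The cofactor matrix of \<open>Z\<close>: for symmetric \<open>B\<close>,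
      \<open>det (B - Z)\<close> is \<open>det B - L \<bullet> B + det Z\<close>, so
      \<open>- det (B - Z)\<close> is of the admissible form up to a constant.\<close>
    define L :: mat2 where "L = vector [vector [Z $ 2 $ 2, - Z $ 1 $ 2], vector [- Z $ 1 $ 2, Z $ 1 $ 1]]"
    have L: "L \<bullet> B - 1 * det B = det Z - gap (coords X Y B) P" if "B \<in> plane Q \<delta>" for B
    proof -
      have "gap (coords X Y B) P = det (B - Z)" using gap_coords[OF co that Z(1)] Z(2) by simp
      then show ?thesis using that Z(1)
        by (simp add: L_def det_2 inner_vec_def sum_2 plane_def mem_sym_mats algebra_simps)
    qed
    have "L \<bullet> M - 1 * det M \<le> det Z"
    proof (rule le)
      fix B assume "B \<in> U"
      then show "L \<bullet> B - 1 * det B \<le> det Z" using L[of B] P[of "coords X Y B"] U by auto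
    qed simp
    then show "0 \<le> gap (fst (coords X Y M), snd (coords X Y M)) P" using L[OF MP] by simp
  next
    fix \<alpha> \<beta> \<gamma> assume u: "\<And>u. u \<in> coords X Y ` U \<Longrightarrow> \<gamma> \<le> \<alpha> * fst u + \<beta> * snd u"
    have "(- \<alpha> *\<^sub>R X - \<beta> *\<^sub>R Y) \<bullet> M - 0 * det M \<le> - \<gamma>"
    proof (rule le)
      fix B assume "B \<in> U"
      then show "(- \<alpha> *\<^sub>R X - \<beta> *\<^sub>R Y) \<bullet> B - 0 * det B \<le> - \<gamma>"
        using u[of "coords X Y B"] by (simp add: coords_def inner_diff_left)
    qed simp
    then show "\<gamma> \<le> \<alpha> * fst (coords X Y M) + \<beta> * snd (coords X Y M)"
      by (simp add: coords_def inner_diff_left)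
  qed
  then obtain M' where M': "M' \<in> sym_lamination_hull U" "coords X Y M' = coords X Y M" by auto
  then have "M' = M" using coords_inj[OF co, of \<delta>] LP MP by (auto simp: inj_on_def)
  with M' show "M \<in> sym_lamination_hull U" by simp
qed

section \<open>Basic configurations\<close>

text \<open>\<open>Q\<close> is the symmetric product of two vectors \<open>p\<close> and
  \<open>r\<close>, independent because \<open>det Q\<close> is minus a quarter of the square of
  their cross product \<open>w\<close>. The rank-one squares of the vectors orthogonal to
  \<open>p\<close> and to \<open>r\<close> are then orthogonal to \<open>Q\<close>, and they are the
  null directions.\<close>

lemma null_coordinates_exist:
  assumes Q: "Q \<in> sym_mats" "det Q < 0"
  obtains X Y N1 N2 where "null_coordinates Q X Y N1 N2"
proof -
  have "Q \<noteq> 0" using Q(2) by (auto simp: det_2)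
  with Q obtain p r where pr: "Q = sym_outer p r"
    by (meson det_nonpos_sym_outer less_imp_le)
  define w where "w = p $ 1 * r $ 2 - p $ 2 * r $ 1"
  have "det Q = - (w / 2)\<^sup>2" by (simp add: pr w_def det_2 sym_outer_def power2_eq_square field_simps)
  then have w: "w \<noteq> 0" using Q(2) by auto
  \<comment> \<open>The factors \<open>1 / w\<^sup>2\<close> normalise the duality, since all
    nonzero pairings equal \<open>w\<^sup>2\<close>; they also give
    \<open>det (N1 + N2) = 1\<close>, as the product formula demands.\<close>
  define X Y N1 N2 where "X = sym_outer p p" and "Y = (1 / w\<^sup>2) *\<^sub>R sym_outer r r"
    and "N1 = (1 / w\<^sup>2) *\<^sub>R sym_outer (rot90 r) (rot90 r)" and "N2 = sym_outer (rot90 p) (rot90 p)"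
  have in2: "A \<bullet> B = A$1$1 * B$1$1 + A$1$2 * B$1$2 + A$2$1 * B$2$1 + A$2$2 * B$2$2" for A B :: mat2
    by (simp add: inner_vec_def sum_2)
  have N: "N1 \<in> sym_mats" "N2 \<in> sym_mats"
    unfolding N1_def N2_def by (intro subspace_scale subspace_sym_mats sym_outer_sym)+
    have "sym_outer p r \<bullet> sym_outer (rot90 z) (rot90 z) = 0" if "z \<in> {p, r}" for z
      using that by (auto simp: in2 sym_outer_def rot90_def field_simps)
    moreover have "sym_outer z z \<bullet> sym_outer (rot90 z) (rot90 z) = 0" for z
      by (simp add: in2 sym_outer_def rot90_def algebra_simps)
    ultimately have orth: "Q \<bullet> N1 = 0" "Q \<bullet> N2 = 0" "X \<bullet> N2 = 0" "Y \<bullet> N1 = 0"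
      by (simp_all add: pr X_def Y_def N1_def N2_def)
    have "sym_outer p p \<bullet> sym_outer (rot90 r) (rot90 r) = w\<^sup>2" "sym_outer r r \<bullet> sym_outer (rot90 p) (rot90 p) = w\<^sup>2"
      by (simp_all add: in2 sym_outer_def rot90_def w_def power2_eq_square algebra_simps)
    then have unit: "X \<bullet> N1 = 1" "Y \<bullet> N2 = 1" using w by (simp_all add: X_def Y_def N1_def N2_def)
  have "M = (X \<bullet> M) *\<^sub>R N1 + (Y \<bullet> M) *\<^sub>R N2 \<and> det M = (X \<bullet> M) * (Y \<bullet> M)"
    if M: "M \<in> sym_mats" "Q \<bullet> M = 0" for M
  proof
    have sym: "M $ 2 $ 1 = M $ 1 $ 2" using M(1) by (simp add: mem_sym_mats)
    have e: "p$1 * r$1 * M$1$1 + (p$1 * r$2 + p$2 * r$1) * M$1$2 + p$2 * r$2 * M$2$2 = 0"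
      using M(2) by (simp add: in2 pr sym_outer_def sym field_simps)
    let ?P = "sym_outer p p \<bullet> M" and ?R = "sym_outer r r \<bullet> M"
    have P: "?P = p$1 * p$1 * M$1$1 + 2 * p$1 * p$2 * M$1$2 + p$2 * p$2 * M$2$2"
      and R: "?R = r$1 * r$1 * M$1$1 + 2 * r$1 * r$2 * M$1$2 + r$2 * r$2 * M$2$2"
      by (simp_all add: in2 sym_outer_def sym algebra_simps)
    \<comment> \<open>Polynomial identities for every symmetric \<open>M\<close>, with the multiple
      of \<open>Q \<bullet> M\<close> written out so that ring normalisation proves them;
      \<open>e\<close> removes that multiple afterwards.\<close>
    have 11: "w\<^sup>2 * M$1$1 = ?P * (r$2 * r$2) + ?R * (p$2 * p$2)
        - 2 * (r$2 * p$2) * (p$1 * r$1 * M$1$1 + (p$1 * r$2 + p$2 * r$1) * M$1$2 + p$2 * r$2 * M$2$2)"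
      and 12: "w\<^sup>2 * M$1$2 = - ?P * (r$1 * r$2) - ?R * (p$1 * p$2)
        + (r$1 * p$2 + r$2 * p$1) * (p$1 * r$1 * M$1$1 + (p$1 * r$2 + p$2 * r$1) * M$1$2 + p$2 * r$2 * M$2$2)"
      and 22: "w\<^sup>2 * M$2$2 = ?P * (r$1 * r$1) + ?R * (p$1 * p$1)
        - 2 * (r$1 * p$1) * (p$1 * r$1 * M$1$1 + (p$1 * r$2 + p$2 * r$1) * M$1$2 + p$2 * r$2 * M$2$2)"
      unfolding P R w_def power2_eq_square by (simp_all add: algebra_simps)
    have comp: "M$1$1 = (?P * (r$2 * r$2) + ?R * (p$2 * p$2)) / w\<^sup>2"
      "M$1$2 = (- ?P * (r$1 * r$2) - ?R * (p$1 * p$2)) / w\<^sup>2"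
      "M$2$2 = (?P * (r$1 * r$1) + ?R * (p$1 * p$1)) / w\<^sup>2"
      using 11 12 22 w unfolding e by (simp_all add: field_simps)
    show "M = (X \<bullet> M) *\<^sub>R N1 + (Y \<bullet> M) *\<^sub>R N2"
      unfolding vec_eq_iff forall_2 sym
      by (simp only: comp) (simp add: X_def Y_def N1_def N2_def sym_outer_def rot90_def add_divide_distrib diff_divide_distrib mult_ac)
    have "w\<^sup>2 * det M = ?P * ?R - (p$1 * r$1 * M$1$1 + (p$1 * r$2 + p$2 * r$1) * M$1$2 + p$2 * r$2 * M$2$2)\<^sup>2"
      unfolding P R w_def power2_eq_square by (simp add: det_2 sym algebra_simps)
    then have "det M = ?P * ?R / w\<^sup>2" using w unfolding e by (simp add: field_simps)
    then show "det M = (X \<bullet> M) * (Y \<bullet> M)" by (simp add: X_def Y_def)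
  qed
  then have "null_coordinates Q X Y N1 N2"
    using N orth unit by (simp add: null_coordinates_def)
  then show ?thesis by (rule that)
qed

text \<open>A symmetric matrix with positive determinant is definite, and a nonzero one with
  nonnegative determinant is semidefinite; the inner product of two such matrices cannot
  vanish.\<close>

lemma det_normal_neg:
  assumes Q: "Q \<in> sym_mats" "Q \<noteq> 0" and M: "M \<in> sym_mats" "det M > 0" "Q \<bullet> M = 0"
  shows "det Q < 0"
proof -
  define a b c where "a = Q $ 1 $ 1" and "b = Q $ 1 $ 2" and "c = Q $ 2 $ 2"
  define u v w where "u = M $ 1 $ 1" and "v = M $ 1 $ 2" and "w = M $ 2 $ 2"
  have sym: "Q $ 2 $ 1 = b" "M $ 2 $ 1 = v" using Q M by (simp_all add: mem_sym_mats b_def v_def)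
  have d: "u * w > v * v" using M(2) by (simp add: det_2 sym u_def v_def w_def)
  have o: "a * u + 2 * b * v + c * w = 0"
    using M(3) by (simp add: inner_vec_def sum_2 sym; simp add: a_def b_def c_def u_def v_def w_def algebra_simps)
  have "a * c < b * b"
  proof (rule ccontr)
    assume n: "\<not> a * c < b * b"
    \<comment> \<open>The squared orthogonality relation, rearranged into terms that would all be
      nonnegative if \<open>a * c\<close> were at least \<open>b * b\<close>.\<close>
    have "(a * u - c * w)\<^sup>2 + 4 * ((a * c - b * b) * (u * w)) + 4 * (b * b * (u * w - v * v)) = 0"
    proof -
      have "a * u + c * w = - (2 * b * v)" using o by linarith
      then have "(a * u + c * w)\<^sup>2 = (2 * b * v)\<^sup>2" by simp
      then show ?thesis by (simp add: power2_eq_square algebra_simps)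
    qed
    moreover have uw: "u * w > 0" using d zero_le_square[of v] by linarith
    then have "(a * c - b * b) * (u * w) \<ge> 0" using n by (simp add: mult_nonneg_nonneg)
    moreover have "b * b * (u * w - v * v) \<ge> 0" using d by simp
    moreover have "(a * u - c * w)\<^sup>2 \<ge> 0" by simp
    ultimately have "(a * u - c * w)\<^sup>2 = 0" "b * b * (u * w - v * v) = 0" by linarith+
    then have "b = 0" "a * u = c * w" using d by auto
    with o have "a * u = 0" "c * w = 0" by auto
    then have "a = 0" "c = 0" using uw by auto
    with \<open>b = 0\<close> have "Q = 0" using sym by (simp add: vec_eq_iff forall_2 a_def b_def c_def)
    with Q(2) show False by simp
  qed
  then show ?thesis by (simp add: det_2 sym a_def b_def c_def)
qed

text \<open>For four wells the definition names no incompatible pair; it is found in null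
  coordinates of the plane given with the block, whose normal has negative determinant.\<close>

lemma basic_block_incompatible_pair:
  assumes T: "basic_block T" "T \<subseteq> sym_mats"
    and nc: "\<forall>A\<in>T. \<forall>B\<in>T. \<forall>C\<in>T. distinct [A, B, C] \<longrightarrow> \<not> collinear {A, B, C}"
  obtains A B where "A \<in> T" "B \<in> T" "det (A - B) > 0"
proof (cases "three_well_block T")
  case True
  then obtain A C where "A \<in> T" "C \<in> T" "\<not> compatible A C" unfolding three_well_block_def by auto
  then show ?thesis using that compatible_iff[of A C] T(2) by fastforce
next
  case False
  then have block: "four_well_block T" using T(1) by (simp add: basic_block_def)
  then obtain Q \<delta> where Q: "Q \<in> sym_mats" "det Q < 0" "\<forall>A\<in>T. Q \<bullet> A = \<delta>"
    unfolding four_well_block_def by blast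
  obtain X Y N1 N2 where co: "null_coordinates Q X Y N1 N2" using null_coordinates_exist[OF Q(1,2)] .
  have TP: "T \<subseteq> plane Q \<delta>" using T(2) Q(3) by (auto simp: plane_def)
  obtain A B where "A \<in> T" "B \<in> T" "gap (coords X Y A) (coords X Y B) > 0"
    using block_points_four_well[OF co TP block nc] unfolding block_points_def by blast
  moreover from this have "gap (coords X Y A) (coords X Y B) = det (A - B)" using TP by (intro gap_coords[OF co]) auto
  ultimately show ?thesis using that by metis
qed

text \<open>Starting from a strictly compatible pair of the first block, each block is attached at a
  strictly compatible pair already present, which all its other points extend.\<close>

lemma staircase_chain:
  fixes P :: "nat \<Rightarrow> (real \<times> real) set"
  assumes W: "no_three_aligned (\<Union>i\<in>{1..n}. P i)" and "n \<ge> 1"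
    and block: "\<And>i. i \<in> {1..n} \<Longrightarrow> block_points (P i)"
    and shared: "\<And>i. 1 \<le> i \<Longrightarrow> i < n \<Longrightarrow> \<exists>p q. {p, q} \<subseteq> P i \<inter> P (i + 1) \<and> gap p q < 0"
  shows "staircase (\<Union>i\<in>{1..n}. P i)"
proof -
  have "staircase (\<Union>i\<in>{1..j}. P i)" if "1 \<le> j" "j \<le> n" for j
    using that
  proof (induction j rule: dec_induct)
    case base
    then have "1 \<in> {1..n}" by simp
    from block[OF this] obtain p q where pq: "p \<in> P 1" "q \<in> P 1" "gap p q < 0" "finite (P 1)"
      "\<And>c. c \<in> P 1 - {p, q} \<Longrightarrow> extends_pair p q c" unfolding block_points_def by blast
    have "staircase ({p, q} \<union> P 1)"
      using pq \<open>1 \<in> {1..n}\<close> by (intro staircase_union[OF staircase_pair W _ _ _ _ pq(4,5)]) auto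
    moreover have "{p, q} \<union> P 1 = P 1" using pq by auto
    ultimately show ?case by simp
  next
    case (step j)
    then obtain p q where pq: "{p, q} \<subseteq> P j \<inter> P (j + 1)" "gap p q < 0" using shared[of j] by auto
    have j: "Suc j \<in> {1..n}" using step by simp
    have "staircase ((\<Union>i\<in>{1..j}. P i) \<union> P (Suc j))"
    proof (rule staircase_union[OF _ W, of _ _ p q])
      show "staircase (\<Union>i\<in>{1..j}. P i)" using step by simp
      show "(\<Union>i\<in>{1..j}. P i) \<union> P (Suc j) \<subseteq> (\<Union>i\<in>{1..n}. P i)" using step j by force
      show "p \<in> (\<Union>i\<in>{1..j}. P i)" "q \<in> (\<Union>i\<in>{1..j}. P i)" using pq step by auto
      show "finite (P (Suc j))" using block[OF j] by (simp add: block_points_def)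
      show "extends_pair p q c" if "c \<in> P (Suc j) - {p, q}" for c
        using block[OF j] pq that unfolding block_points_def by auto
    qed (rule pq)
    moreover have "{1..Suc j} = insert (Suc j) {1..j}" by auto
    ultimately show ?case by (simp add: Un_commute)
  qed
  then show ?thesis using assms(2) by blast
qed

theorem theorem2p3:
  fixes U :: "(real^2^2) set"
  assumes "U \<subseteq> sym_mats"
    and "finite U"
    and "coplanar_wells U"
    and "basic_configuration U"
  shows "sym_lamination_hull U = sym_quasiconvex_hull U"
proof -
  from assms(4) have nc: "\<forall>A\<in>U. \<forall>B\<in>U. \<forall>C\<in>U. distinct [A, B, C] \<longrightarrow> \<not> collinear {A, B, C}"
    unfolding basic_configuration_def by (elim conjE)
  from assms(4) obtain n and Ub :: "nat \<Rightarrow> mat2 set" where n: "n \<ge> 1" and U: "U = (\<Union>i\<in>{1..n}. Ub i)"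
    and blocks: "\<forall>i\<in>{1..n}. basic_block (Ub i)"
    and chain: "\<forall>i. 1 \<le> i \<and> i < n \<longrightarrow> (\<exists>V W. V \<noteq> W \<and> Ub i \<inter> Ub (i + 1) = {V, W} \<and> det (V - W) < 0)"
    unfolding basic_configuration_def by (elim conjE exE) (rule that; assumption)
  note Ub = U bspec[OF blocks]
  obtain Q \<delta> where Q: "Q \<in> sym_mats" "Q \<noteq> 0" "\<And>A. A \<in> U \<Longrightarrow> Q \<bullet> A = \<delta>"
    using assms(3) unfolding coplanar_wells_def by blast
  have sub: "Ub i \<subseteq> U" if "i \<in> {1..n}" for i using that Ub(1) by blast
  have nc': "\<forall>A\<in>Ub i. \<forall>B\<in>Ub i. \<forall>C\<in>Ub i. distinct [A, B, C] \<longrightarrow> \<not> collinear {A, B, C}" if "i \<in> {1..n}" for i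
    using nc sub[OF that] by blast
  have "1 \<in> {1..n}" using n by simp
  \<comment> \<open>One block suffices to determine the sign of \<open>det Q\<close>, since all
    wells share the plane.\<close>
  then have "basic_block (Ub 1)" "Ub 1 \<subseteq> sym_mats" using Ub(2) sub[of 1] assms(1) by auto
  then obtain A B where AB: "A \<in> Ub 1" "B \<in> Ub 1" "det (A - B) > 0"
    using basic_block_incompatible_pair[OF _ _ nc'[OF \<open>1 \<in> {1..n}\<close>]] by blast
  then have "A \<in> U" "B \<in> U" using sub[OF \<open>1 \<in> {1..n}\<close>] by auto
  then have "det Q < 0"
    by (intro det_normal_neg[OF Q(1,2) _ AB(3)] subspace_diff[OF subspace_sym_mats])
      (use Q(3) assms(1) in \<open>auto simp: inner_diff_right\<close>)
  then obtain X Y N1 N2 where co: "null_coordinates Q X Y N1 N2" using null_coordinates_exist[OF Q(1)] by blast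
  have UP: "U \<subseteq> plane Q \<delta>" using assms(1) Q(3) by (auto simp: plane_def)
  have img: "coords X Y ` U = (\<Union>i\<in>{1..n}. coords X Y ` Ub i)" unfolding Ub(1) by blast
  have "staircase (coords X Y ` U)"
    unfolding img
  proof (rule staircase_chain[OF _ n])
    show "no_three_aligned (\<Union>i\<in>{1..n}. coords X Y ` Ub i)"
      using no_three_aligned_coords[OF co UP nc] unfolding img .
    show "block_points (coords X Y ` Ub i)" if i: "i \<in> {1..n}" for i
    proof -
      have "Ub i \<subseteq> plane Q \<delta>" using sub[OF i] UP by blast
      then show ?thesis
        using Ub(2)[OF i] block_points_three_well[OF co, of "Ub i"] block_points_four_well[OF co _ _ nc'[OF i]]
        unfolding basic_block_def by auto
    qed
    show "\<exists>p q. {p, q} \<subseteq> coords X Y ` Ub i \<inter> coords X Y ` Ub (i + 1) \<and> gap p q < 0" if i: "1 \<le> i" "i < n" for i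
    proof -
      obtain V W where VW: "Ub i \<inter> Ub (i + 1) = {V, W}" "det (V - W) < 0" using chain i by blast
      then have "V \<in> plane Q \<delta>" "W \<in> plane Q \<delta>" using sub[of i] UP i by auto
      then have "gap (coords X Y V) (coords X Y W) < 0" using VW(2) by (simp add: gap_coords[OF co])
      moreover have "{coords X Y V, coords X Y W} \<subseteq> coords X Y ` Ub i \<inter> coords X Y ` Ub (i + 1)" using VW(1) by blast
      ultimately show ?thesis by blast
    qed
  qed
  then show ?thesis
    using sym_lamination_hull_subset_quasiconvex_hull[OF assms(1)] quasiconvex_hull_subset_lamination_hull[OF co UP] by blast
qed

end
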